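(* Let $\{(X_i,d_i,\nu_i)\}_{i=1}^\infty$ be a sequence of compact measured length spaces with $\lim_{i\to\infty}(X_i,d_i,\nu_i)=(X,d,\nu)$ in the measured Gromov--Hausdorff topology. (a) For any $N\in[1,\infty)$, if each $(X_i,d_i,\nu_i)$ has nonnegative $N$-Ricci curvature, then $(X,d,\nu)$ has nonnegative $N$-Ricci curvature. (b) For any $K\in\mathbb{R}$, if each $(X_i,d_i,\nu_i)$ has $\infty$-Ricci curvature bounded below by $K$, then $(X,d,\nu)$ has $\infty$-Ricci curvature bounded below by $K$.
   Context: A compact measured length space $(X,d,\nu)$ is a compact length space $(X,d)$ (the distance is the infimum of lengths of joining curves) with a Borel probability measure $\nu$. An $\epsilon$-Gromov--Hausdorff approximation $f:X_1\to X_2$ between compact metric spaces is a (not necessarily continuous, assumed Borel) map with $|d_2(f(x),f(x'))-d_1(x,x')|\le\epsilon$ for all $x,x'\in X_1$ and such that every point of $X_2$ is within distance $\epsilon$ of $f(X_1)$ (i.e. for every $x_2\in X_2$ there is $x_1\in X_1$ with $d_2(f(x_1),x_2)\le\epsilon$). $(X_i,d_i,\nu_i)\to(X,d,\nu)$ in the measured Gromov--Hausdorff topology means that there are Borel $\epsilon_i$-approximations $f_i:X_i\to X$ with $\epsilon_i\to0$ and $(f_i)_*\nu_i\to\nu$ in the weak-$*$ topology on Borel probability measures; here $(X,d)$ is a compact metric space with Borel probability measure $\nu$ (the limit is then automatically a length space). $P_2(X)$ is the set of Borel probability measures on $X$ with the quadratic Wasserstein metric $W_2(\mu_0,\mu_1)^2=\inf_\pi\int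 d(x_0,x_1)^2\,d\pi$ ($\pi$ ranging over couplings of $\mu_0,\mu_1$). A Wasserstein geodesic $\{\mu_t\}_{t\in[0,1]}$ is a minimizing geodesic of $P_2(X)$, parametrized so that $W_2(\mu_t,\mu_s)=|t-s|W_2(\mu_0,\mu_1)$. For a continuous convex $U:[0,\infty)\to\mathbb{R}$ with $U(0)=0$, put $U'(\infty)=\lim_{r\to\infty}U(r)/r$ and $U_\nu(\mu)=\int_X U(\rho)\,d\nu+U'(\infty)\mu_s(X)\in\mathbb{R}\cup\{\infty\}$, where $\mu=\rho\nu+\mu_s$ is the Lebesgue decomposition of $\mu$ with respect to $\nu$ (convention $\infty\cdot0=0$). $\mathcal{DC}_N$ ($N\in[1,\infty)$) is the set of such $U$ for which $\lambda\mapsto\lambda^N U(\lambda^{-N})$ is convex on $(0,\infty)$; $\mathcal{DC}_\infty$ is the set of such $U$ for which $\lambda\mapsto e^\lambda U(e^{-\lambda})$ is convex on $\mathbb{R}$. $(X,d,\nu)$ has nonnegative $N$-Ricci curvature if for all $\mu_0,\mu_1\in P_2(X)$ with supports contained in $\mathrm{supp}(\nu)$ there is some Wasserstein geodesic $\{\mu_t\}$ from $\mu_0$ to $\mu_1$ such that for all $U\in\mathcal{DC}_N$ and all $t\in[0,1]$: $U_\nu(\mu_t)\le tU_\nu(\mu_1)+(1-t)U_\nu(\mu_0)$. Given $K\in\mathbb{R}$, for $U\in\mathcal{DC}_\infty$ put $p(r)=rU'_+(r)-U(r)$ ($U'_+$ the right derivative) and $\lambda(U)=\inf_{r>0}K\frac{p(r)}{r}\in\mathbb{R}\cup\{-\infty\}$.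 $(X,d,\nu)$ has $\infty$-Ricci curvature bounded below by $K$ if for all $\mu_0,\mu_1\in P_2(X)$ with supports in $\mathrm{supp}(\nu)$ there is some Wasserstein geodesic $\{\mu_t\}$ from $\mu_0$ to $\mu_1$ such that for all $U\in\mathcal{DC}_\infty$ and $t\in[0,1]$: $U_\nu(\mu_t)\le tU_\nu(\mu_1)+(1-t)U_\nu(\mu_0)-\frac12\lambda(U)t(1-t)W_2(\mu_0,\mu_1)^2$. *)

theory Defs
  imports "HOL-Probability.Probability"
begin

section \<open>Measured length spaces\<close>

definition borel_metric :: "'a metric \<Rightarrow> 'a measure" where
  "borel_metric X = sigma (mspace X) {S. openin (mtopology_of X) S}"

definition curve_length :: "'a metric \<Rightarrow> (real \<Rightarrow> 'a) \<Rightarrow> ereal" where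
  "curve_length X \<gamma> =
    (SUP (n, s) \<in> {(n::nat, s::nat \<Rightarrow> real). s 0 = 0 \<and> s n = 1 \<and> mono_on {..n} s}.
       ereal (\<Sum>k<n. mdist X (\<gamma> (s k)) (\<gamma> (s (Suc k)))))"

text \<open>The infimum is taken in the extended reals, so two points that are not joined by a curve
  of finite length violate the condition.\<close>

definition length_space :: "'a metric \<Rightarrow> bool" where
  "length_space X \<longleftrightarrow>
    (\<forall>x\<in>mspace X. \<forall>y\<in>mspace X.
       ereal (mdist X x y) =
         (INF \<gamma> \<in> {\<gamma>. pathin (mtopology_of X) \<gamma> \<and> \<gamma> 0 = x \<and> \<gamma> 1 = y}. curve_length X \<gamma>))"

text \<open>The underlying set of \<open>P\<^sub>2(X)\<close>. All spaces considered are compact, so there is no condition on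
  second moments.\<close>

definition P2 :: "'a metric \<Rightarrow> 'a measure set" where
  "P2 X = {\<mu>. sets \<mu> = sets (borel_metric X) \<and> prob_space \<mu>}"

definition compact_measured_length_space :: "'a metric \<Rightarrow> 'a measure \<Rightarrow> bool" where
  "compact_measured_length_space X \<nu> \<longleftrightarrow>
    compact_space (mtopology_of X) \<and> length_space X \<and> \<nu> \<in> P2 X"

definition measure_support :: "'a metric \<Rightarrow> 'a measure \<Rightarrow> 'a set" where
  "measure_support X \<mu> =
    {x \<in> mspace X. \<forall>S. openin (mtopology_of X) S \<and> x \<in> S \<longrightarrow> emeasure \<mu> S > 0}"


section \<open>Measured Gromov--Hausdorff convergence\<close>

definition GH_approximation ::
    "real \<Rightarrow> 'a metric \<Rightarrow> 'b metric \<Rightarrow> ('a \<Rightarrow> 'b) \<Rightarrow> bool" where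
  "GH_approximation \<epsilon> X Y f \<longleftrightarrow>
    f \<in> measurable (borel_metric X) (borel_metric Y) \<and>
    (\<forall>x\<in>mspace X. \<forall>x'\<in>mspace X. \<bar>mdist Y (f x) (f x') - mdist X x x'\<bar> \<le> \<epsilon>) \<and>
    (\<forall>y\<in>mspace Y. \<exists>x\<in>mspace X. mdist Y (f x) y \<le> \<epsilon>)"

text \<open>Test functions range over all continuous real functions; on a compact space these are bounded.\<close>

definition weak_star_converges ::
    "'a metric \<Rightarrow> (nat \<Rightarrow> 'a measure) \<Rightarrow> 'a measure \<Rightarrow> bool" where
  "weak_star_converges X \<mu> \<mu>' \<longleftrightarrow>
    (\<forall>\<phi>. continuous_map (mtopology_of X) euclideanreal \<phi> \<longrightarrow>
       (\<lambda>i. integral\<^sup>L (\<mu> i) \<phi>) \<longlonglongrightarrow> integral\<^sup>L \<mu>' \<phi>)"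

definition mGH_converges ::
    "(nat \<Rightarrow> 'a metric) \<Rightarrow> (nat \<Rightarrow> 'a measure) \<Rightarrow> 'b metric \<Rightarrow> 'b measure \<Rightarrow> bool" where
  "mGH_converges X \<nu> Y \<nu>' \<longleftrightarrow>
    (\<exists>(f :: nat \<Rightarrow> 'a \<Rightarrow> 'b) (\<epsilon> :: nat \<Rightarrow> real).
       (\<forall>i. GH_approximation (\<epsilon> i) (X i) Y (f i)) \<and>
       \<epsilon> \<longlonglongrightarrow> 0 \<and>
       weak_star_converges Y (\<lambda>i. distr (\<nu> i) (borel_metric Y) (f i)) \<nu>')"


section \<open>Wasserstein distance and geodesics\<close>

text \<open>Compact metric spaces are second countable, so the product sigma-algebra is the Borel
  sigma-algebra of the product space.\<close>

definition couplings :: "'a metric \<Rightarrow> 'a measure \<Rightarrow> 'a measure \<Rightarrow> ('a \<times> 'a) measure set" where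
  "couplings X \<mu>0 \<mu>1 =
    {\<pi>. sets \<pi> = sets (borel_metric X \<Otimes>\<^sub>M borel_metric X) \<and> prob_space \<pi> \<and>
        distr \<pi> (borel_metric X) fst = \<mu>0 \<and> distr \<pi> (borel_metric X) snd = \<mu>1}"

text \<open>On a compact space the infimum is finite.\<close>

definition W2 :: "'a metric \<Rightarrow> 'a measure \<Rightarrow> 'a measure \<Rightarrow> real" where
  "W2 X \<mu>0 \<mu>1 =
    sqrt (enn2real (INF \<pi> \<in> couplings X \<mu>0 \<mu>1. \<integral>\<^sup>+ z. ennreal ((mdist X (fst z) (snd z))\<^sup>2) \<partial>\<pi>))"

definition wasserstein_geodesic ::
    "'a metric \<Rightarrow> 'a measure \<Rightarrow> 'a measure \<Rightarrow> (real \<Rightarrow> 'a measure) \<Rightarrow> bool" where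
  "wasserstein_geodesic X \<mu>0 \<mu>1 \<mu> \<longleftrightarrow>
    (\<forall>t\<in>{0..1}. \<mu> t \<in> P2 X) \<and> \<mu> 0 = \<mu>0 \<and> \<mu> 1 = \<mu>1 \<and>
    (\<forall>s\<in>{0..1}. \<forall>t\<in>{0..1}. W2 X (\<mu> t) (\<mu> s) = \<bar>t - s\<bar> * W2 X \<mu>0 \<mu>1)"


section \<open>The functionals \<open>U\<^sub>\<nu>\<close>\<close>

text \<open>Only the values of \<open>U\<close> on \<open>[0,\<infinity>)\<close> matter.\<close>

definition convex_nonlinearities :: "(real \<Rightarrow> real) set" where
  "convex_nonlinearities = {U. continuous_on {0..} U \<and> convex_on {0..} U \<and> U 0 = 0}"

definition DC :: "real \<Rightarrow> (real \<Rightarrow> real) set" where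
  "DC N = {U \<in> convex_nonlinearities. convex_on {0<..} (\<lambda>l. l powr N * U (l powr (- N)))}"

definition DC_inf :: "(real \<Rightarrow> real) set" where
  "DC_inf = {U \<in> convex_nonlinearities. convex_on UNIV (\<lambda>l. exp l * U (exp (- l)))}"

text \<open>By convexity and \<open>U 0 = 0\<close> the quotient is nondecreasing in \<open>r\<close>, so the limit exists in
  \<open>\<real> \<union> {\<infinity>}\<close>.\<close>

definition U_prime_inf :: "(real \<Rightarrow> real) \<Rightarrow> ereal" where
  "U_prime_inf U = Lim at_top (\<lambda>r. ereal (U r / r))"

definition lebesgue_decomposition ::
    "'a measure \<Rightarrow> 'a measure \<Rightarrow> ('a \<Rightarrow> real) \<Rightarrow> 'a measure \<Rightarrow> bool" where
  "lebesgue_decomposition \<nu> \<mu> \<rho> \<mu>s \<longleftrightarrow>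
    \<rho> \<in> borel_measurable \<nu> \<and> (\<forall>x\<in>space \<nu>. 0 \<le> \<rho> x) \<and> sets \<mu>s = sets \<nu> \<and>
    (\<exists>A\<in>sets \<nu>. emeasure \<nu> A = 0 \<and> emeasure \<mu>s (space \<nu> - A) = 0) \<and>
    (\<forall>B\<in>sets \<nu>. emeasure \<mu> B = emeasure (density \<nu> (\<lambda>x. ennreal (\<rho> x))) B + emeasure \<mu>s B)"

text \<open>The integral of a function whose negative part has finite integral, with values in
  \<open>\<real> \<union> {\<infinity>}\<close>.\<close>

definition ext_integral :: "'a measure \<Rightarrow> ('a \<Rightarrow> real) \<Rightarrow> ereal" where
  "ext_integral M f =
    enn2ereal (\<integral>\<^sup>+ x. ennreal (f x) \<partial>M) - enn2ereal (\<integral>\<^sup>+ x. ennreal (- f x) \<partial>M)"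

text \<open>For finite measures the decomposition exists, \<open>\<mu>s\<close> is unique and \<open>\<rho>\<close> is unique \<open>\<nu>\<close>-almost
  everywhere, so the value does not depend on the choice. A convex \<open>U\<close> is bounded below by an
  affine function, so the negative part of \<open>U \<circ> \<rho>\<close> is integrable. In \<^typ>\<open>ereal\<close>, \<open>\<infinity> * 0 = 0\<close>.\<close>

definition U_functional :: "(real \<Rightarrow> real) \<Rightarrow> 'a measure \<Rightarrow> 'a measure \<Rightarrow> ereal" where
  "U_functional U \<nu> \<mu> =
    (let (\<rho>, \<mu>s) = (SOME (\<rho>, \<mu>s). lebesgue_decomposition \<nu> \<mu> \<rho> \<mu>s)
     in ext_integral \<nu> (\<lambda>x. U (\<rho> x)) + U_prime_inf U * enn2ereal (emeasure \<mu>s (space \<nu>)))"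


section \<open>Ricci curvature bounds\<close>

definition nonneg_N_Ricci :: "real \<Rightarrow> 'a metric \<Rightarrow> 'a measure \<Rightarrow> bool" where
  "nonneg_N_Ricci N X \<nu> \<longleftrightarrow>
    (\<forall>\<mu>0\<in>P2 X. \<forall>\<mu>1\<in>P2 X.
       measure_support X \<mu>0 \<subseteq> measure_support X \<nu> \<and>
       measure_support X \<mu>1 \<subseteq> measure_support X \<nu> \<longrightarrow>
       (\<exists>\<mu>. wasserstein_geodesic X \<mu>0 \<mu>1 \<mu> \<and>
          (\<forall>U\<in>DC N. \<forall>t\<in>{0..1}.
             U_functional U \<nu> (\<mu> t)
               \<le> ereal t * U_functional U \<nu> \<mu>1 + ereal (1 - t) * U_functional U \<nu> \<mu>0)))"

definition pressure :: "(real \<Rightarrow> real) \<Rightarrow> real \<Rightarrow> real" where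
  "pressure U r = r * vector_derivative U (at_right r) - U r"

definition lambda_K :: "real \<Rightarrow> (real \<Rightarrow> real) \<Rightarrow> ereal" where
  "lambda_K K U = (INF r\<in>{0<..}. ereal (K * (pressure U r / r)))"

definition inf_Ricci_ge :: "real \<Rightarrow> 'a metric \<Rightarrow> 'a measure \<Rightarrow> bool" where
  "inf_Ricci_ge K X \<nu> \<longleftrightarrow>
    (\<forall>\<mu>0\<in>P2 X. \<forall>\<mu>1\<in>P2 X.
       measure_support X \<mu>0 \<subseteq> measure_support X \<nu> \<and>
       measure_support X \<mu>1 \<subseteq> measure_support X \<nu> \<longrightarrow>
       (\<exists>\<mu>. wasserstein_geodesic X \<mu>0 \<mu>1 \<mu> \<and>
          (\<forall>U\<in>DC_inf. \<forall>t\<in>{0..1}.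
             U_functional U \<nu> (\<mu> t)
               \<le> ereal t * U_functional U \<nu> \<mu>1 + ereal (1 - t) * U_functional U \<nu> \<mu>0
                 - ereal (1 / 2) * lambda_K K U * ereal (t * (1 - t) * (W2 X \<mu>0 \<mu>1)\<^sup>2))))"

end

theory Submission
  imports Defs "HOL-Library.Diagonal_Subsequence"
begin

text \<open>The proof follows Lott and Villani. For measures with continuous densities on the limit space,
  pull the densities back along the approximations \<open>f\<^sub>i\<close>, take the Wasserstein geodesics provided by
  the curvature bound of \<open>X\<^sub>i\<close>, and push them forward by \<open>f\<^sub>i\<close>. The resulting curves are geodesics up
  to an error that tends to \<open>0\<close>, so by compactness of \<open>P\<^sub>2(X)\<close> a subsequence converges to a geodesic.
  The functional \<open>U\<^sub>\<nu>(\<mu>)\<close> is the supremum of \<open>\<integral>\<phi> d\<mu> + \<integral>b d\<nu>\<close> over the continuous \<open>\<phi>\<close>, \<open>b\<close> such that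
  \<open>r \<mapsto> \<phi>(x) r + b(x)\<close> is an affine minorant of \<open>U\<close> for every \<open>x\<close>; this makes it jointly lower
  semicontinuous and nonincreasing under push-forward, while at the end points it converges. General
  end points are reduced to continuous densities by a mollification that does not increase any of
  the functionals, and a second passage to the limit. All functionals are treated along a single
  subsequence.\<close>

section \<open>Borel structure of compact metric spaces\<close>

text \<open>The maps \<open>f n\<close> are only Borel, and this shapes the proof twice. Composed
  with \<open>f n\<close>, a continuous pair \<phi>, b becomes merely bounded and Borel; so next to
  the supremum over continuous pairs, which is used on the limit space, the bound by the functional
  is needed for bounded Borel pairs on each \<open>X n\<close>. And to estimate W2 on
  \<open>X n\<close> by W2 of the push-forwards, a coupling on the limit space must be lifted along
  a map without usable inverse. It is lifted up to a small error by matching points whose images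
  share a cell of a finite Borel partition; neither disintegration nor optimal couplings occur.

  Densities are made continuous because the push-forwards of \<nu> n converge only weakly: for
  continuous \<rho> the integral of U(\<rho>) is the integral of a test function. On the limit space
  the condition on supports is what makes the mollification conserve mass: a bump function of
  \<nu>-mass zero must have \<mu>-mass zero.

  Both curvature conditions have the same form up to the correction term, which is zero in part (a),
  so a single argument serves them. The geodesic has to be found before U is known.\<close>

lemma space_borel_metric [simp]: "space (borel_metric X) = mspace X"
  by (auto simp: borel_metric_def space_measure_of_conv)

lemma sets_borel_metric:
  "sets (borel_metric X) = sigma_sets (mspace X) {S. openin (mtopology_of X) S}"
  unfolding borel_metric_def
  by (rule sets_measure_of) (use openin_subset in fastforce)

lemma openin_in_sets_borel_metric: "openin (mtopology_of X) S \<Longrightarrow> S \<in> sets (borel_metric X)"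
  by (auto simp: sets_borel_metric)

lemma borel_measurable_continuous_map:
  assumes "continuous_map (mtopology_of X) euclideanreal f"
  shows "f \<in> borel_measurable (borel_metric X)"
proof (rule borel_measurableI)
  fix S :: "real set" assume "open S"
  with assms have "openin (mtopology_of X) {x \<in> topspace (mtopology_of X). f x \<in> S}"
    by (intro openin_continuous_map_preimage) auto
  moreover have "{x \<in> topspace (mtopology_of X). f x \<in> S} = f -` S \<inter> space (borel_metric X)"
    by auto
  ultimately show "f -` S \<inter> space (borel_metric X) \<in> sets (borel_metric X)"
    using openin_in_sets_borel_metric by simp
qed

lemma P2_D:
  assumes "\<mu> \<in> P2 X"
  shows "sets \<mu> = sets (borel_metric X)" "prob_space \<mu>" "space \<mu> = mspace X"
  using assms by (auto simp: P2_def dest: sets_eq_imp_space_eq)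

lemma measurable_P2:
  assumes "\<mu> \<in> P2 X"
  shows "measurable \<mu> N = measurable (borel_metric X) N"
  using P2_D[OF assms] by (simp cong: measurable_cong_sets)

lemma distr_in_P2:
  assumes "prob_space M" "f \<in> measurable M (borel_metric Y)"
  shows "distr M (borel_metric Y) f \<in> P2 Y"
  using assms by (auto simp: P2_def intro: prob_space.prob_space_distr)

lemma tendsto_of_abs_le:
  fixes f :: "'a \<Rightarrow> real"
  assumes "\<And>x. \<bar>f x - l\<bar> \<le> g x" "(g \<longlongrightarrow> 0) F"
  shows "(f \<longlongrightarrow> l) F"
  by (rule LIM_zero_cancel, rule Lim_null_comparison[OF _ assms(2)]) (use assms(1) in auto)

section \<open>Finite nets, Borel partitions and measurability of the metric\<close>

locale compact_metric =
  fixes X :: "'a metric"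
  assumes compact: "compact_space (mtopology_of X)"
begin

sublocale Metric_space "mspace X" "mdist X" ..

lemma mtopology_eq: "mtopology_of X = mtopology"
  by (simp add: mtopology_of_def)

lemma finite_net:
  assumes "\<delta> > 0"
  obtains K where "finite K" "K \<subseteq> mspace X" "\<And>x. x \<in> mspace X \<Longrightarrow> \<exists>y\<in>K. mdist X y x < \<delta>"
proof -
  have "mtotally_bounded (mspace X)"
    using compact compactin_imp_mtotally_bounded[of "mspace X"]
    by (simp add: compact_space_def mtopology_eq)
  then obtain K where "finite K" "K \<subseteq> mspace X" "mspace X \<subseteq> (\<Union>x\<in>K. mball x \<delta>)"
    using assms unfolding mtotally_bounded_def by meson
  then have "\<exists>y\<in>K. mdist X y x < \<delta>" if "x \<in> mspace X" for x
    using subsetD[OF \<open>mspace X \<subseteq> _\<close> that] by (auto simp: mball_def)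
  with \<open>finite K\<close> \<open>K \<subseteq> mspace X\<close> show thesis
    by (rule that)
qed

lemma bounded_mdist:
  obtains D where "D > 0" "\<And>x y. x \<in> mspace X \<Longrightarrow> y \<in> mspace X \<Longrightarrow> mdist X x y \<le> D"
proof -
  obtain K where K: "finite K" "K \<subseteq> mspace X" "\<And>x. x \<in> mspace X \<Longrightarrow> \<exists>y\<in>K. mdist X y x < 1"
    using finite_net[of 1] by auto
  define m where "m = (\<Sum>y\<in>K. \<Sum>z\<in>K. mdist X y z)"
  have m: "mdist X y z \<le> m" if "y \<in> K" "z \<in> K" for y z
  proof -
    have "mdist X y z \<le> (\<Sum>z\<in>K. mdist X y z)"
      using K(1) that by (intro member_le_sum) auto
    also have "\<dots> \<le> m"
      unfolding m_def using K(1) that by (intro member_le_sum) (auto intro: sum_nonneg)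
    finally show ?thesis .
  qed
  show thesis
  proof (rule that[of "m + 2"])
    show "m + 2 > 0" unfolding m_def by (intro add_nonneg_pos sum_nonneg) auto
    fix x y assume xy: "x \<in> mspace X" "y \<in> mspace X"
    obtain x' y' where *: "x' \<in> K" "mdist X x' x < 1" "y' \<in> K" "mdist X y' y < 1"
      using K(3) xy by meson
    have "x' \<in> mspace X" "y' \<in> mspace X" using * K by auto
    then have "mdist X x y \<le> mdist X x' x + mdist X x' y" "mdist X x' y \<le> mdist X x' y' + mdist X y' y"
      using xy by (simp_all add: triangle triangle'')
    with m[OF *(1,3)] * show "mdist X x y \<le> m + 2" by linarith
  qed
qed

lemma mdist_continuous: "a \<in> mspace X \<Longrightarrow> continuous_map (mtopology_of X) euclideanreal (mdist X a)"
  by (rule continuous_on_mdist)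

lemma mdist_measurable1 [measurable]:
  "a \<in> mspace X \<Longrightarrow> (\<lambda>x. mdist X a x) \<in> borel_measurable (borel_metric X)"
  by (simp add: borel_measurable_continuous_map mdist_continuous)

text \<open>Finitely many balls of radius \<delta>/2 cover the space; a point is sent to the index
  of the first ball that contains it. Such finite Borel partitions are the device by which points
  are matched up to an error \<delta>, and they also discretise the metric and code points by
  digits.\<close>

lemma measurable_cells:
  assumes "\<delta> > 0"
  obtains cell :: "'a \<Rightarrow> nat" and n
  where "cell \<in> measurable (borel_metric X) (count_space UNIV)"
    and "\<And>x. x \<in> mspace X \<Longrightarrow> cell x < n"
    and "\<And>x y. \<lbrakk>x \<in> mspace X; y \<in> mspace X; cell x = cell y\<rbrakk> \<Longrightarrow> mdist X x y < \<delta>"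
proof -
  obtain K where K: "finite K" "K \<subseteq> mspace X" "\<And>x. x \<in> mspace X \<Longrightarrow> \<exists>y\<in>K. mdist X y x < \<delta>/2"
    using finite_net[of "\<delta>/2"] assms by auto
  obtain xs where xs: "set xs = K" using K(1) finite_list by blast
  \<comment> \<open>Beyond the list \<open>xs ! j\<close> is unspecified; the first disjunct makes
    the predicate constantly true there, hence measurable for every \<open>j\<close>. For points of
    the space the minimum is still attained at a genuine net point.\<close>
  define cell where "cell x = (LEAST j. j \<ge> length xs \<or> mdist X (xs ! j) x < \<delta>/2)" for x
  have cell: "cell x < length xs" "mdist X (xs ! cell x) x < \<delta>/2" if x: "x \<in> mspace X" for x
  proof -
    obtain j where j: "j < length xs" "mdist X (xs ! j) x < \<delta>/2"
      using K(3)[OF x] xs by (metis in_set_conv_nth)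
    then have "cell x \<le> j" unfolding cell_def by (intro Least_le) auto
    then show *: "cell x < length xs" using j by simp
    have "cell x \<ge> length xs \<or> mdist X (xs ! cell x) x < \<delta>/2"
      unfolding cell_def by (rule LeastI[of _ j]) (use j in auto)
    with * show "mdist X (xs ! cell x) x < \<delta>/2" by simp
  qed
  have meas: "cell \<in> measurable (borel_metric X) (count_space UNIV)"
    unfolding cell_def
  proof (rule measurable_Least)
    fix j
    have "{x \<in> space (borel_metric X). mdist X (xs ! j) x < \<delta>/2} \<in> sets (borel_metric X)" if "j < length xs"
    proof -
      have "xs ! j \<in> mspace X" using K xs that by auto
      from mdist_measurable1[OF this] show ?thesis by measurable
    qed
    then have "{x \<in> space (borel_metric X). length xs \<le> j \<or> mdist X (xs ! j) x < \<delta>/2} \<in> sets (borel_metric X)"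
      using sets.top[of "borel_metric X"] by (cases "j < length xs") auto
    then show "(\<lambda>x. length xs \<le> j \<or> mdist X (xs ! j) x < \<delta>/2) \<in> measurable (borel_metric X) (count_space UNIV)"
      unfolding pred_def .
  qed
  show thesis
  proof (rule that[of cell "length xs"])
    show "cell \<in> measurable (borel_metric X) (count_space UNIV)" by (rule meas)
    show "cell x < length xs" if "x \<in> mspace X" for x using cell(1) that by blast
  next
    fix x y assume xy: "x \<in> mspace X" "y \<in> mspace X" "cell x = cell y"
    have "xs ! cell x \<in> mspace X" using cell(1)[OF xy(1)] K xs by auto
    then have "mdist X x y \<le> mdist X (xs ! cell x) x + mdist X (xs ! cell x) y"
      using xy by (intro triangle'')
    then show "mdist X x y < \<delta>"
      using cell(2)[OF xy(1)] cell(2)[OF xy(2)] xy(3) by simp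
  qed
qed

text \<open>Replacing both arguments by representatives of their cells changes the distance by at
  most twice the mesh. The resulting function depends only on two natural numbers, so it is
  measurable for the product of the Borel sigma-algebras, and the metric is a pointwise limit of
  such functions.\<close>

lemma mdist_measurable_pair [measurable]:
  "(\<lambda>z. mdist X (fst z) (snd z)) \<in> borel_measurable (borel_metric X \<Otimes>\<^sub>M borel_metric X)"
proof -
  have "\<exists>cell :: 'a \<Rightarrow> nat. cell \<in> measurable (borel_metric X) (count_space UNIV) \<and>
     (\<forall>x\<in>mspace X. \<forall>y\<in>mspace X. cell x = cell y \<longrightarrow> mdist X x y < inverse (Suc n))" for n
    by (rule measurable_cells[of "inverse (Suc n)"]) auto
  then obtain cell :: "nat \<Rightarrow> 'a \<Rightarrow> nat" where
    cell [measurable]: "\<And>n. cell n \<in> measurable (borel_metric X) (count_space UNIV)" and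
    c: "\<And>n x y. x \<in> mspace X \<Longrightarrow> y \<in> mspace X \<Longrightarrow> cell n x = cell n y \<Longrightarrow> mdist X x y < inverse (Suc n)"
    by metis
  define p where "p n j = (SOME x. x \<in> mspace X \<and> cell n x = j)" for n j
  have p: "p n (cell n x) \<in> mspace X" "mdist X (p n (cell n x)) x < inverse (Suc n)" if "x \<in> mspace X" for n x
  proof -
    have *: "p n (cell n x) \<in> mspace X \<and> cell n (p n (cell n x)) = cell n x"
      unfolding p_def by (rule someI[of _ x]) (use that in auto)
    then show "p n (cell n x) \<in> mspace X" ..
    show "mdist X (p n (cell n x)) x < inverse (Suc n)"
      using c[of "p n (cell n x)" x n] * that by simp
  qed
  show ?thesis
  proof (rule borel_measurable_LIMSEQ_real)
    fix z assume "z \<in> space (borel_metric X \<Otimes>\<^sub>M borel_metric X)"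
    then have z: "fst z \<in> mspace X" "snd z \<in> mspace X" by (auto simp: space_pair_measure)
    have "\<bar>mdist X (p n (cell n (fst z))) (p n (cell n (snd z))) - mdist X (fst z) (snd z)\<bar>
       \<le> 2 * inverse (Suc n)" for n
    proof -
      note pp = p(1)[OF z(1), of n] p(1)[OF z(2), of n]
      have "mdist X (p n (cell n (fst z))) (p n (cell n (snd z))) \<le>
         mdist X (p n (cell n (fst z))) (fst z) + mdist X (fst z) (p n (cell n (snd z)))"
        using pp z by (intro triangle) auto
      moreover have "mdist X (fst z) (p n (cell n (snd z))) \<le>
         mdist X (fst z) (snd z) + mdist X (p n (cell n (snd z))) (snd z)"
        using pp z by (intro triangle') auto
      moreover have "mdist X (fst z) (snd z) \<le>
         mdist X (p n (cell n (fst z))) (fst z) + mdist X (p n (cell n (fst z))) (snd z)"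
        using pp z by (intro triangle'') auto
      moreover have "mdist X (p n (cell n (fst z))) (snd z) \<le>
         mdist X (p n (cell n (fst z))) (p n (cell n (snd z))) + mdist X (p n (cell n (snd z))) (snd z)"
        using pp z by (intro triangle) auto
      ultimately show ?thesis using p(2)[OF z(1), of n] p(2)[OF z(2), of n] by linarith
    qed
    moreover have "(\<lambda>n. 2 * inverse (real (Suc n))) \<longlonglongrightarrow> 0"
      by (intro tendsto_mult_right_zero LIMSEQ_inverse_real_of_nat)
    ultimately show "(\<lambda>n. mdist X (p n (cell n (fst z))) (p n (cell n (snd z)))) \<longlonglongrightarrow> mdist X (fst z) (snd z)"
      by (rule tendsto_of_abs_le)
  next
    fix n
    show "(\<lambda>z. mdist X (p n (cell n (fst z))) (p n (cell n (snd z)))) \<in> borel_measurable (borel_metric X \<Otimes>\<^sub>M borel_metric X)"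
      by measurable
  qed
qed

lemma mdist_measurable [measurable (raw)]:
  assumes "f \<in> measurable M (borel_metric X)" "g \<in> measurable M (borel_metric X)"
  shows "(\<lambda>x. mdist X (f x) (g x)) \<in> borel_measurable M"
  using measurable_compose[OF measurable_Pair[OF assms] mdist_measurable_pair] by simp

lemma bounded_continuous:
  assumes "continuous_map (mtopology_of X) euclideanreal \<phi>"
  obtains B where "B > 0" "\<And>x. x \<in> mspace X \<Longrightarrow> \<bar>\<phi> x\<bar> \<le> B"
proof -
  have "compactin euclideanreal (\<phi> ` topspace (mtopology_of X))"
    using compact assms by (intro image_compactin) (auto simp: compact_space_def)
  then have "bounded (\<phi> ` mspace X)" by (simp add: compact_imp_bounded)
  then obtain B where "\<forall>x\<in>mspace X. \<bar>\<phi> x\<bar> \<le> B" unfolding bounded_iff by auto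
  then show thesis by (intro that[of "\<bar>B\<bar> + 1"]) force+
qed

lemma uniformly_continuous:
  assumes "continuous_map (mtopology_of X) euclideanreal \<phi>" "\<epsilon> > 0"
  obtains \<delta> where "\<delta> > 0"
    "\<And>x y. \<lbrakk>x \<in> mspace X; y \<in> mspace X; mdist X x y < \<delta>\<rbrakk> \<Longrightarrow> \<bar>\<phi> x - \<phi> y\<bar> < \<epsilon>"
proof -
  have "uniformly_continuous_map X euclidean_metric \<phi>"
    using assms compact continuous_eq_uniformly_continuous_map[of X euclidean_metric \<phi>] by simp
  then show thesis
    using assms(2) that unfolding uniformly_continuous_map_def
    by (auto simp: dist_real_def)
qed

end


section \<open>Gluing and the Wasserstein metric\<close>

lemma distr_pair_snd:
  assumes "prob_space N" "prob_space M"
  shows "distr (N \<Otimes>\<^sub>M M) M snd = M"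
proof (rule measure_eqI)
  interpret N: prob_space N by fact
  interpret M: prob_space M by fact
  fix A assume "A \<in> sets (distr (N \<Otimes>\<^sub>M M) M snd)"
  then have A: "A \<in> sets M" by simp
  then have "snd -` A \<inter> space (N \<Otimes>\<^sub>M M) = space N \<times> A"
    using sets.sets_into_space by (auto simp: space_pair_measure)
  then show "emeasure (distr (N \<Otimes>\<^sub>M M) M snd) A = emeasure M A"
    using A by (simp add: emeasure_distr M.emeasure_pair_measure_Times N.emeasure_space_1)
qed simp

text \<open>Conditioning on the common value of \<open>a\<close> and \<open>b\<close> replaces the disintegration of measures in
  the usual gluing lemma.\<close>

lemma countable_gluing:
  fixes a :: "'p \<Rightarrow> nat" and b :: "'q \<Rightarrow> nat"
  assumes P: "prob_space P" and Q: "prob_space Q"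
    and a [measurable]: "a \<in> measurable P (count_space UNIV)"
    and b [measurable]: "b \<in> measurable Q (count_space UNIV)"
    and eq: "\<And>i. emeasure P {x \<in> space P. a x = i} = emeasure Q {x \<in> space Q. b x = i}"
  obtains \<gamma> where "sets \<gamma> = sets (P \<Otimes>\<^sub>M Q)" "prob_space \<gamma>" "distr \<gamma> P fst = P" "distr \<gamma> Q snd = Q"
    "AE z in \<gamma>. a (fst z) = b (snd z)"
proof -
  interpret P: prob_space P by fact
  interpret Q: prob_space Q by fact
  interpret PQ: pair_sigma_finite P Q ..
  define m where "m i = emeasure P {x \<in> space P. a x = i}" for i
  have m_inv: "inverse (m i) * m i = 1" if "m i \<noteq> 0" for i
    using that P.emeasure_finite[of "{x \<in> space P. a x = i}"] ennreal_divide_self[of "m i"]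
    by (simp add: m_def divide_ennreal_def mult.commute less_top[symmetric])
  \<comment> \<open>The independent coupling conditioned on \<open>a = b\<close>. The event that
    both values are i has product mass \<open>m i * m i\<close>, and the factor
    \<open>inverse (m i)\<close> brings it back to the mass m i in both marginals.\<close>
  define h where "h z = (if a (fst z) = b (snd z) then inverse (m (a (fst z))) else 0)" for z
  have [measurable]: "(\<lambda>z. m (a (fst z))) \<in> borel_measurable (P \<Otimes>\<^sub>M Q)"
    by (rule measurable_compose[OF measurable_compose[OF measurable_fst a]]) simp
  have [measurable]: "Measurable.pred (P \<Otimes>\<^sub>M Q) (\<lambda>z. a (fst z) = b (snd z))"
  proof -
    have "Measurable.pred (P \<Otimes>\<^sub>M Q) (\<lambda>z. \<exists>i. b (snd z) = i \<and> a (fst z) = i)"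
      by measurable
    then show ?thesis by simp
  qed
  have h [measurable]: "h \<in> borel_measurable (P \<Otimes>\<^sub>M Q)"
    unfolding h_def by measurable
  define \<gamma> where "\<gamma> = density (P \<Otimes>\<^sub>M Q) h"
  have sets: "sets \<gamma> = sets (P \<Otimes>\<^sub>M Q)" by (simp add: \<gamma>_def)
  \<comment> \<open>In \<open>ennreal\<close> the product \<open>inverse 0 * 0\<close> is 0 and not
    1, so the marginals come out right only where \<open>m\<close> does not vanish. Values of mass
    zero are taken with probability zero under either measure.\<close>
  have null: "AE x in M. m (c x) \<noteq> 0"
    if [measurable]: "c \<in> measurable M (count_space UNIV)"
      and "\<And>i. emeasure M {x \<in> space M. c x = i} = m i" for M :: "'z measure" and c
  proof -
    have "AE x in M. m i = 0 \<longrightarrow> c x \<noteq> i" for i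
    proof (cases "m i = 0")
      case True
      then have "{x \<in> space M. c x = i} \<in> null_sets M"
        using that(2)[of i] by (intro null_setsI) auto
      then show ?thesis by (rule AE_I') auto
    qed simp
    then have "AE x in M. \<forall>i. m i = 0 \<longrightarrow> c x \<noteq> i" by (simp add: AE_all_countable)
    then show ?thesis by eventually_elim auto
  qed
  have int1: "(\<integral>\<^sup>+ y. h (x, y) \<partial>Q) = inverse (m (a x)) * m (a x)" for x
  proof -
    have "(\<integral>\<^sup>+ y. h (x, y) \<partial>Q) = (\<integral>\<^sup>+ y. inverse (m (a x)) * indicator {y \<in> space Q. b y = a x} y \<partial>Q)"
      by (rule nn_integral_cong) (auto simp: h_def)
    then show ?thesis by (simp add: nn_integral_cmult m_def eq)
  qed
  have int2: "(\<integral>\<^sup>+ x. h (x, y) \<partial>P) = inverse (m (b y)) * m (b y)" for y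
  proof -
    have "(\<integral>\<^sup>+ x. h (x, y) \<partial>P) = (\<integral>\<^sup>+ x. inverse (m (b y)) * indicator {x \<in> space P. a x = b y} x \<partial>P)"
      by (rule nn_integral_cong) (auto simp: h_def)
    then show ?thesis by (simp add: nn_integral_cmult m_def)
  qed
  have fst: "distr \<gamma> P fst = P"
  proof (rule measure_eqI)
    fix A assume "A \<in> sets (distr \<gamma> P fst)"
    then have A [measurable]: "A \<in> sets P" by simp
    have "emeasure (distr \<gamma> P fst) A = (\<integral>\<^sup>+ z. h z * indicator (fst -` A \<inter> space (P \<Otimes>\<^sub>M Q)) z \<partial>(P \<Otimes>\<^sub>M Q))"
      by (subst emeasure_distr) (auto simp: \<gamma>_def measurable_def[symmetric] emeasure_density)
    also have "\<dots> = (\<integral>\<^sup>+ z. h z * indicator A (fst z) \<partial>(P \<Otimes>\<^sub>M Q))"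
      by (rule nn_integral_cong) (auto split: split_indicator)
    also have "\<dots> = (\<integral>\<^sup>+ x. \<integral>\<^sup>+ y. h (x, y) * indicator A x \<partial>Q \<partial>P)"
      by (subst Q.nn_integral_fst[symmetric]) auto
    also have "\<dots> = (\<integral>\<^sup>+ x. inverse (m (a x)) * m (a x) * indicator A x \<partial>P)"
      by (rule nn_integral_cong) (simp add: nn_integral_multc int1)
    also have "\<dots> = (\<integral>\<^sup>+ x. indicator A x \<partial>P)"
    proof (rule nn_integral_cong_AE)
      show "AE x in P. inverse (m (a x)) * m (a x) * indicator A x = indicator A x"
        using null[OF a, folded m_def, OF refl] by eventually_elim (simp add: m_inv)
    qed
    finally show "emeasure (distr \<gamma> P fst) A = emeasure P A" by simp
  qed simp
  have snd: "distr \<gamma> Q snd = Q"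
  proof (rule measure_eqI)
    fix A assume "A \<in> sets (distr \<gamma> Q snd)"
    then have A [measurable]: "A \<in> sets Q" by simp
    have "emeasure (distr \<gamma> Q snd) A = (\<integral>\<^sup>+ z. h z * indicator (snd -` A \<inter> space (P \<Otimes>\<^sub>M Q)) z \<partial>(P \<Otimes>\<^sub>M Q))"
      by (subst emeasure_distr) (auto simp: \<gamma>_def measurable_def[symmetric] emeasure_density)
    also have "\<dots> = (\<integral>\<^sup>+ z. h z * indicator A (snd z) \<partial>(P \<Otimes>\<^sub>M Q))"
      by (rule nn_integral_cong) (auto split: split_indicator)
    also have "\<dots> = (\<integral>\<^sup>+ y. \<integral>\<^sup>+ x. h (x, y) * indicator A y \<partial>P \<partial>Q)"
      by (subst PQ.nn_integral_snd[symmetric]) auto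
    also have "\<dots> = (\<integral>\<^sup>+ y. inverse (m (b y)) * m (b y) * indicator A y \<partial>Q)"
      by (rule nn_integral_cong) (simp add: nn_integral_multc int2)
    also have "\<dots> = (\<integral>\<^sup>+ y. indicator A y \<partial>Q)"
    proof (rule nn_integral_cong_AE)
      show "AE y in Q. inverse (m (b y)) * m (b y) * indicator A y = indicator A y"
        using null[OF b eq[folded m_def, symmetric]] by eventually_elim (simp add: m_inv)
    qed
    finally show "emeasure (distr \<gamma> Q snd) A = emeasure Q A" by simp
  qed simp
  have prob: "prob_space \<gamma>"
  proof (rule prob_spaceI)
    have f: "fst \<in> measurable \<gamma> P" by (simp add: measurable_cong_sets[OF sets refl])
    have "emeasure (distr \<gamma> P fst) (space P) = emeasure \<gamma> (fst -` space P \<inter> space \<gamma>)"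
      using f by (rule emeasure_distr) simp
    also have "fst -` space P \<inter> space \<gamma> = space \<gamma>"
      using measurable_space[OF f] by auto
    finally show "emeasure \<gamma> (space \<gamma>) = 1"
      unfolding fst by (simp add: P.emeasure_space_1)
  qed
  have "AE z in \<gamma>. a (fst z) = b (snd z)"
    unfolding \<gamma>_def AE_density[OF h] by (rule AE_I2) (simp add: h_def)
  with sets prob fst snd show thesis by (rule that)
qed

text \<open>The Cauchy--Schwarz inequality in the form needed for Minkowski's inequality with
  three summands.\<close>

lemma three_square_bound:
  fixes u v A B \<delta> :: real
  assumes "A > 0" "B > 0" "\<delta> > 0"
  shows "(u + v + \<delta>)\<^sup>2 \<le> (A + B + \<delta>) * (u\<^sup>2 / A + v\<^sup>2 / B + \<delta>)"
proof -
  have "(A + B + \<delta>) * (u\<^sup>2 / A + v\<^sup>2 / B + \<delta>) - (u + v + \<delta>)\<^sup>2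
     = (B * u - A * v)\<^sup>2 / (A * B) + \<delta> * (u - A)\<^sup>2 / A + \<delta> * (v - B)\<^sup>2 / B"
    using assms by (simp add: field_simps power2_eq_square)
  also have "\<dots> \<ge> 0" using assms by (intro add_nonneg_nonneg divide_nonneg_pos mult_nonneg_nonneg) auto
  finally show ?thesis by simp
qed

text \<open>Integrating the weighted bound with weights A, B, \<delta> turns integrals below A^2 and
  B^2 into at most A + B + \<delta> for the second factor. Strict inequalities are used because W2
  is an infimum that is accessed through couplings of cost below a threshold; the constant \<delta>
  collects matching errors.\<close>

lemma L2_three_bound:
  assumes "prob_space M" and [measurable]: "u \<in> borel_measurable M" "v \<in> borel_measurable M"
    and h: "AE x in M. 0 \<le> h x \<and> h x \<le> u x + v x + \<delta>"
    and pos: "A > 0" "B > 0" "\<delta> > 0"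
    and u: "(\<integral>\<^sup>+ x. ennreal ((u x)\<^sup>2) \<partial>M) < ennreal (A\<^sup>2)"
    and v: "(\<integral>\<^sup>+ x. ennreal ((v x)\<^sup>2) \<partial>M) < ennreal (B\<^sup>2)"
  shows "(\<integral>\<^sup>+ x. ennreal ((h x)\<^sup>2) \<partial>M) < ennreal ((A + B + \<delta>)\<^sup>2)"
proof -
  interpret prob_space M by fact
  obtain i where i: "(\<integral>\<^sup>+ x. ennreal ((u x)\<^sup>2) \<partial>M) = ennreal i" "i \<ge> 0"
    using u by (cases "\<integral>\<^sup>+ x. ennreal ((u x)\<^sup>2) \<partial>M") auto
  obtain j where j: "(\<integral>\<^sup>+ x. ennreal ((v x)\<^sup>2) \<partial>M) = ennreal j" "j \<ge> 0"
    using v by (cases "\<integral>\<^sup>+ x. ennreal ((v x)\<^sup>2) \<partial>M") auto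
  have ij: "i < A\<^sup>2" "j < B\<^sup>2" using u v i j by (auto simp: ennreal_less_iff)
  define c where "c = A + B + \<delta>"
  have c: "c > 0" using pos by (simp add: c_def)
  have "(\<integral>\<^sup>+ x. ennreal ((h x)\<^sup>2) \<partial>M) \<le> (\<integral>\<^sup>+ x. ennreal (c / A) * ennreal ((u x)\<^sup>2) + ennreal (c / B) * ennreal ((v x)\<^sup>2) + ennreal (c * \<delta>) \<partial>M)"
  proof (rule nn_integral_mono_AE)
    show "AE x in M. ennreal ((h x)\<^sup>2) \<le> ennreal (c / A) * ennreal ((u x)\<^sup>2) + ennreal (c / B) * ennreal ((v x)\<^sup>2) + ennreal (c * \<delta>)"
      using h
    proof eventually_elim
      case (elim x)
      then have "(h x)\<^sup>2 \<le> (u x + v x + \<delta>)\<^sup>2" by (intro power_mono) auto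
      also have "\<dots> \<le> c / A * (u x)\<^sup>2 + c / B * (v x)\<^sup>2 + c * \<delta>"
        using three_square_bound[OF pos, of "u x" "v x"] by (simp add: c_def algebra_simps)
      finally have "ennreal ((h x)\<^sup>2) \<le> ennreal (c / A * (u x)\<^sup>2 + c / B * (v x)\<^sup>2 + c * \<delta>)"
        by (rule ennreal_leI)
      then show ?case using c pos by (simp add: ennreal_mult[symmetric] ennreal_plus[symmetric] del: ennreal_plus)
    qed
  qed
  also have "\<dots> = ennreal (c / A) * ennreal i + ennreal (c / B) * ennreal j + ennreal (c * \<delta>)"
    by (simp add: nn_integral_add nn_integral_cmult i j emeasure_space_1)
  also have "\<dots> = ennreal (c * (i / A + j / B + \<delta>))"
    using c pos i j by (simp add: ennreal_mult[symmetric] ennreal_plus[symmetric] algebra_simps del: ennreal_plus)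
  also have "\<dots> < ennreal ((A + B + \<delta>)\<^sup>2)"
  proof -
    have "i / A < A" "j / B < B" using ij pos by (simp_all add: field_simps power2_eq_square)
    then have "c * (i / A + j / B + \<delta>) < c * c" using c by (intro mult_strict_left_mono) (auto simp: c_def)
    then show ?thesis using c pos i j by (subst ennreal_less_iff) (auto simp: c_def power2_eq_square)
  qed
  finally show ?thesis .
qed

lemma emeasure_fibre_distr:
  assumes g: "g \<in> measurable M N" and c: "c \<in> measurable N (count_space UNIV)"
  shows "emeasure M {x \<in> space M. c (g x) = i} = emeasure (distr M N g) {y \<in> space N. c y = i}"
proof -
  have "{y \<in> space N. c y = i} = c -` {i} \<inter> space N" by auto
  then have S: "{y \<in> space N. c y = i} \<in> sets N" using measurable_sets[OF c, of "{i}"] by simp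
  have "g -` {y \<in> space N. c y = i} \<inter> space M = {x \<in> space M. c (g x) = i}"
    using measurable_space[OF g] by auto
  then show ?thesis using emeasure_distr[OF g S] by simp
qed

lemma couplingsD:
  assumes "\<pi> \<in> couplings X \<mu>0 \<mu>1"
  shows "sets \<pi> = sets (borel_metric X \<Otimes>\<^sub>M borel_metric X)" "prob_space \<pi>"
    "distr \<pi> (borel_metric X) fst = \<mu>0" "distr \<pi> (borel_metric X) snd = \<mu>1"
    "space \<pi> = mspace X \<times> mspace X"
    "measurable \<pi> N = measurable (borel_metric X \<Otimes>\<^sub>M borel_metric X) N"
proof -
  show s: "sets \<pi> = sets (borel_metric X \<Otimes>\<^sub>M borel_metric X)" "prob_space \<pi>"
    "distr \<pi> (borel_metric X) fst = \<mu>0" "distr \<pi> (borel_metric X) snd = \<mu>1"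
    using assms by (auto simp: couplings_def)
  show "space \<pi> = mspace X \<times> mspace X"
    using sets_eq_imp_space_eq[OF s(1)] by (simp add: space_pair_measure)
  show "measurable \<pi> N = measurable (borel_metric X \<Otimes>\<^sub>M borel_metric X) N"
    by (rule measurable_cong_sets[OF s(1) refl])
qed

lemma W2_nonneg: "0 \<le> W2 X \<mu> \<mu>'"
  unfolding W2_def by (rule real_sqrt_ge_zero) (rule enn2real_nonneg)

section \<open>W2 through couplings of cost below a threshold\<close>

context compact_metric
begin

abbreviation transport_cost :: "('a \<times> 'a) measure \<Rightarrow> ennreal" where
  "transport_cost \<pi> \<equiv> \<integral>\<^sup>+ z. ennreal ((mdist X (fst z) (snd z))\<^sup>2) \<partial>\<pi>"

text \<open>The product measure is a coupling whose cost is at most the squared diameter, so the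
  infimum is finite; otherwise \<open>enn2real\<close> could turn \<infinity> into 0. Apart from
  nonnegativity, all later facts about \<open>W2\<close> go through this equivalence, so existence
  of optimal couplings is never an issue.\<close>

lemma W2_less_iff:
  assumes "\<mu> \<in> P2 X" "\<mu>' \<in> P2 X" "A > 0"
  shows "W2 X \<mu> \<mu>' < A \<longleftrightarrow> (\<exists>\<pi>\<in>couplings X \<mu> \<mu>'. transport_cost \<pi> < ennreal (A\<^sup>2))"
proof -
  note m = P2_D[OF assms(1)] and m' = P2_D[OF assms(2)]
  let ?I = "INF \<pi> \<in> couplings X \<mu> \<mu>'. transport_cost \<pi>"
  have "prob_space (\<mu> \<Otimes>\<^sub>M \<mu>')"
    using m(2) m'(2) by (rule prob_space_pair)
  moreover have "distr (\<mu> \<Otimes>\<^sub>M \<mu>') (borel_metric X) fst = \<mu>"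
    using prob_space.distr_pair_fst[OF m'(2), of \<mu>] m(1) by (simp cong: distr_cong)
  moreover have "distr (\<mu> \<Otimes>\<^sub>M \<mu>') (borel_metric X) snd = \<mu>'"
    using distr_pair_snd[OF m(2) m'(2)] m'(1) by (simp cong: distr_cong)
  moreover have "sets (\<mu> \<Otimes>\<^sub>M \<mu>') = sets (borel_metric X \<Otimes>\<^sub>M borel_metric X)"
    using m m' by (intro sets_pair_measure_cong) auto
  ultimately have c: "\<mu> \<Otimes>\<^sub>M \<mu>' \<in> couplings X \<mu> \<mu>'"
    by (simp add: couplings_def)
  obtain D where D: "D > 0" "\<And>x y. x \<in> mspace X \<Longrightarrow> y \<in> mspace X \<Longrightarrow> mdist X x y \<le> D"
    using bounded_mdist by blast
  have "?I \<le> transport_cost (\<mu> \<Otimes>\<^sub>M \<mu>')"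
    using c by (rule INF_lower)
  also have "\<dots> \<le> (\<integral>\<^sup>+ z. ennreal (D\<^sup>2) \<partial>(\<mu> \<Otimes>\<^sub>M \<mu>'))"
    using couplingsD(5)[OF c] D by (intro nn_integral_mono ennreal_leI power_mono) auto
  also have "\<dots> = ennreal (D\<^sup>2)"
    using prob_space.emeasure_space_1[OF couplingsD(2)[OF c]] by simp
  finally have fin: "?I < \<top>" by (rule le_less_trans) simp
  have "W2 X \<mu> \<mu>' < A \<longleftrightarrow> sqrt (enn2real ?I) < sqrt (A\<^sup>2)"
    using assms(3) by (simp add: W2_def)
  also have "\<dots> \<longleftrightarrow> ?I < ennreal (A\<^sup>2)"
    unfolding real_sqrt_less_iff using fin by (rule enn2real_less_iff)
  finally show ?thesis by (simp add: INF_less_iff)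
qed

text \<open>Couplings appear below as joint laws of two maps on a glued space or on the space given
  by Skorohod's theorem; in this form the pair law need not be handled each time.\<close>

lemma W2_lessI:
  assumes "prob_space M" and [measurable]: "f \<in> measurable M (borel_metric X)" "g \<in> measurable M (borel_metric X)"
    and "distr M (borel_metric X) f = \<mu>" "distr M (borel_metric X) g = \<mu>'"
    and "A > 0" "(\<integral>\<^sup>+ x. ennreal ((mdist X (f x) (g x))\<^sup>2) \<partial>M) < ennreal (A\<^sup>2)"
  shows "W2 X \<mu> \<mu>' < A"
proof -
  let ?\<pi> = "distr M (borel_metric X \<Otimes>\<^sub>M borel_metric X) (\<lambda>x. (f x, g x))"
  have "\<mu> \<in> P2 X" "\<mu>' \<in> P2 X" using assms by (auto intro: distr_in_P2)
  moreover have "?\<pi> \<in> couplings X \<mu> \<mu>'"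
    using assms by (auto simp: couplings_def distr_distr comp_def intro!: prob_space.prob_space_distr)
  moreover have "transport_cost ?\<pi> < ennreal (A\<^sup>2)"
    using assms(7) by (subst nn_integral_distr) auto
  ultimately show ?thesis using assms(6) by (auto simp: W2_less_iff)
qed

lemma W2_le_commute:
  assumes "\<mu> \<in> P2 X" "\<mu>' \<in> P2 X"
  shows "W2 X \<mu>' \<mu> \<le> W2 X \<mu> \<mu>'"
proof (rule dense_ge)
  fix A assume A: "W2 X \<mu> \<mu>' < A"
  then have "A > 0" using W2_nonneg[of X \<mu> \<mu>'] by linarith
  then obtain \<pi> where \<pi>: "\<pi> \<in> couplings X \<mu> \<mu>'" "transport_cost \<pi> < ennreal (A\<^sup>2)"
    using A W2_less_iff[OF assms] by auto
  note p = couplingsD[OF \<pi>(1)]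
  have "W2 X \<mu>' \<mu> < A"
    by (rule W2_lessI[of \<pi> snd fst]) (use p \<pi> \<open>A > 0\<close> in \<open>auto simp: commute\<close>)
  then show "W2 X \<mu>' \<mu> \<le> A" by simp
qed

lemma W2_commute:
  assumes "\<mu> \<in> P2 X" "\<mu>' \<in> P2 X"
  shows "W2 X \<mu> \<mu>' = W2 X \<mu>' \<mu>"
  by (rule antisym[OF W2_le_commute[OF assms(2,1)] W2_le_commute[OF assms]])

text \<open>The two couplings are glued along the cell of the middle point instead of the point
  itself. The two middle points are then distinct but closer than \<delta>, and this is the third
  summand of \<open>L2_three_bound\<close>.\<close>

lemma W2_triangle:
  assumes "\<mu>1 \<in> P2 X" "\<mu>2 \<in> P2 X" "\<mu>3 \<in> P2 X"
  shows "W2 X \<mu>1 \<mu>3 \<le> W2 X \<mu>1 \<mu>2 + W2 X \<mu>2 \<mu>3"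
proof (rule field_le_epsilon)
  fix e :: real assume "e > 0"
  define \<delta> where "\<delta> = e / 3"
  define A B where "A = W2 X \<mu>1 \<mu>2 + \<delta>" and "B = W2 X \<mu>2 \<mu>3 + \<delta>"
  have pos: "A > 0" "B > 0" "\<delta> > 0"
    using \<open>e > 0\<close> W2_nonneg[of X \<mu>1 \<mu>2] W2_nonneg[of X \<mu>2 \<mu>3] by (auto simp: A_def B_def \<delta>_def)
  obtain \<alpha> where \<alpha>: "\<alpha> \<in> couplings X \<mu>1 \<mu>2" "transport_cost \<alpha> < ennreal (A\<^sup>2)"
    using W2_less_iff[OF assms(1,2) pos(1)] pos by (auto simp: A_def)
  obtain \<beta> where \<beta>: "\<beta> \<in> couplings X \<mu>2 \<mu>3" "transport_cost \<beta> < ennreal (B\<^sup>2)"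
    using W2_less_iff[OF assms(2,3) pos(2)] pos by (auto simp: B_def)
  note a = couplingsD[OF \<alpha>(1)] and b = couplingsD[OF \<beta>(1)]
  obtain cell :: "'a \<Rightarrow> nat" where cell [measurable]: "cell \<in> measurable (borel_metric X) (count_space UNIV)"
    and cd: "\<And>x y. \<lbrakk>x \<in> mspace X; y \<in> mspace X; cell x = cell y\<rbrakk> \<Longrightarrow> mdist X x y < \<delta>"
    using measurable_cells[OF pos(3)] by metis
  have [measurable]: "fst \<in> measurable \<alpha> (borel_metric X)" "snd \<in> measurable \<alpha> (borel_metric X)"
    "fst \<in> measurable \<beta> (borel_metric X)" "snd \<in> measurable \<beta> (borel_metric X)"
    by (simp_all add: a b)
  have "emeasure \<alpha> {x \<in> space \<alpha>. cell (snd x) = i} = emeasure \<beta> {x \<in> space \<beta>. cell (fst x) = i}" for i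
  proof -
    have "emeasure \<alpha> {x \<in> space \<alpha>. cell (snd x) = i}
        = emeasure (distr \<alpha> (borel_metric X) snd) {x \<in> space (borel_metric X). cell x = i}"
      by (rule emeasure_fibre_distr) measurable
    also have "\<dots> = emeasure (distr \<beta> (borel_metric X) fst) {x \<in> space (borel_metric X). cell x = i}"
      by (simp only: a b)
    also have "\<dots> = emeasure \<beta> {x \<in> space \<beta>. cell (fst x) = i}"
      by (rule emeasure_fibre_distr[symmetric]) measurable
    finally show ?thesis .
  qed
  then obtain \<gamma> where \<gamma>: "sets \<gamma> = sets (\<alpha> \<Otimes>\<^sub>M \<beta>)" "prob_space \<gamma>" "distr \<gamma> \<alpha> fst = \<alpha>" "distr \<gamma> \<beta> snd = \<beta>"
    "AE z in \<gamma>. cell (snd (fst z)) = cell (fst (snd z))"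
    using countable_gluing[OF a(2) b(2), of "\<lambda>x. cell (snd x)" "\<lambda>x. cell (fst x)"] by auto
  have [measurable]: "fst \<in> measurable \<gamma> \<alpha>" "snd \<in> measurable \<gamma> \<beta>"
    by (simp_all add: measurable_cong_sets[OF \<gamma>(1) refl])
  have sp: "space \<gamma> = (mspace X \<times> mspace X) \<times> (mspace X \<times> mspace X)"
    using sets_eq_imp_space_eq[OF \<gamma>(1)] by (simp add: space_pair_measure a b)
  have "W2 X \<mu>1 \<mu>3 < A + B + \<delta>"
  proof (rule W2_lessI[of \<gamma> "\<lambda>z. fst (fst z)" "\<lambda>z. snd (snd z)"])
    have "distr \<gamma> (borel_metric X) (\<lambda>z. fst (fst z)) = distr (distr \<gamma> \<alpha> fst) (borel_metric X) fst"
      by (subst distr_distr) (auto simp: comp_def)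
    then show "distr \<gamma> (borel_metric X) (\<lambda>z. fst (fst z)) = \<mu>1" by (simp add: \<gamma> a)
    have "distr \<gamma> (borel_metric X) (\<lambda>z. snd (snd z)) = distr (distr \<gamma> \<beta> snd) (borel_metric X) snd"
      by (subst distr_distr) (auto simp: comp_def)
    then show "distr \<gamma> (borel_metric X) (\<lambda>z. snd (snd z)) = \<mu>3" by (simp add: \<gamma> b)
    show "(\<integral>\<^sup>+ z. ennreal ((mdist X (fst (fst z)) (snd (snd z)))\<^sup>2) \<partial>\<gamma>) < ennreal ((A + B + \<delta>)\<^sup>2)"
    proof (rule L2_three_bound[OF \<gamma>(2)])
      show "AE z in \<gamma>. 0 \<le> mdist X (fst (fst z)) (snd (snd z)) \<and> mdist X (fst (fst z)) (snd (snd z))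
         \<le> mdist X (fst (fst z)) (snd (fst z)) + mdist X (fst (snd z)) (snd (snd z)) + \<delta>"
        using \<gamma>(5) AE_space
      proof eventually_elim
        case (elim z)
        then have z: "fst (fst z) \<in> mspace X" "snd (fst z) \<in> mspace X" "fst (snd z) \<in> mspace X" "snd (snd z) \<in> mspace X"
          by (auto simp: sp)
        have "mdist X (fst (fst z)) (snd (snd z)) \<le> mdist X (fst (fst z)) (snd (fst z)) + mdist X (snd (fst z)) (snd (snd z))"
          by (rule triangle[OF z(1,2,4)])
        moreover have "mdist X (snd (fst z)) (snd (snd z)) \<le> mdist X (snd (fst z)) (fst (snd z)) + mdist X (fst (snd z)) (snd (snd z))"
          by (rule triangle[OF z(2,3,4)])
        moreover have "mdist X (snd (fst z)) (fst (snd z)) < \<delta>" using cd elim z by simp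
        ultimately show ?case by simp
      qed
      have "(\<integral>\<^sup>+ z. ennreal ((mdist X (fst (fst z)) (snd (fst z)))\<^sup>2) \<partial>\<gamma>) = transport_cost (distr \<gamma> \<alpha> fst)"
        by (subst nn_integral_distr) auto
      then show "(\<integral>\<^sup>+ z. ennreal ((mdist X (fst (fst z)) (snd (fst z)))\<^sup>2) \<partial>\<gamma>) < ennreal (A\<^sup>2)"
        by (simp add: \<gamma> \<alpha>)
      have "(\<integral>\<^sup>+ z. ennreal ((mdist X (fst (snd z)) (snd (snd z)))\<^sup>2) \<partial>\<gamma>) = transport_cost (distr \<gamma> \<beta> snd)"
        by (subst nn_integral_distr) auto
      then show "(\<integral>\<^sup>+ z. ennreal ((mdist X (fst (snd z)) (snd (snd z)))\<^sup>2) \<partial>\<gamma>) < ennreal (B\<^sup>2)"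
        by (simp add: \<gamma> \<beta>)
    qed (use pos in simp_all)
  qed (use pos \<gamma> in simp_all)
  then show "W2 X \<mu>1 \<mu>3 \<le> W2 X \<mu>1 \<mu>2 + W2 X \<mu>2 \<mu>3 + e"
    by (simp add: A_def B_def \<delta>_def)
qed

end


section \<open>Wasserstein metric and weak convergence\<close>

text \<open>Using only the digits 0 and 1 in base 3 leaves gaps. If j is the first index of
  disagreement, its term contributes (1/3)^j and all later ones together at most half of that, so
  the sums differ by at least (1/3)^j / 2. In base 2 the tail could cancel the leading term.\<close>

lemma ternary_digits_eq:
  fixes a b :: "nat \<Rightarrow> bool"
  assumes "\<bar>(\<Sum>l. of_bool (a l) * (1/3) ^ l) - (\<Sum>l. of_bool (b l) * (1/3) ^ l)\<bar> < (1/3 :: real) ^ K / 2"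
    and "k \<le> K"
  shows "a k = b k"
proof (rule ccontr)
  assume "a k \<noteq> b k"
  define j where "j = (LEAST j. a j \<noteq> b j)"
  have j: "a j \<noteq> b j" unfolding j_def by (rule LeastI) fact
  have "j \<le> k" unfolding j_def by (rule Least_le) fact
  have lt: "a i = b i" if "i < j" for i using not_less_Least that unfolding j_def by blast
  have sm: "summable (\<lambda>l. of_bool (c l) * (1/3 :: real) ^ l)" for c
    by (rule summable_comparison_test'[of "\<lambda>l. (1/3) ^ l" 0]) (auto intro: summable_geometric)
  define f :: "nat \<Rightarrow> real" where "f l = (of_bool (a l) - of_bool (b l)) * (1/3) ^ l" for l
  have f_eq: "f l = of_bool (a l) * (1/3) ^ l - of_bool (b l) * (1/3) ^ l" for l
    by (simp add: f_def algebra_simps)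
  have f: "summable f" unfolding f_eq by (intro summable_diff sm)
  have sum_f: "(\<Sum>l. of_bool (a l) * (1/3) ^ l) - (\<Sum>l. of_bool (b l) * (1/3 :: real) ^ l) = suminf f"
    unfolding f_eq by (rule suminf_diff[OF sm sm])
  have "suminf f = (\<Sum>n. f (n + Suc j)) + (\<Sum>i<Suc j. f i)"
    by (rule suminf_split_initial_segment[OF f])
  also have "(\<Sum>i<Suc j. f i) = f j"
    using lt by (simp add: f_def)
  finally have split: "suminf f = (\<Sum>n. f (n + Suc j)) + f j" .
  have g: "(\<lambda>n. (1/3) ^ Suc j * (1/3 :: real) ^ n) sums ((1/3) ^ Suc j * (3/2))"
    using geometric_sums[of "1/3 :: real"] by (intro sums_mult) simp
  have bd: "\<bar>f (n + Suc j)\<bar> \<le> (1/3) ^ Suc j * (1/3) ^ n" for n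
    by (auto simp: f_def power_add abs_mult)
  have sg: "summable (\<lambda>n. (1/3) ^ Suc j * (1/3 :: real) ^ n)" using g by (rule sums_summable)
  have sa: "summable (\<lambda>n. \<bar>f (n + Suc j)\<bar>)"
    by (rule summable_comparison_test'[OF sg, of 0]) (use bd in auto)
  have "\<bar>\<Sum>n. f (n + Suc j)\<bar> \<le> (\<Sum>n. \<bar>f (n + Suc j)\<bar>)"
    by (rule summable_rabs[OF sa])
  also have "\<dots> \<le> (\<Sum>n. (1/3) ^ Suc j * (1/3 :: real) ^ n)"
    by (rule suminf_le[OF bd sa sg])
  also have "\<dots> = (1/3) ^ j / 2" using g by (simp add: sums_iff)
  finally have "\<bar>\<Sum>n. f (n + Suc j)\<bar> \<le> (1/3) ^ j / 2" .
  moreover have "\<bar>f j\<bar> = (1/3) ^ j" using j by (auto simp: f_def of_bool_def)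
  ultimately have "\<bar>suminf f\<bar> \<ge> (1/3) ^ j / 2" unfolding split by linarith
  moreover have "(1/3 :: real) ^ K \<le> (1/3) ^ j"
    using \<open>j \<le> k\<close> \<open>k \<le> K\<close> by (intro power_decreasing) auto
  ultimately show False using assms(1) unfolding sum_f by linarith
qed

context compact_metric
begin

lemma integrable_bounded:
  assumes "\<mu> \<in> P2 X" "\<phi> \<in> borel_measurable (borel_metric X)" "\<And>x. x \<in> mspace X \<Longrightarrow> \<bar>\<phi> x\<bar> \<le> B"
  shows "integrable \<mu> (\<phi> :: 'a \<Rightarrow> real)"
proof -
  interpret prob_space \<mu> using P2_D(2)[OF assms(1)] .
  show ?thesis
    by (rule integrable_const_bound[where B = B]) (use assms P2_D[OF assms(1)] in \<open>auto simp: measurable_P2\<close>)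
qed

lemma integrable_continuous:
  assumes "\<mu> \<in> P2 X" "continuous_map (mtopology_of X) euclideanreal \<phi>"
  shows "integrable \<mu> \<phi>"
  using bounded_continuous[OF assms(2)] integrable_bounded[OF assms(1) borel_measurable_continuous_map[OF assms(2)]]
  by metis

text \<open>The distance g to the complement is positive exactly on the open set, so
  \<open>min 1 (n * g)\<close> increases to its indicator. An empty complement is treated apart
  because g would be an infimum over the empty set.\<close>

lemma open_indicator_approx:
  assumes "openin (mtopology_of X) S"
  obtains \<phi> :: "nat \<Rightarrow> 'a \<Rightarrow> real"
  where "\<And>n. continuous_map (mtopology_of X) euclideanreal (\<phi> n)"
    and "\<And>n x. 0 \<le> \<phi> n x" "\<And>n x. \<phi> n x \<le> 1"
    and "\<And>x. x \<in> mspace X \<Longrightarrow> (\<lambda>n. \<phi> n x) \<longlonglongrightarrow> indicator S x"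
proof (cases "mspace X - S = {}")
  case True
  then show thesis
    by (intro that[of "\<lambda>_ _. 1"]) (auto simp: indicator_def)
next
  case False
  define C where "C = mspace X - S"
  have C: "C \<noteq> {}" "C \<subseteq> mspace X" using False by (auto simp: C_def)
  define g where "g x = (INF c\<in>C. mdist X x c)" for x
  have bdd: "bdd_below (mdist X x ` C)" for x by (rule bdd_belowI[of _ 0]) auto
  have g_nonneg: "0 \<le> g x" for x unfolding g_def using C by (intro cINF_greatest) auto
  have g_lip: "g x \<le> mdist X x y + g y" if "x \<in> mspace X" "y \<in> mspace X" for x y
  proof -
    have "g x - mdist X x y \<le> g y"
      unfolding g_def[of y]
    proof (rule cINF_greatest[OF C(1)])
      fix c assume c: "c \<in> C"
      have "g x \<le> mdist X x c" unfolding g_def by (rule cINF_lower[OF bdd c])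
      also have "\<dots> \<le> mdist X x y + mdist X y c" using c C that by (intro triangle) auto
      finally show "g x - mdist X x y \<le> mdist X y c" by simp
    qed
    then show ?thesis by simp
  qed
  have "dist (g x) (g y) \<le> 1 * mdist X x y" if "x \<in> mspace X" "y \<in> mspace X" for x y
    using g_lip[OF that] g_lip[OF that(2,1)] by (simp add: dist_real_def commute[of y x] abs_le_iff)
  then have "Lipschitz_continuous_map X euclidean_metric g"
    unfolding Lipschitz_continuous_map_def by (intro conjI exI[of _ 1]) auto
  then have cont: "continuous_map (mtopology_of X) euclideanreal g"
    using Lipschitz_continuous_imp_continuous_map by fastforce
  show thesis
  proof (rule that[of "\<lambda>n x. min 1 (real n * g x)"])
    show "continuous_map (mtopology_of X) euclideanreal (\<lambda>x. min 1 (real n * g x))" for n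
      by (rule continuous_map_real_min[OF continuous_map_const[THEN iffD2] continuous_map_real_mult_left[OF cont]]) simp
    show "0 \<le> min 1 (real n * g x)" for n x using g_nonneg[of x] by simp
    show "min 1 (real n * g x) \<le> 1" for n x by simp
    fix x assume x: "x \<in> mspace X"
    show "(\<lambda>n. min 1 (real n * g x)) \<longlonglongrightarrow> indicator S x"
    proof (cases "x \<in> S")
      case False
      then have "x \<in> C" using x by (simp add: C_def)
      then have "g x \<le> mdist X x x" unfolding g_def by (rule cINF_lower[OF bdd])
      then have "g x = 0" using x g_nonneg[of x] by simp
      then show ?thesis using False by simp
    next
      case True
      then obtain r where r: "r > 0" "mball x r \<subseteq> S"
        using assms by (auto simp: mtopology_eq openin_mtopology)
      have "r \<le> g x" unfolding g_def
      proof (rule cINF_greatest[OF C(1)])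
        fix c assume "c \<in> C"
        then have "c \<notin> mball x r" using r by (auto simp: C_def)
        with \<open>c \<in> C\<close> C x show "r \<le> mdist X x c" by (auto simp: mball_def)
      qed
      obtain N :: nat where N: "1 / r < real N" using reals_Archimedean2 by blast
      have "min 1 (real n * g x) = 1" if "n \<ge> N" for n
      proof -
        have "1 \<le> real N * r" using N r by (simp add: field_simps)
        also have "\<dots> \<le> real n * g x" using that \<open>r \<le> g x\<close> r by (intro mult_mono) auto
        finally show ?thesis by simp
      qed
      then have "\<forall>\<^sub>F n in sequentially. min 1 (real n * g x) = 1"
        unfolding eventually_sequentially by blast
      then show ?thesis using True by (simp add: tendsto_eventually)
    qed
  qed
qed

text \<open>Open sets are stable under intersection and generate the sigma-algebra; their measures
  are limits of integrals of continuous functions by dominated convergence.\<close>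

lemma P2_eqI:
  assumes \<mu>: "\<mu> \<in> P2 X" and \<mu>': "\<mu>' \<in> P2 X"
    and eq: "\<And>\<phi>. continuous_map (mtopology_of X) euclideanreal \<phi> \<Longrightarrow> integral\<^sup>L \<mu> \<phi> = integral\<^sup>L \<mu>' \<phi>"
  shows "\<mu> = \<mu>'"
proof (rule measure_eqI_generator_eq[of "{S. openin (mtopology_of X) S}" "mspace X" \<mu> \<mu>' "\<lambda>_. mspace X"])
  note m = P2_D[OF \<mu>] and m' = P2_D[OF \<mu>']
  interpret \<mu>: prob_space \<mu> by (fact m)
  interpret \<mu>': prob_space \<mu>' by (fact m')
  show "sets \<mu> = sigma_sets (mspace X) {S. openin (mtopology_of X) S}"
    "sets \<mu>' = sigma_sets (mspace X) {S. openin (mtopology_of X) S}"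
    by (simp_all add: m m' sets_borel_metric)
  show "Int_stable {S. openin (mtopology_of X) S}" by (auto simp: Int_stable_def)
  show "{S. openin (mtopology_of X) S} \<subseteq> Pow (mspace X)" using openin_subset by fastforce
  show "range (\<lambda>_. mspace X) \<subseteq> {S. openin (mtopology_of X) S}"
    using openin_topspace[of "mtopology_of X"] by auto
  show "emeasure \<mu> (mspace X) \<noteq> \<infinity>" by simp
  fix S assume S: "S \<in> {S. openin (mtopology_of X) S}"
  obtain \<phi> :: "nat \<Rightarrow> 'a \<Rightarrow> real" where \<phi>: "\<And>n. continuous_map (mtopology_of X) euclideanreal (\<phi> n)"
    "\<And>n x. 0 \<le> \<phi> n x" "\<And>n x. \<phi> n x \<le> 1" "\<And>x. x \<in> mspace X \<Longrightarrow> (\<lambda>n. \<phi> n x) \<longlonglongrightarrow> indicator S x"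
    using open_indicator_approx S by blast
  have lim: "(\<lambda>n. integral\<^sup>L M (\<phi> n)) \<longlonglongrightarrow> measure M S" if M: "M \<in> P2 X" for M
  proof -
    note M' = P2_D[OF M]
    interpret prob_space M by (fact M')
    have SM: "S \<in> sets M" using S by (auto simp: M' openin_in_sets_borel_metric)
    have "(\<lambda>n. integral\<^sup>L M (\<phi> n)) \<longlonglongrightarrow> integral\<^sup>L M (indicator S)"
    proof (rule integral_dominated_convergence[where w = "\<lambda>_. 1"])
      show "\<phi> n \<in> borel_measurable M" for n
        using borel_measurable_continuous_map[OF \<phi>(1)] by (simp add: measurable_P2[OF M])
      show "AE x in M. (\<lambda>n. \<phi> n x) \<longlonglongrightarrow> indicator S x"
        using \<phi>(4) by (intro AE_I2) (simp add: M')
    qed (use \<phi> SM in auto)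
    then show ?thesis using SM sets.sets_into_space[OF SM] by (simp add: Int_absorb2)
  qed
  have "measure \<mu> S = measure \<mu>' S"
    using LIMSEQ_unique[OF lim[OF \<mu>]] lim[OF \<mu>'] eq[OF \<phi>(1)] by simp
  then show "emeasure \<mu> S = emeasure \<mu>' S"
    by (simp add: \<mu>.emeasure_eq_measure \<mu>'.emeasure_eq_measure)
qed auto

text \<open>Near the diagonal uniform continuity bounds the oscillation of \<phi> by \<eta>; at
  distance d at least \<delta> the bound 2B is at most (2B/\<delta>^2) d^2. Integrating against a
  coupling of small cost gives the estimate. The constant depends on \<phi> and \<eta> but not on
  the two measures.\<close>

lemma integral_diff_le_W2:
  assumes \<phi>: "continuous_map (mtopology_of X) euclideanreal \<phi>" and "\<eta> > 0"
  obtains C where "C > 0" "\<And>\<mu> \<mu>' A. \<lbrakk>\<mu> \<in> P2 X; \<mu>' \<in> P2 X; A > 0; W2 X \<mu> \<mu>' < A\<rbrakk>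
    \<Longrightarrow> \<bar>integral\<^sup>L \<mu> \<phi> - integral\<^sup>L \<mu>' \<phi>\<bar> \<le> \<eta> + C * A\<^sup>2"
proof -
  obtain \<delta> where \<delta>: "\<delta> > 0" "\<And>x y. \<lbrakk>x \<in> mspace X; y \<in> mspace X; mdist X x y < \<delta>\<rbrakk> \<Longrightarrow> \<bar>\<phi> x - \<phi> y\<bar> < \<eta>"
    using uniformly_continuous[OF assms] by metis
  obtain B where B: "B > 0" "\<And>x. x \<in> mspace X \<Longrightarrow> \<bar>\<phi> x\<bar> \<le> B"
    using bounded_continuous[OF \<phi>] by metis
  define C where "C = 2 * B / \<delta>\<^sup>2"
  have C: "C > 0" using B \<delta> by (simp add: C_def)
  have pt: "\<bar>\<phi> x - \<phi> y\<bar> \<le> \<eta> + C * (mdist X x y)\<^sup>2" if "x \<in> mspace X" "y \<in> mspace X" for x y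
  proof (cases "mdist X x y < \<delta>")
    case True
    then have "\<bar>\<phi> x - \<phi> y\<bar> < \<eta>" using \<delta> that by auto
    moreover have "0 \<le> C * (mdist X x y)\<^sup>2" using C by simp
    ultimately show ?thesis by linarith
  next
    case False
    have "\<bar>\<phi> x - \<phi> y\<bar> \<le> 2 * B" using B(2)[OF that(1)] B(2)[OF that(2)] by linarith
    also have "\<dots> = C * \<delta>\<^sup>2" using \<delta> by (simp add: C_def)
    also have "\<dots> \<le> C * (mdist X x y)\<^sup>2"
      using False C \<delta> by (intro mult_left_mono power_mono) auto
    finally show ?thesis using \<open>\<eta> > 0\<close> by linarith
  qed
  obtain D where D: "D > 0" "\<And>x y. x \<in> mspace X \<Longrightarrow> y \<in> mspace X \<Longrightarrow> mdist X x y \<le> D"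
    using bounded_mdist by blast
  show thesis
  proof (rule that[OF C])
    fix \<mu> \<mu>' and A :: real assume \<mu>: "\<mu> \<in> P2 X" "\<mu>' \<in> P2 X" and A: "A > 0" "W2 X \<mu> \<mu>' < A"
    obtain \<pi> where \<pi>: "\<pi> \<in> couplings X \<mu> \<mu>'" "transport_cost \<pi> < ennreal (A\<^sup>2)"
      using A W2_less_iff[OF \<mu>] by auto
    note p = couplingsD[OF \<pi>(1)]
    interpret prob_space \<pi> by (fact p)
    have [measurable]: "\<phi> \<in> borel_measurable (borel_metric X)"
      using \<phi> by (rule borel_measurable_continuous_map)
    have [measurable]: "fst \<in> measurable \<pi> (borel_metric X)" "snd \<in> measurable \<pi> (borel_metric X)"
      by (simp_all add: p)
    have sq: "integrable \<pi> (\<lambda>z. (mdist X (fst z) (snd z))\<^sup>2)"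
      by (rule integrable_const_bound[where B = "D\<^sup>2"]) (use D p in \<open>auto intro!: power_mono\<close>)
    have "ennreal (\<integral>z. (mdist X (fst z) (snd z))\<^sup>2 \<partial>\<pi>) < ennreal (A\<^sup>2)"
      using \<pi>(2) nn_integral_eq_integral[OF sq] by simp
    then have cost: "(\<integral>z. (mdist X (fst z) (snd z))\<^sup>2 \<partial>\<pi>) < A\<^sup>2"
      by (simp add: ennreal_less_iff)
    have int: "integrable \<pi> (\<lambda>z. \<phi> (fst z))" "integrable \<pi> (\<lambda>z. \<phi> (snd z))"
      by (rule integrable_const_bound[where B = B]; use B p in auto)+
    have "integral\<^sup>L \<mu> \<phi> - integral\<^sup>L \<mu>' \<phi> = integral\<^sup>L (distr \<pi> (borel_metric X) fst) \<phi> - integral\<^sup>L (distr \<pi> (borel_metric X) snd) \<phi>"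
      by (simp add: p)
    also have "\<dots> = (\<integral>z. \<phi> (fst z) - \<phi> (snd z) \<partial>\<pi>)"
      using int by (simp add: integral_distr)
    finally have "\<bar>integral\<^sup>L \<mu> \<phi> - integral\<^sup>L \<mu>' \<phi>\<bar> \<le> (\<integral>z. \<bar>\<phi> (fst z) - \<phi> (snd z)\<bar> \<partial>\<pi>)"
      by simp
    also have "\<dots> \<le> (\<integral>z. \<eta> + C * (mdist X (fst z) (snd z))\<^sup>2 \<partial>\<pi>)"
      using int sq pt by (intro integral_mono) (auto simp: p)
    also have "\<dots> = \<eta> + C * (\<integral>z. (mdist X (fst z) (snd z))\<^sup>2 \<partial>\<pi>)"
      using sq by (simp add: prob_space)
    also have "\<dots> \<le> \<eta> + C * A\<^sup>2"
      using cost C by simp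
    finally show "\<bar>integral\<^sup>L \<mu> \<phi> - integral\<^sup>L \<mu>' \<phi>\<bar> \<le> \<eta> + C * A\<^sup>2" .
  qed
qed

lemma weak_star_if_W2:
  assumes \<mu>: "\<And>n. \<mu> n \<in> P2 X" "\<mu>' \<in> P2 X" and lim: "(\<lambda>n. W2 X (\<mu> n) \<mu>') \<longlonglongrightarrow> 0"
  shows "weak_star_converges X \<mu> \<mu>'"
  unfolding weak_star_converges_def
proof (intro allI impI)
  fix \<phi> assume \<phi>: "continuous_map (mtopology_of X) euclideanreal \<phi>"
  show "(\<lambda>n. integral\<^sup>L (\<mu> n) \<phi>) \<longlonglongrightarrow> integral\<^sup>L \<mu>' \<phi>"
  proof (rule tendstoI)
    fix e :: real assume e: "e > 0"
    obtain C where C: "C > 0" "\<And>\<mu> \<mu>' A. \<lbrakk>\<mu> \<in> P2 X; \<mu>' \<in> P2 X; A > 0; W2 X \<mu> \<mu>' < A\<rbrakk>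
      \<Longrightarrow> \<bar>integral\<^sup>L \<mu> \<phi> - integral\<^sup>L \<mu>' \<phi>\<bar> \<le> e / 3 + C * A\<^sup>2"
      using integral_diff_le_W2[OF \<phi>, of "e / 3"] e by auto
    define A where "A = sqrt (e / (3 * C))"
    have A: "A > 0" "C * A\<^sup>2 = e / 3" using e C by (auto simp: A_def)
    have "\<forall>\<^sub>F n in sequentially. W2 X (\<mu> n) \<mu>' < A"
      using order_tendstoD(2)[OF lim A(1)] .
    then show "\<forall>\<^sub>F n in sequentially. dist (integral\<^sup>L (\<mu> n) \<phi>) (integral\<^sup>L \<mu>' \<phi>) < e"
    proof eventually_elim
      case (elim n)
      from C(2)[OF \<mu>(1) \<mu>(2) A(1) this] show ?case using A e by (simp add: dist_real_def)
    qed
  qed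
qed

lemma weak_star_unique:
  assumes "weak_star_converges X \<mu> \<mu>1" "weak_star_converges X \<mu> \<mu>2" "\<mu>1 \<in> P2 X" "\<mu>2 \<in> P2 X"
  shows "\<mu>1 = \<mu>2"
proof (rule P2_eqI[OF assms(3,4)])
  fix \<phi> assume "continuous_map (mtopology_of X) euclideanreal \<phi>"
  with assms(1,2) show "integral\<^sup>L \<mu>1 \<phi> = integral\<^sup>L \<mu>2 \<phi>"
    unfolding weak_star_converges_def by (blast intro: LIMSEQ_unique)
qed

lemma W2_eq_0:
  assumes "\<mu> \<in> P2 X" "\<mu>' \<in> P2 X" "W2 X \<mu> \<mu>' = 0"
  shows "\<mu> = \<mu>'"
proof (rule weak_star_unique[of "\<lambda>_. \<mu>"])
  show "weak_star_converges X (\<lambda>_. \<mu>) \<mu>" by (simp add: weak_star_converges_def)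
  show "weak_star_converges X (\<lambda>_. \<mu>) \<mu>'" using assms by (intro weak_star_if_W2) auto
qed (use assms in auto)

end


section \<open>Compactness of the space of probability measures\<close>

context compact_metric
begin

text \<open>The digits of the code of a point record the members of a countable family of small Borel
  sets that contain it, so that decoding is uniformly continuous although coding is only Borel.\<close>

lemma borel_code:
  obtains s :: "'a \<Rightarrow> real" where "s \<in> borel_measurable (borel_metric X)"
    and "\<And>x. 0 \<le> s x" "\<And>x. s x \<le> 3/2"
    and "\<And>\<delta>. \<delta> > 0 \<Longrightarrow> \<exists>\<eta>>0. \<forall>x\<in>mspace X. \<forall>y\<in>mspace X. \<bar>s x - s y\<bar> < \<eta> \<longrightarrow> mdist X x y < \<delta>"
proof -
  have "\<exists>(cell :: 'a \<Rightarrow> nat) N. cell \<in> measurable (borel_metric X) (count_space UNIV) \<and>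
     (\<forall>x\<in>mspace X. cell x < N) \<and>
     (\<forall>x\<in>mspace X. \<forall>y\<in>mspace X. cell x = cell y \<longrightarrow> mdist X x y < inverse (Suc n))" for n
    by (rule measurable_cells[of "inverse (Suc n)"]) auto
  then obtain cell :: "nat \<Rightarrow> 'a \<Rightarrow> nat" and N where
    cell [measurable]: "\<And>n. cell n \<in> measurable (borel_metric X) (count_space UNIV)" and
    N: "\<And>n x. x \<in> mspace X \<Longrightarrow> cell n x < N n" and
    c: "\<And>n x y. x \<in> mspace X \<Longrightarrow> y \<in> mspace X \<Longrightarrow> cell n x = cell n y \<Longrightarrow> mdist X x y < inverse (Suc n)"
    by metis
  \<comment> \<open>Digit \<open>prod_encode (n, j)\<close> of the code tells whether the point lies
    in cell j of the n-th partition.\<close>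
  define a where "a x k \<longleftrightarrow> cell (fst (prod_decode k)) x = snd (prod_decode k)" for x k
  define s where "s x = (\<Sum>k. of_bool (a x k) * (1/3) ^ k :: real)" for x
  have g: "(\<lambda>k. (1/3 :: real) ^ k) sums (3/2)"
    using geometric_sums[of "1/3 :: real"] by simp
  have sm: "summable (\<lambda>k. of_bool (a x k) * (1/3 :: real) ^ k)" for x
    by (rule summable_comparison_test'[OF sums_summable[OF g], of 0]) auto
  show thesis
  proof (rule that[of s])
    have "Measurable.pred (borel_metric X) (\<lambda>x. a x k)" for k
      unfolding a_def by measurable
    then show "s \<in> borel_measurable (borel_metric X)"
      unfolding s_def of_bool_def by measurable
    show "0 \<le> s x" for x unfolding s_def by (rule suminf_nonneg[OF sm]) auto
    have "s x \<le> (\<Sum>k. (1/3) ^ k)" for x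
      unfolding s_def by (rule suminf_le[OF _ sm sums_summable[OF g]]) auto
    then show "s x \<le> 3/2" for x by (simp only: sums_unique[OF g, symmetric])
    fix \<delta> :: real assume "\<delta> > 0"
    then obtain n where n: "inverse (real (Suc n)) < \<delta>" using reals_Archimedean by blast
    \<comment> \<open>The n-th partition has indices below \<open>N n\<close>, so all its digits sit
      at positions up to K. Codes closer than (1/3)^K / 2 agree on all of them, hence the points
      share their n-th cell.\<close>
    define K where "K = Max ((\<lambda>j. prod_encode (n, j)) ` {..N n})"
    have "mdist X x y < \<delta>" if xy: "x \<in> mspace X" "y \<in> mspace X" "\<bar>s x - s y\<bar> < (1/3) ^ K / 2" for x y
    proof -
      have "a x (prod_encode (n, cell n x)) = a y (prod_encode (n, cell n x))"
      proof (rule ternary_digits_eq[of _ _ K])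
        show "\<bar>(\<Sum>l. of_bool (a x l) * (1/3) ^ l) - (\<Sum>l. of_bool (a y l) * (1/3) ^ l)\<bar> < (1/3 :: real) ^ K / 2"
          using xy(3) by (simp add: s_def)
        show "prod_encode (n, cell n x) \<le> K"
          unfolding K_def using N[OF xy(1), of n] by (intro Max_ge) auto
      qed
      then have "cell n x = cell n y" by (simp add: a_def)
      from c[OF xy(1,2) this] n show ?thesis by simp
    qed
    then show "\<exists>\<eta>>0. \<forall>x\<in>mspace X. \<forall>y\<in>mspace X. \<bar>s x - s y\<bar> < \<eta> \<longrightarrow> mdist X x y < \<delta>"
      by (intro exI[of _ "(1/3) ^ K / 2"]) auto
  qed
qed

text \<open>Decoding is uniformly continuous on the set of codes and X, being compact, is complete,
  so decoding extends continuously to the closure. The closure is essential: the code is only Borel,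
  its image need not be closed, and limits of codes lie merely in the closure. Off that closed set T
  is constant, which keeps it Borel.\<close>

lemma borel_decode:
  assumes s: "\<And>\<delta>. \<delta> > 0 \<Longrightarrow> \<exists>\<eta>>0. \<forall>x\<in>mspace X. \<forall>y\<in>mspace X. \<bar>s x - s y\<bar> < \<eta> \<longrightarrow> mdist X x y < \<delta>"
    and ne: "mspace X \<noteq> {}"
  obtains T :: "real \<Rightarrow> 'a" where "T \<in> measurable borel (borel_metric X)"
    and "\<And>x. x \<in> mspace X \<Longrightarrow> T (s x) = x"
    and "\<forall>c l. (\<forall>n. c n \<in> closure (s ` mspace X)) \<and> c \<longlonglongrightarrow> l \<longrightarrow> (\<lambda>n. mdist X (T (c n)) (T l)) \<longlonglongrightarrow> 0"
proof -
  define S where "S = s ` mspace X"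
  have inj: "inj_on s (mspace X)"
  proof (rule inj_onI)
    fix x y assume xy: "x \<in> mspace X" "y \<in> mspace X" "s x = s y"
    have "mdist X x y < \<delta>" if "\<delta> > 0" for \<delta>
      using s[OF that] xy by auto
    then have "mdist X x y \<le> 0" by (meson dense_ge less_imp_le)
    then show "x = y" using xy by (metis antisym nonneg zero)
  qed
  define f where "f = inv_into (mspace X) s"
  have f: "f (s x) = x" if "x \<in> mspace X" for x
    unfolding f_def using inj that by (rule inv_into_f_f)
  have "uniformly_continuous_map (submetric euclidean_metric S) X f"
    unfolding uniformly_continuous_map_def
  proof (intro conjI allI impI)
    show "f \<in> mspace (submetric euclidean_metric S) \<rightarrow> mspace X"
      using f by (auto simp: S_def)
    fix e :: real assume "e > 0"
    from s[OF this] obtain \<eta> where "\<eta> > 0" "\<forall>x\<in>mspace X. \<forall>y\<in>mspace X. \<bar>s x - s y\<bar> < \<eta> \<longrightarrow> mdist X x y < e" by blast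
    then show "\<exists>\<delta>>0. \<forall>x\<in>mspace (submetric euclidean_metric S). \<forall>y\<in>mspace (submetric euclidean_metric S).
        mdist (submetric euclidean_metric S) y x < \<delta> \<longrightarrow> mdist X (f y) (f x) < e"
      using f by (intro exI[of _ \<eta>]) (auto simp: S_def dist_real_def)
  qed
  then have "Cauchy_continuous_map (submetric euclidean_metric S) X f"
    by (rule uniformly_imp_Cauchy_continuous_map)
  moreover have "mcomplete_of X"
    using compact compact_space_imp_mcomplete by (simp add: mcomplete_of_def mtopology_eq)
  ultimately obtain g where g: "continuous_map (subtopology (mtopology_of euclidean_metric) (mtopology_of euclidean_metric closure_of S)) (mtopology_of X) g"
    "\<And>x. x \<in> S \<Longrightarrow> g x = f x"
    using Cauchy_continuous_map_extends_to_continuous_closure_of by blast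
  have g1: "continuous_map (top_of_set (closure S)) (mtopology_of X) g"
    using g(1) by (simp add: euclidean_closure_of)
  obtain x0 where x0: "x0 \<in> mspace X" using ne by blast
  define T where "T r = (if r \<in> closure S then g r else x0)" for r
  have gX: "g r \<in> mspace X" if "r \<in> closure S" for r
    using continuous_map_funspace[OF g1] that by auto
  show thesis
  proof (rule that)
    show "T \<in> measurable borel (borel_metric X)"
      unfolding borel_metric_def
    proof (rule measurable_measure_of)
      show "{S. openin (mtopology_of X) S} \<subseteq> Pow (mspace X)" using openin_subset by fastforce
      show "T \<in> space borel \<rightarrow> mspace X" using gX x0 by (auto simp: T_def)
      fix y assume y: "y \<in> {S. openin (mtopology_of X) S}"
      have "openin (top_of_set (closure S)) {r \<in> topspace (top_of_set (closure S)). g r \<in> y}"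
        using y by (intro openin_continuous_map_preimage[OF g1]) auto
      then obtain U where U: "open U" "{r \<in> closure S. g r \<in> y} = closure S \<inter> U"
        by (auto simp: openin_open)
      have "T -` y \<inter> space borel = (closure S \<inter> U) \<union> (if x0 \<in> y then - closure S else {})"
        unfolding U(2)[symmetric] by (auto simp: T_def split: if_splits)
      then show "T -` y \<inter> space borel \<in> sets borel"
        using U(1) by simp
    qed
    show "T (s x) = x" if "x \<in> mspace X" for x
      using that f g(2) closure_subset[of S] by (auto simp: T_def S_def)
    show "\<forall>c l. (\<forall>n. c n \<in> closure (s ` mspace X)) \<and> c \<longlonglongrightarrow> l \<longrightarrow> (\<lambda>n. mdist X (T (c n)) (T l)) \<longlonglongrightarrow> 0"
    proof (intro allI impI)
      fix c :: "nat \<Rightarrow> real" and l assume c: "(\<forall>n. c n \<in> closure (s ` mspace X)) \<and> c \<longlonglongrightarrow> l"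
      have l: "l \<in> closure S"
        using c closed_sequentially[OF closed_closure, of c] by (auto simp: S_def)
      have "limitin (top_of_set (closure S)) c l sequentially"
        using c l by (simp add: limitin_subtopology S_def)
      from continuous_map_limit[OF g1 this]
      have "limitin mtopology (g \<circ> c) (g l) sequentially" by (simp add: mtopology_eq)
      then have "(\<lambda>n. mdist X (g (c n)) (g l)) \<longlonglongrightarrow> 0"
        by (simp add: limitin_metric_dist_null)
      then show "(\<lambda>n. mdist X (T (c n)) (T l)) \<longlonglongrightarrow> 0"
        using c l by (simp add: T_def S_def)
    qed
  qed
qed

text \<open>Prokhorov's theorem reduced to the real line. The laws of the codes live on a bounded
  interval, hence are tight and have a weakly convergent subsequence. Skorohod's representation
  replaces it by pointwise convergent random variables; decoding these gives couplings on X whose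
  cost tends to 0 by dominated convergence, so the convergence is in W2 at once.\<close>

lemma W2_compact:
  assumes \<mu>: "\<And>n. \<mu> n \<in> P2 X"
  obtains r \<mu>' where "strict_mono (r :: nat \<Rightarrow> nat)" "\<mu>' \<in> P2 X" "(\<lambda>n. W2 X (\<mu> (r n)) \<mu>') \<longlonglongrightarrow> 0"
proof -
  have ne: "mspace X \<noteq> {}"
    using prob_space.not_empty[OF P2_D(2)[OF \<mu>[of 0]]] P2_D(3)[OF \<mu>[of 0]] by simp
  obtain s :: "'a \<Rightarrow> real" where s [measurable]: "s \<in> borel_measurable (borel_metric X)"
    and s_bd: "\<And>x. 0 \<le> s x" "\<And>x. s x \<le> 3/2"
    and s_uc: "\<And>\<delta>. \<delta> > 0 \<Longrightarrow> \<exists>\<eta>>0. \<forall>x\<in>mspace X. \<forall>y\<in>mspace X. \<bar>s x - s y\<bar> < \<eta> \<longrightarrow> mdist X x y < \<delta>"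
    by (rule borel_code) (rule that)
  obtain T where T [measurable]: "T \<in> measurable borel (borel_metric X)"
    and T_s: "\<And>x. x \<in> mspace X \<Longrightarrow> T (s x) = x"
    and T_lim: "\<forall>c l. (\<forall>n. c n \<in> closure (s ` mspace X)) \<and> c \<longlonglongrightarrow> l \<longrightarrow> (\<lambda>n. mdist X (T (c n)) (T l)) \<longlonglongrightarrow> 0"
    by (rule borel_decode[OF s_uc ne]) (assumption, rule that)
  define m where "m n = distr (\<mu> n) borel s" for n
  have s\<mu> [measurable]: "s \<in> borel_measurable (\<mu> n)" for n
    using s by (simp add: measurable_P2[OF \<mu>])
  have m: "real_distribution (m n)" for n
    unfolding m_def real_distribution_def real_distribution_axioms_def
    using prob_space.prob_space_distr[OF P2_D(2)[OF \<mu>] s\<mu>] by simp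
  have "tight m"
    unfolding tight_def
  proof (intro conjI allI impI)
    fix e :: real assume "e > 0"
    have "measure (m n) {-1<..2} = 1" for n
    proof -
      have "s x \<in> {-1<..2}" for x using s_bd[of x] by simp
      then have "s -` {-1<..2} \<inter> space (\<mu> n) = space (\<mu> n)" by auto
      then show ?thesis
        using prob_space.prob_space[OF P2_D(2)[OF \<mu>[of n]]] unfolding m_def by (subst measure_distr) auto
    qed
    then show "\<exists>a b. a < b \<and> (\<forall>n. 1 - e < measure (m n) {a<..b})"
      using \<open>e > 0\<close> by (intro exI[of _ "-1"] exI[of _ 2]) auto
  qed (rule m)
  from tight_imp_convergent_subsubsequence[OF this strict_mono_id]
  obtain r M where r: "strict_mono r" and M: "real_distribution M" and mM: "weak_conv_m (m \<circ> id \<circ> r) M"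
    by blast
  have "real_distribution ((m \<circ> id \<circ> r) n)" for n by (simp add: m)
  from Skorohod[OF this M mM] obtain \<Omega> :: "real measure" and Z :: "nat \<Rightarrow> real \<Rightarrow> real" and Z' where
    \<Omega>: "prob_space \<Omega>" and Z_meas: "\<forall>n. Z n \<in> borel_measurable \<Omega>"
    and Z_distr: "\<forall>n. distr \<Omega> borel (Z n) = (m \<circ> id \<circ> r) n"
    and Z': "Z' \<in> measurable \<Omega> lborel" and ZZ': "\<forall>x\<in>space \<Omega>. (\<lambda>n. Z n x) \<longlonglongrightarrow> Z' x"
    by blast
  have Z [measurable]: "Z n \<in> borel_measurable \<Omega>" for n using Z_meas by blast
  have dZ: "distr \<Omega> borel (Z n) = m (r n)" for n using Z_distr by simp
  interpret \<Omega>: prob_space \<Omega> by fact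
  have [measurable]: "Z' \<in> borel_measurable \<Omega>" using Z' by simp
  \<comment> \<open>\<open>Z n\<close> has the law of a code, so it takes values in the closure
    almost surely. The closure is measurable because it is closed, and \<open>T_lim\<close> asks
    only for membership in it.\<close>
  have cl: "AE \<omega> in \<Omega>. \<forall>n. Z n \<omega> \<in> closure (s ` mspace X)"
  proof (subst AE_all_countable, rule allI)
    fix n
    have "AE x in \<mu> (r n). s x \<in> closure (s ` mspace X)"
      using closure_subset[of "s ` mspace X"] P2_D(3)[OF \<mu>] by (intro AE_I2) auto
    then have "AE y in distr \<Omega> borel (Z n). y \<in> closure (s ` mspace X)"
      unfolding dZ m_def by (subst AE_distr_iff) auto
    then show "AE \<omega> in \<Omega>. Z n \<omega> \<in> closure (s ` mspace X)"
      by (subst (asm) AE_distr_iff) auto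
  qed
  define \<mu>' where "\<mu>' = distr \<Omega> (borel_metric X) (\<lambda>\<omega>. T (Z' \<omega>))"
  have \<mu>': "\<mu>' \<in> P2 X" unfolding \<mu>'_def by (rule distr_in_P2[OF \<Omega>]) measurable
  have dT: "distr \<Omega> (borel_metric X) (\<lambda>\<omega>. T (Z n \<omega>)) = \<mu> (r n)" for n
  proof -
    have "distr \<Omega> (borel_metric X) (\<lambda>\<omega>. T (Z n \<omega>)) = distr (distr \<Omega> borel (Z n)) (borel_metric X) T"
      by (subst distr_distr) (auto simp: comp_def)
    also have "\<dots> = distr (\<mu> (r n)) (borel_metric X) (\<lambda>x. T (s x))"
      unfolding dZ m_def by (subst distr_distr) (auto simp: comp_def)
    also have "\<dots> = distr (\<mu> (r n)) (borel_metric X) (\<lambda>x. x)"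
      by (rule distr_cong) (auto simp: T_s P2_D(3)[OF \<mu>])
    also have "\<dots> = \<mu> (r n)"
      by (rule distr_id2) (simp add: P2_D(1)[OF \<mu>])
    finally show ?thesis .
  qed
  obtain D where D: "D > 0" "\<And>x y. x \<in> mspace X \<Longrightarrow> y \<in> mspace X \<Longrightarrow> mdist X x y \<le> D"
    using bounded_mdist by blast
  have TX: "T y \<in> mspace X" for y using measurable_space[OF T, of y] by simp
  define h where "h n \<omega> = (mdist X (T (Z n \<omega>)) (T (Z' \<omega>)))\<^sup>2" for n \<omega>
  have h_meas [measurable]: "h n \<in> borel_measurable \<Omega>" for n unfolding h_def by measurable
  have h_bd: "\<bar>h n \<omega>\<bar> \<le> D\<^sup>2" for n \<omega> using D TX by (simp add: h_def power_mono)
  have int: "integrable \<Omega> (h n)" for n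
    by (rule \<Omega>.integrable_const_bound[where B = "D\<^sup>2"]) (use h_bd in auto)
  have "(\<lambda>n. integral\<^sup>L \<Omega> (h n)) \<longlonglongrightarrow> integral\<^sup>L \<Omega> (\<lambda>_. 0 :: real)"
  proof (rule integral_dominated_convergence[where w = "\<lambda>_. D\<^sup>2"])
    show "AE \<omega> in \<Omega>. (\<lambda>n. h n \<omega>) \<longlonglongrightarrow> 0"
      using cl AE_space
    proof eventually_elim
      case (elim \<omega>)
      have "(\<lambda>n. mdist X (T (Z n \<omega>)) (T (Z' \<omega>))) \<longlonglongrightarrow> 0"
        using elim ZZ' by (intro T_lim[rule_format]) auto
      from tendsto_power[OF this, of 2] show ?case by (simp add: h_def)
    qed
  qed (use h_bd in auto)
  then have lim: "(\<lambda>n. integral\<^sup>L \<Omega> (h n)) \<longlonglongrightarrow> 0" by simp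
  have "(\<lambda>n. W2 X (\<mu> (r n)) \<mu>') \<longlonglongrightarrow> 0"
  proof (rule tendstoI)
    fix e :: real assume e: "e > 0"
    then have "\<forall>\<^sub>F n in sequentially. integral\<^sup>L \<Omega> (h n) < e\<^sup>2"
      by (intro order_tendstoD(2)[OF lim]) auto
    then show "\<forall>\<^sub>F n in sequentially. dist (W2 X (\<mu> (r n)) \<mu>') 0 < e"
    proof eventually_elim
      case (elim n)
      have nn: "(\<integral>\<^sup>+ \<omega>. ennreal (h n \<omega>) \<partial>\<Omega>) = ennreal (integral\<^sup>L \<Omega> (h n))"
        by (rule nn_integral_eq_integral[OF int]) (simp add: h_def)
      have "W2 X (\<mu> (r n)) \<mu>' < e"
      proof (rule W2_lessI[OF \<Omega> _ _ dT \<mu>'_def[symmetric] e])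
        show "(\<integral>\<^sup>+ x. ennreal ((mdist X (T (Z n x)) (T (Z' x)))\<^sup>2) \<partial>\<Omega>) < ennreal (e\<^sup>2)"
          using nn elim by (simp add: h_def ennreal_less_iff integral_nonneg_AE)
      qed measurable
      then show ?case using W2_nonneg[of X "\<mu> (r n)" \<mu>'] by (simp add: dist_real_def)
    qed
  qed
  with r \<mu>' show thesis by (rule that)
qed

text \<open>A subsequence staying at distance at least e would by compactness have a further
  subsequence with a W2-limit; that is also a weak limit and therefore equals \<mu>', a
  contradiction.\<close>

lemma W2_if_weak_star:
  assumes \<mu>: "\<And>n. \<mu> n \<in> P2 X" "\<mu>' \<in> P2 X" and lim: "weak_star_converges X \<mu> \<mu>'"
  shows "(\<lambda>n. W2 X (\<mu> n) \<mu>') \<longlonglongrightarrow> 0"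
proof (rule ccontr)
  assume "\<not> ?thesis"
  then obtain e where "e > 0" "\<not> (\<forall>\<^sub>F n in sequentially. dist (W2 X (\<mu> n) \<mu>') 0 < e)"
    unfolding tendsto_iff by blast
  then have e: "e > 0" "\<exists>\<^sub>F n in sequentially. e \<le> W2 X (\<mu> n) \<mu>'"
    by (simp_all add: not_eventually not_less dist_real_def abs_of_nonneg[OF W2_nonneg])
  define A where "A = {n. e \<le> W2 X (\<mu> n) \<mu>'}"
  have inf: "infinite A"
    using e(2) by (simp add: A_def frequently_sequentially infinite_nat_iff_unbounded_le)
  define q where "q = enumerate A"
  have q: "strict_mono q" "\<And>n. q n \<in> A"
    unfolding q_def using inf by (auto intro: strict_mono_enumerate enumerate_in_set)
  obtain r \<mu>'' where r: "strict_mono (r :: nat \<Rightarrow> nat)" "\<mu>'' \<in> P2 X" "(\<lambda>n. W2 X (\<mu> (q (r n))) \<mu>'') \<longlonglongrightarrow> 0"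
    using W2_compact[of "\<lambda>n. \<mu> (q n)"] \<mu> by metis
  have "weak_star_converges X (\<lambda>n. \<mu> (q (r n))) \<mu>''"
    using \<mu> r by (intro weak_star_if_W2)
  moreover have "weak_star_converges X (\<lambda>n. \<mu> (q (r n))) \<mu>'"
    using lim LIMSEQ_subseq_LIMSEQ[OF _ strict_mono_o[OF q(1) r(1)]]
    unfolding weak_star_converges_def by (fastforce simp: comp_def)
  ultimately have "\<mu>'' = \<mu>'" using \<mu> r weak_star_unique by blast
  then have "\<forall>\<^sub>F n in sequentially. W2 X (\<mu> (q (r n))) \<mu>' < e"
    using r(3) e(1) by (intro order_tendstoD(2)) auto
  then obtain n where "W2 X (\<mu> (q (r n))) \<mu>' < e"
    unfolding eventually_sequentially by blast
  with q(2)[of "r n"] show False by (simp add: A_def)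
qed

end


section \<open>Approximate isometries and limits of geodesics\<close>

text \<open>A coupling of small cost is pushed forward by f in both coordinates; the distortion
  \<epsilon> enters as the constant summand of \<open>L2_three_bound\<close>.\<close>

lemma W2_distr_le:
  assumes X: "compact_metric X" and Y: "compact_metric Y"
    and f [measurable]: "f \<in> measurable (borel_metric X) (borel_metric Y)"
    and le: "\<And>x x'. \<lbrakk>x \<in> mspace X; x' \<in> mspace X\<rbrakk> \<Longrightarrow> mdist Y (f x) (f x') \<le> mdist X x x' + \<epsilon>"
    and "\<epsilon> \<ge> 0" and \<mu>: "\<mu> \<in> P2 X" "\<mu>' \<in> P2 X"
  shows "W2 Y (distr \<mu> (borel_metric Y) f) (distr \<mu>' (borel_metric Y) f) \<le> W2 X \<mu> \<mu>' + \<epsilon>"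
proof (rule field_le_epsilon)
  interpret X: compact_metric X by fact
  interpret Y: compact_metric Y by fact
  fix e :: real assume "e > 0"
  \<comment> \<open>The constant in \<open>L2_three_bound\<close> must be positive, so e/3 is added
    to \<epsilon>, which may be 0; B is the slack for the second function, here identically
    0.\<close>
  define A B \<delta> where "A = W2 X \<mu> \<mu>' + e / 3" and "B = e / 3" and "\<delta> = \<epsilon> + e / 3"
  have pos: "A > 0" "B > 0" "\<delta> > 0"
    using \<open>e > 0\<close> \<open>\<epsilon> \<ge> 0\<close> W2_nonneg[of X \<mu> \<mu>'] by (auto simp: A_def B_def \<delta>_def)
  obtain \<pi> where \<pi>: "\<pi> \<in> couplings X \<mu> \<mu>'" "X.transport_cost \<pi> < ennreal (A\<^sup>2)"
    using X.W2_less_iff[OF \<mu> pos(1)] \<open>e > 0\<close> by (auto simp: A_def)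
  note p = couplingsD[OF \<pi>(1)]
  have [measurable]: "fst \<in> measurable \<pi> (borel_metric X)" "snd \<in> measurable \<pi> (borel_metric X)"
    by (simp_all add: p)
  have "W2 Y (distr \<mu> (borel_metric Y) f) (distr \<mu>' (borel_metric Y) f) < A + B + \<delta>"
  proof (rule Y.W2_lessI[OF p(2), of "\<lambda>z. f (fst z)" "\<lambda>z. f (snd z)"])
    have "distr \<pi> (borel_metric Y) (\<lambda>z. f (fst z)) = distr (distr \<pi> (borel_metric X) fst) (borel_metric Y) f"
      by (subst distr_distr) (auto simp: comp_def)
    then show "distr \<pi> (borel_metric Y) (\<lambda>z. f (fst z)) = distr \<mu> (borel_metric Y) f" by (simp only: p)
    have "distr \<pi> (borel_metric Y) (\<lambda>z. f (snd z)) = distr (distr \<pi> (borel_metric X) snd) (borel_metric Y) f"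
      by (subst distr_distr) (auto simp: comp_def)
    then show "distr \<pi> (borel_metric Y) (\<lambda>z. f (snd z)) = distr \<mu>' (borel_metric Y) f" by (simp only: p)
    show "(\<integral>\<^sup>+ z. ennreal ((mdist Y (f (fst z)) (f (snd z)))\<^sup>2) \<partial>\<pi>) < ennreal ((A + B + \<delta>)\<^sup>2)"
    proof (rule L2_three_bound[OF p(2), where v = "\<lambda>_. 0"])
      show "AE z in \<pi>. 0 \<le> mdist Y (f (fst z)) (f (snd z)) \<and>
        mdist Y (f (fst z)) (f (snd z)) \<le> mdist X (fst z) (snd z) + 0 + \<delta>"
      proof (rule AE_I2)
        fix z assume "z \<in> space \<pi>"
        then have "mdist Y (f (fst z)) (f (snd z)) \<le> mdist X (fst z) (snd z) + \<epsilon>"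
          by (intro le) (auto simp: p)
        then show "0 \<le> mdist Y (f (fst z)) (f (snd z)) \<and>
          mdist Y (f (fst z)) (f (snd z)) \<le> mdist X (fst z) (snd z) + 0 + \<delta>"
          using \<open>e > 0\<close> by (simp add: \<delta>_def)
      qed
      show "X.transport_cost \<pi> < ennreal (A\<^sup>2)" by (fact \<pi>)
    qed (use pos in simp_all)
  qed (use pos in simp_all)
  then show "W2 Y (distr \<mu> (borel_metric Y) f) (distr \<mu>' (borel_metric Y) f) \<le> W2 X \<mu> \<mu>' + \<epsilon> + e"
    by (simp add: A_def B_def \<delta>_def)
qed

text \<open>A coupling of the push-forwards is lifted by gluing twice: a point x is attached to a
  pair (y, y') with f x in the cell of y, and then a point x' with f x' in the cell of y'. Hence
  d(x, x') is at most d(y, y') + \<epsilon> plus the two matching errors. No choice of preimages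
  under f is made.\<close>

lemma W2_le_distr:
  assumes X: "compact_metric X" and Y: "compact_metric Y"
    and f [measurable]: "f \<in> measurable (borel_metric X) (borel_metric Y)"
    and le: "\<And>x x'. \<lbrakk>x \<in> mspace X; x' \<in> mspace X\<rbrakk> \<Longrightarrow> mdist X x x' \<le> mdist Y (f x) (f x') + \<epsilon>"
    and "\<epsilon> \<ge> 0" and \<mu>: "\<mu> \<in> P2 X" "\<mu>' \<in> P2 X"
  shows "W2 X \<mu> \<mu>' \<le> W2 Y (distr \<mu> (borel_metric Y) f) (distr \<mu>' (borel_metric Y) f) + \<epsilon>"
proof (rule field_le_epsilon)
  interpret X: compact_metric X by fact
  interpret Y: compact_metric Y by fact
  fix e :: real assume "e > 0"
  note m = P2_D[OF \<mu>(1)] and m' = P2_D[OF \<mu>(2)]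
  have [measurable]: "f \<in> measurable \<mu> (borel_metric Y)" "f \<in> measurable \<mu>' (borel_metric Y)"
    using f by (simp_all add: measurable_P2[OF \<mu>(1)] measurable_P2[OF \<mu>(2)])
  define \<sigma> \<sigma>' where "\<sigma> = distr \<mu> (borel_metric Y) f" and "\<sigma>' = distr \<mu>' (borel_metric Y) f"
  have \<sigma>: "\<sigma> \<in> P2 Y" "\<sigma>' \<in> P2 Y"
    unfolding \<sigma>_def \<sigma>'_def using m m' by (auto intro!: distr_in_P2)
  \<comment> \<open>The budget e is split into five parts: one in A, one in B and three in \<delta>,
    of which the two matchings use less than two.\<close>
  define \<eta> A B \<delta> where "\<eta> = e / 5" and "A = W2 Y \<sigma> \<sigma>' + \<eta>" and "B = \<eta>" and "\<delta> = \<epsilon> + 3 * \<eta>"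
  have pos: "A > 0" "B > 0" "\<delta> > 0" "\<eta> > 0"
    using \<open>e > 0\<close> \<open>\<epsilon> \<ge> 0\<close> W2_nonneg[of Y \<sigma> \<sigma>'] by (auto simp: A_def B_def \<delta>_def \<eta>_def)
  obtain \<pi> where \<pi>: "\<pi> \<in> couplings Y \<sigma> \<sigma>'" "Y.transport_cost \<pi> < ennreal (A\<^sup>2)"
    using Y.W2_less_iff[OF \<sigma> pos(1)] pos by (auto simp: A_def)
  note p = couplingsD[OF \<pi>(1)]
  have [measurable]: "fst \<in> measurable \<pi> (borel_metric Y)" "snd \<in> measurable \<pi> (borel_metric Y)"
    by (simp_all add: p)
  obtain cell :: "'b \<Rightarrow> nat" where cell [measurable]: "cell \<in> measurable (borel_metric Y) (count_space UNIV)"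
    and cd: "\<And>x y. \<lbrakk>x \<in> mspace Y; y \<in> mspace Y; cell x = cell y\<rbrakk> \<Longrightarrow> mdist Y x y < \<eta>"
    using Y.measurable_cells[OF pos(4)] by metis
  have "emeasure \<mu> {x \<in> space \<mu>. cell (f x) = i} = emeasure \<pi> {z \<in> space \<pi>. cell (fst z) = i}" for i
  proof -
    have "emeasure \<mu> {x \<in> space \<mu>. cell (f x) = i} = emeasure \<sigma> {y \<in> space (borel_metric Y). cell y = i}"
      unfolding \<sigma>_def by (rule emeasure_fibre_distr) measurable
    also have "\<dots> = emeasure (distr \<pi> (borel_metric Y) fst) {y \<in> space (borel_metric Y). cell y = i}"
      by (simp only: p)
    also have "\<dots> = emeasure \<pi> {z \<in> space \<pi>. cell (fst z) = i}"
      by (rule emeasure_fibre_distr[symmetric]) measurable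
    finally show ?thesis .
  qed
  then obtain \<gamma> where \<gamma>: "sets \<gamma> = sets (\<mu> \<Otimes>\<^sub>M \<pi>)" "prob_space \<gamma>" "distr \<gamma> \<mu> fst = \<mu>" "distr \<gamma> \<pi> snd = \<pi>"
    "AE z in \<gamma>. cell (f (fst z)) = cell (fst (snd z))"
    using countable_gluing[OF m(2) p(2), of "\<lambda>x. cell (f x)" "\<lambda>x. cell (fst x)"] by auto
  have [measurable]: "fst \<in> measurable \<gamma> \<mu>" "snd \<in> measurable \<gamma> \<pi>"
    by (simp_all add: measurable_cong_sets[OF \<gamma>(1) refl])
  have "emeasure \<gamma> {z \<in> space \<gamma>. cell (snd (snd z)) = i} = emeasure \<mu>' {x \<in> space \<mu>'. cell (f x) = i}" for i
  proof -
    have "emeasure \<gamma> {z \<in> space \<gamma>. cell (snd (snd z)) = i} = emeasure \<pi> {z \<in> space \<pi>. cell (snd z) = i}"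
      using emeasure_fibre_distr[of snd \<gamma> \<pi> "\<lambda>z. cell (snd z)" i] by (simp add: \<gamma>)
    also have "\<dots> = emeasure (distr \<pi> (borel_metric Y) snd) {y \<in> space (borel_metric Y). cell y = i}"
      by (rule emeasure_fibre_distr) measurable
    also have "\<dots> = emeasure \<sigma>' {y \<in> space (borel_metric Y). cell y = i}"
      by (simp only: p)
    also have "\<dots> = emeasure \<mu>' {x \<in> space \<mu>'. cell (f x) = i}"
      unfolding \<sigma>'_def by (rule emeasure_fibre_distr[symmetric]) measurable
    finally show ?thesis .
  qed
  then obtain \<beta> where \<beta>: "sets \<beta> = sets (\<gamma> \<Otimes>\<^sub>M \<mu>')" "prob_space \<beta>" "distr \<beta> \<gamma> fst = \<gamma>" "distr \<beta> \<mu>' snd = \<mu>'"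
    "AE z in \<beta>. cell (snd (snd (fst z))) = cell (f (snd z))"
    using countable_gluing[OF \<gamma>(2) m'(2), of "\<lambda>z. cell (snd (snd z))" "\<lambda>x. cell (f x)"] by auto
  have [measurable]: "fst \<in> measurable \<beta> \<gamma>" "snd \<in> measurable \<beta> \<mu>'"
    by (simp_all add: measurable_cong_sets[OF \<beta>(1) refl])
  have [measurable]: "snd \<in> measurable \<beta> (borel_metric X)"
    using \<open>snd \<in> measurable \<beta> \<mu>'\<close> by (simp add: measurable_cong_sets[OF refl m'(1)])
  have [measurable]: "fst \<in> measurable \<gamma> (borel_metric X)"
    using \<open>fst \<in> measurable \<gamma> \<mu>\<close> by (simp add: measurable_cong_sets[OF refl m(1)])
  have sp: "space \<beta> = (mspace X \<times> (mspace Y \<times> mspace Y)) \<times> mspace X"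
    using sets_eq_imp_space_eq[OF \<gamma>(1)] sets_eq_imp_space_eq[OF \<beta>(1)] by (simp add: space_pair_measure p m m')
  have AE1: "AE z in \<beta>. cell (f (fst (fst z))) = cell (fst (snd (fst z)))"
  proof -
    have "AE z in distr \<beta> \<gamma> fst. cell (f (fst z)) = cell (fst (snd z))"
      unfolding \<beta>(3) by (rule \<gamma>(5))
    then show ?thesis by (rule AE_distrD[rotated]) measurable
  qed
  have "W2 X \<mu> \<mu>' < A + B + \<delta>"
  proof (rule X.W2_lessI[OF \<beta>(2), of "\<lambda>z. fst (fst z)" snd])
    have "distr \<beta> (borel_metric X) (\<lambda>z. fst (fst z)) = distr (distr \<beta> \<gamma> fst) (borel_metric X) fst"
      by (subst distr_distr) (auto simp: comp_def)
    also have "\<dots> = distr \<gamma> \<mu> fst" unfolding \<beta>(3) by (rule distr_cong) (simp_all add: m)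
    finally show "distr \<beta> (borel_metric X) (\<lambda>z. fst (fst z)) = \<mu>" by (simp add: \<gamma>)
    have "distr \<beta> (borel_metric X) snd = distr \<beta> \<mu>' snd" by (rule distr_cong) (simp_all add: m')
    then show "distr \<beta> (borel_metric X) snd = \<mu>'" by (simp add: \<beta>)
    show "(\<integral>\<^sup>+ z. ennreal ((mdist X (fst (fst z)) (snd z))\<^sup>2) \<partial>\<beta>) < ennreal ((A + B + \<delta>)\<^sup>2)"
    proof (rule L2_three_bound[OF \<beta>(2), where v = "\<lambda>_. 0" and u = "\<lambda>z. mdist Y (fst (snd (fst z))) (snd (snd (fst z)))"])
      show "AE z in \<beta>. 0 \<le> mdist X (fst (fst z)) (snd z) \<and>
        mdist X (fst (fst z)) (snd z) \<le> mdist Y (fst (snd (fst z))) (snd (snd (fst z))) + 0 + \<delta>"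
        using AE1 \<beta>(5) AE_space
      proof eventually_elim
        case (elim z)
        define x x' y y' where "x = fst (fst z)" and "x' = snd z" and "y = fst (snd (fst z))" and "y' = snd (snd (fst z))"
        have z: "x \<in> mspace X" "x' \<in> mspace X" "y \<in> mspace Y" "y' \<in> mspace Y"
          using elim(3) by (auto simp: sp x_def x'_def y_def y'_def)
        have fx: "f x \<in> mspace Y" "f x' \<in> mspace Y" using z measurable_space[OF f] by auto
        have "mdist Y (f x) (f x') \<le> mdist Y (f x) y + mdist Y y (f x')"
          by (rule Y.triangle[OF fx(1) z(3) fx(2)])
        moreover have "mdist Y y (f x') \<le> mdist Y y y' + mdist Y y' (f x')"
          by (rule Y.triangle[OF z(3,4) fx(2)])
        moreover have "mdist Y (f x) y < \<eta>" "mdist Y y' (f x') < \<eta>"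
          using cd[OF fx(1) z(3)] cd[OF z(4) fx(2)] elim(1,2) by (simp_all add: x_def x'_def y_def y'_def)
        ultimately have "mdist X x x' \<le> mdist Y y y' + \<delta>"
          using le[OF z(1,2)] pos by (simp add: \<delta>_def)
        then show ?case by (simp add: x_def x'_def y_def y'_def)
      qed
      have "(\<integral>\<^sup>+ z. ennreal ((mdist Y (fst (snd (fst z))) (snd (snd (fst z))))\<^sup>2) \<partial>\<beta>)
         = (\<integral>\<^sup>+ z. ennreal ((mdist Y (fst (snd z)) (snd (snd z)))\<^sup>2) \<partial>distr \<beta> \<gamma> fst)"
        by (subst nn_integral_distr) auto
      also have "\<dots> = Y.transport_cost (distr \<gamma> \<pi> snd)"
        unfolding \<beta>(3) by (subst nn_integral_distr) auto
      finally show "(\<integral>\<^sup>+ z. ennreal ((mdist Y (fst (snd (fst z))) (snd (snd (fst z))))\<^sup>2) \<partial>\<beta>) < ennreal (A\<^sup>2)"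
        using \<pi>(2) by (simp add: \<gamma>)
    qed (use pos in simp_all)
  qed (use pos in simp_all)
  then show "W2 X \<mu> \<mu>' \<le> W2 Y (distr \<mu> (borel_metric Y) f) (distr \<mu>' (borel_metric Y) f) + \<epsilon> + e"
    by (simp add: A_def B_def \<delta>_def \<eta>_def \<sigma>_def \<sigma>'_def)
qed

lemma W2_GH_approximation:
  assumes X: "compact_metric X" and Y: "compact_metric Y" and f: "GH_approximation \<epsilon> X Y f"
    and \<mu>: "\<mu> \<in> P2 X" "\<mu>' \<in> P2 X"
  shows "\<bar>W2 Y (distr \<mu> (borel_metric Y) f) (distr \<mu>' (borel_metric Y) f) - W2 X \<mu> \<mu>'\<bar> \<le> \<epsilon>"
proof -
  have f': "f \<in> measurable (borel_metric X) (borel_metric Y)"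
    and d: "\<And>x x'. \<lbrakk>x \<in> mspace X; x' \<in> mspace X\<rbrakk> \<Longrightarrow> \<bar>mdist Y (f x) (f x') - mdist X x x'\<bar> \<le> \<epsilon>"
    using f by (auto simp: GH_approximation_def)
  obtain x where "x \<in> mspace X"
    using prob_space.not_empty[OF P2_D(2)[OF \<mu>(1)]] P2_D(3)[OF \<mu>(1)] by auto
  from d[OF this this] have "\<epsilon> \<ge> 0" by linarith
  have "W2 Y (distr \<mu> (borel_metric Y) f) (distr \<mu>' (borel_metric Y) f) \<le> W2 X \<mu> \<mu>' + \<epsilon>"
  proof (rule W2_distr_le[OF X Y f' _ \<open>\<epsilon> \<ge> 0\<close> \<mu>])
    show "mdist Y (f x) (f x') \<le> mdist X x x' + \<epsilon>" if "x \<in> mspace X" "x' \<in> mspace X" for x x'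
      using d[OF that] by linarith
  qed
  moreover have "W2 X \<mu> \<mu>' \<le> W2 Y (distr \<mu> (borel_metric Y) f) (distr \<mu>' (borel_metric Y) f) + \<epsilon>"
  proof (rule W2_le_distr[OF X Y f' _ \<open>\<epsilon> \<ge> 0\<close> \<mu>])
    show "mdist X x x' \<le> mdist Y (f x) (f x') + \<epsilon>" if "x \<in> mspace X" "x' \<in> mspace X" for x x'
      using d[OF that] by linarith
  qed
  ultimately show ?thesis by linarith
qed

section \<open>Stability and completeness of W2, and limits of approximate geodesics\<close>

context compact_metric
begin

lemma W2_diff_le:
  assumes "\<mu> \<in> P2 X" "\<nu> \<in> P2 X" "\<mu>' \<in> P2 X" "\<nu>' \<in> P2 X"
  shows "\<bar>W2 X \<mu> \<nu> - W2 X \<mu>' \<nu>'\<bar> \<le> W2 X \<mu> \<mu>' + W2 X \<nu> \<nu>'"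
proof -
  have "W2 X \<mu> \<nu> \<le> W2 X \<mu> \<mu>' + W2 X \<mu>' \<nu>" "W2 X \<mu>' \<nu> \<le> W2 X \<mu>' \<nu>' + W2 X \<nu>' \<nu>"
    "W2 X \<mu>' \<nu>' \<le> W2 X \<mu>' \<mu> + W2 X \<mu> \<nu>'" "W2 X \<mu> \<nu>' \<le> W2 X \<mu> \<nu> + W2 X \<nu> \<nu>'"
    using assms by (simp_all add: W2_triangle)
  then show ?thesis using W2_commute[of \<mu> \<mu>'] W2_commute[of \<nu> \<nu>'] assms by simp
qed

lemma W2_tendsto:
  assumes "\<And>n. a n \<in> P2 X" "\<And>n. b n \<in> P2 X" "a' \<in> P2 X" "b' \<in> P2 X"
    and "((\<lambda>n. W2 X (a n) a') \<longlongrightarrow> 0) F" "((\<lambda>n. W2 X (b n) b') \<longlongrightarrow> 0) F"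
  shows "((\<lambda>n. W2 X (a n) (b n)) \<longlongrightarrow> W2 X a' b') F"
proof (rule tendsto_of_abs_le)
  show "\<bar>W2 X (a n) (b n) - W2 X a' b'\<bar> \<le> W2 X (a n) a' + W2 X (b n) b'" for n
    using assms by (intro W2_diff_le)
  show "((\<lambda>n. W2 X (a n) a' + W2 X (b n) b') \<longlongrightarrow> 0) F"
    using tendsto_add[OF assms(5,6)] by simp
qed

lemma W2_Cauchy_convergent:
  assumes \<mu>: "\<And>n. \<mu> n \<in> P2 X"
    and cauchy: "\<And>e. e > 0 \<Longrightarrow> \<exists>N. \<forall>m\<ge>N. \<forall>n\<ge>N. W2 X (\<mu> m) (\<mu> n) < e"
  obtains L where "L \<in> P2 X" "(\<lambda>n. W2 X (\<mu> n) L) \<longlonglongrightarrow> 0"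
proof -
  obtain r L where r: "strict_mono (r :: nat \<Rightarrow> nat)" "L \<in> P2 X" "(\<lambda>n. W2 X (\<mu> (r n)) L) \<longlonglongrightarrow> 0"
    by (rule W2_compact[of \<mu>, OF \<mu>]) (rule that)
  have "(\<lambda>n. W2 X (\<mu> n) L) \<longlonglongrightarrow> 0"
  proof (rule tendstoI)
    fix e :: real assume e: "e > 0"
    obtain N where N: "\<And>m n. m \<ge> N \<Longrightarrow> n \<ge> N \<Longrightarrow> W2 X (\<mu> m) (\<mu> n) < e / 2"
      using cauchy[of "e / 2"] e by auto
    have "\<forall>\<^sub>F n in sequentially. W2 X (\<mu> (r n)) L < e / 2"
      using e by (intro order_tendstoD(2)[OF r(3)]) auto
    then have "\<forall>\<^sub>F k in sequentially. W2 X (\<mu> (r k)) L < e / 2 \<and> N \<le> k"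
      using eventually_ge_at_top by (rule eventually_conj)
    then obtain k where k: "W2 X (\<mu> (r k)) L < e / 2" "N \<le> k"
      using eventually_happens'[OF sequentially_bot] by blast
    have "W2 X (\<mu> n) L < e" if "n \<ge> N" for n
    proof -
      have "W2 X (\<mu> n) (\<mu> (r k)) < e / 2"
        using N[OF that] k(2) seq_suble[OF r(1), of k] by force
      then show ?thesis using W2_triangle[OF \<mu> \<mu> r(2), of n "r k"] k(1) by simp
    qed
    then show "\<forall>\<^sub>F n in sequentially. dist (W2 X (\<mu> n) L) 0 < e"
      unfolding eventually_sequentially by (auto simp: dist_real_def abs_of_nonneg[OF W2_nonneg])
  qed
  with r(2) show thesis by (rule that)
qed

text \<open>An Arzela-Ascoli argument for curves that need not be continuous: they are Lipschitz
  only up to the vanishing error \<epsilon> n. A diagonal subsequence converges at all rational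
  times. At another time t the curves are compared with a rational time u slightly larger than t;
  the discrepancy |t - u| D + \<epsilon> is small for large n, so the sequence at t is
  Cauchy.\<close>

lemma wasserstein_geodesic_limit:
  assumes \<sigma>: "\<And>n t. t \<in> {0..1} \<Longrightarrow> \<sigma> n t \<in> P2 X"
    and approx: "\<And>n s t. \<lbrakk>s \<in> {0..1}; t \<in> {0..1}\<rbrakk> \<Longrightarrow> \<bar>W2 X (\<sigma> n s) (\<sigma> n t) - \<bar>s - t\<bar> * D n\<bar> \<le> \<epsilon> n"
    and \<epsilon>: "\<epsilon> \<longlonglongrightarrow> 0"
    and \<mu>: "\<mu>0 \<in> P2 X" "\<mu>1 \<in> P2 X"
    and lim0: "(\<lambda>n. W2 X (\<sigma> n 0) \<mu>0) \<longlonglongrightarrow> 0" and lim1: "(\<lambda>n. W2 X (\<sigma> n 1) \<mu>1) \<longlonglongrightarrow> 0"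
  obtains r \<mu> where "strict_mono (r :: nat \<Rightarrow> nat)" "wasserstein_geodesic X \<mu>0 \<mu>1 \<mu>"
    "\<And>t. t \<in> {0..1} \<Longrightarrow> (\<lambda>n. W2 X (\<sigma> (r n) t) (\<mu> t)) \<longlonglongrightarrow> 0" "D \<longlonglongrightarrow> W2 X \<mu>0 \<mu>1"
proof -
  have D: "D \<longlonglongrightarrow> W2 X \<mu>0 \<mu>1"
  proof -
    have "(\<lambda>n. W2 X (\<sigma> n 0) (\<sigma> n 1)) \<longlonglongrightarrow> W2 X \<mu>0 \<mu>1"
      using \<sigma> \<mu> lim0 lim1 by (intro W2_tendsto) auto
    moreover have "(\<lambda>n. W2 X (\<sigma> n 0) (\<sigma> n 1) - D n) \<longlonglongrightarrow> 0"
      by (rule tendsto_of_abs_le[OF _ \<epsilon>]) (use approx[of 0 1] in auto)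
    ultimately show ?thesis using tendsto_diff by fastforce
  qed
  then have "Bseq D" using convergent_imp_Bseq[of D] unfolding convergent_def by blast
  then obtain B where B: "B > 0" "\<And>n. \<bar>D n\<bar> \<le> B"
    by (auto simp: Bseq_def)
  define q where "q = from_nat_into (\<rat> \<inter> {0..1 :: real})"
  have q_range: "range q = \<rat> \<inter> {0..1}"
    unfolding q_def by (rule range_from_nat_into) (auto intro!: countable_Int1 countable_rat exI[of _ 0])
  then have q01: "q n \<in> {0..1}" for n by blast
  \<comment> \<open>Convergence at the n-th rational time. It is inherited by subsequences, which is
    what the diagonal construction asks for.\<close>
  define P where "P n s \<longleftrightarrow> (\<exists>L\<in>P2 X. (\<lambda>k. W2 X (\<sigma> (s k) (q n)) L) \<longlonglongrightarrow> 0)" for n and s :: "nat \<Rightarrow> nat"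
  interpret subseqs P
  proof
    fix n and s :: "nat \<Rightarrow> nat"
    show "\<exists>r'. strict_mono r' \<and> P n (s \<circ> r')"
    proof (rule W2_compact[of "\<lambda>k. \<sigma> (s k) (q n)"])
      show "\<sigma> (s k) (q n) \<in> P2 X" for k by (rule \<sigma>[OF q01])
      fix p L assume "strict_mono (p :: nat \<Rightarrow> nat)" "L \<in> P2 X" "(\<lambda>k. W2 X (\<sigma> (s (p k)) (q n)) L) \<longlonglongrightarrow> 0"
      then show ?thesis by (auto simp: P_def comp_def)
    qed
  qed
  define r where "r = diagseq"
  have r: "strict_mono r" unfolding r_def by (rule subseq_diagseq)
  have rat: "\<exists>L\<in>P2 X. (\<lambda>k. W2 X (\<sigma> (r k) (q n)) L) \<longlonglongrightarrow> 0" for n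
  proof -
    have "P n (diagseq \<circ> (+) (Suc n))"
    proof (rule diagseq_holds)
      fix p s n assume "strict_mono (p :: nat \<Rightarrow> nat)" "P n s"
      then obtain L where "L \<in> P2 X" "(\<lambda>k. W2 X (\<sigma> (s k) (q n)) L) \<longlonglongrightarrow> 0" by (auto simp: P_def)
      with LIMSEQ_subseq_LIMSEQ[OF this(2) \<open>strict_mono p\<close>] show "P n (s \<circ> p)"
        by (auto simp: P_def comp_def)
    qed
    then obtain L where "L \<in> P2 X" "(\<lambda>k. W2 X (\<sigma> (r (k + Suc n)) (q n)) L) \<longlonglongrightarrow> 0"
      by (auto simp: P_def r_def add.commute)
    then show ?thesis using LIMSEQ_offset[of "\<lambda>k. W2 X (\<sigma> (r k) (q n)) L" "Suc n"] by blast
  qed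
  have ex: "\<exists>L. L \<in> P2 X \<and> (\<lambda>n. W2 X (\<sigma> (r n) t) L) \<longlonglongrightarrow> 0 \<and> (t = 0 \<longrightarrow> L = \<mu>0) \<and> (t = 1 \<longrightarrow> L = \<mu>1)"
    if t: "t \<in> {0..1}" for t
  proof -
    consider "t = 0" | "t = 1" | "0 < t" "t < 1" using t by fastforce
    then show ?thesis
    proof cases
      case 1
      then show ?thesis using \<mu> LIMSEQ_subseq_LIMSEQ[OF lim0 r] by (auto simp: comp_def)
    next
      case 2
      then show ?thesis using \<mu> LIMSEQ_subseq_LIMSEQ[OF lim1 r] by (auto simp: comp_def)
    next
      case 3
      obtain L where "L \<in> P2 X" "(\<lambda>n. W2 X (\<sigma> (r n) t) L) \<longlonglongrightarrow> 0"
      proof (rule W2_Cauchy_convergent[of "\<lambda>n. \<sigma> (r n) t"])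
        show "\<sigma> (r n) t \<in> P2 X" for n using \<sigma> t by blast
        fix e :: real assume e: "e > 0"
        \<comment> \<open>This u makes |t - u| D at most e/8 for every index, because B bounds all D
          n; the minimum with 1 keeps u a legitimate time.\<close>
        have "t < min 1 (t + e / (8 * B))" using 3 e B by simp
        then obtain u where u: "u \<in> \<rat>" "t < u" "u < min 1 (t + e / (8 * B))"
          using Rats_dense_in_real by blast
        have "u \<in> \<rat> \<inter> {0..1}" using u 3 by auto
        then obtain j where j: "u = q j" unfolding q_range[symmetric] by blast
        obtain L where L: "L \<in> P2 X" "(\<lambda>k. W2 X (\<sigma> (r k) u) L) \<longlonglongrightarrow> 0"
          using rat[of j] j by auto
        have u01: "u \<in> {0..1}" using u 3 by auto
        have "\<forall>\<^sub>F n in sequentially. W2 X (\<sigma> (r n) u) L < e / 4"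
          using e by (intro order_tendstoD(2)[OF L(2)]) auto
        moreover have "\<forall>\<^sub>F n in sequentially. \<epsilon> (r n) < e / 8"
          using LIMSEQ_subseq_LIMSEQ[OF \<epsilon> r] e by (intro order_tendstoD(2)[where y = 0]) (auto simp: comp_def)
        ultimately have "\<forall>\<^sub>F n in sequentially. W2 X (\<sigma> (r n) t) L < e / 2"
        proof eventually_elim
          case (elim n)
          have "\<bar>t - u\<bar> * D (r n) \<le> \<bar>t - u\<bar> * B"
            using B(2)[of "r n"] by (intro mult_left_mono) auto
          also have "\<dots> \<le> e / (8 * B) * B"
            using u B(1) by (intro mult_right_mono) auto
          also have "\<dots> = e / 8" using B(1) by simp
          finally have "W2 X (\<sigma> (r n) t) (\<sigma> (r n) u) < e / 8 + e / 8"
            using approx[OF t u01, of "r n"] elim(2) by linarith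
          then show ?case
            using W2_triangle[OF \<sigma>[OF t] \<sigma>[OF u01] L(1), of "r n" "r n"] elim(1) by simp
        qed
        then obtain N where N: "\<And>n. n \<ge> N \<Longrightarrow> W2 X (\<sigma> (r n) t) L < e / 2"
          by (auto simp: eventually_sequentially)
        show "\<exists>N. \<forall>m\<ge>N. \<forall>n\<ge>N. W2 X (\<sigma> (r m) t) (\<sigma> (r n) t) < e"
        proof (intro exI[of _ N] allI impI)
          fix m n assume "N \<le> m" "N \<le> n"
          then show "W2 X (\<sigma> (r m) t) (\<sigma> (r n) t) < e"
            using N[of m] N[of n] W2_triangle[OF \<sigma>[OF t] L(1) \<sigma>[OF t], of "r m" "r n"]
              W2_commute[OF \<sigma>[OF t] L(1), of "r n"] by linarith
        qed
      qed
      then show ?thesis using 3 by auto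
    qed
  qed
  \<comment> \<open>The two clauses about the end points are part of the choice, so the limit curve
    has the prescribed end points without appeal to uniqueness of limits.\<close>
  define \<mu> where "\<mu> t = (SOME L. L \<in> P2 X \<and> (\<lambda>n. W2 X (\<sigma> (r n) t) L) \<longlonglongrightarrow> 0 \<and> (t = 0 \<longrightarrow> L = \<mu>0) \<and> (t = 1 \<longrightarrow> L = \<mu>1))" for t
  have \<mu>t: "\<mu> t \<in> P2 X" "(\<lambda>n. W2 X (\<sigma> (r n) t) (\<mu> t)) \<longlonglongrightarrow> 0" "t = 0 \<longrightarrow> \<mu> t = \<mu>0" "t = 1 \<longrightarrow> \<mu> t = \<mu>1"
    if "t \<in> {0..1}" for t
    using someI_ex[OF ex[OF that]] unfolding \<mu>_def[symmetric] by auto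
  have "wasserstein_geodesic X \<mu>0 \<mu>1 \<mu>"
    unfolding wasserstein_geodesic_def
  proof (intro conjI ballI)
    show "\<mu> 0 = \<mu>0" "\<mu> 1 = \<mu>1" using \<mu>t[of 0] \<mu>t[of 1] by auto
    fix s t :: real assume st: "s \<in> {0..1}" "t \<in> {0..1}"
    have "(\<lambda>n. W2 X (\<sigma> (r n) t) (\<sigma> (r n) s)) \<longlonglongrightarrow> W2 X (\<mu> t) (\<mu> s)"
      using st \<sigma> \<mu>t by (intro W2_tendsto) auto
    moreover have "(\<lambda>n. W2 X (\<sigma> (r n) t) (\<sigma> (r n) s) - \<bar>t - s\<bar> * D (r n)) \<longlonglongrightarrow> 0"
      by (rule tendsto_of_abs_le[of _ _ "\<lambda>n. \<epsilon> (r n)"])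
         (use approx st LIMSEQ_subseq_LIMSEQ[OF \<epsilon> r] in \<open>auto simp: comp_def\<close>)
    moreover have "(\<lambda>n. \<bar>t - s\<bar> * D (r n)) \<longlonglongrightarrow> \<bar>t - s\<bar> * W2 X \<mu>0 \<mu>1"
      using LIMSEQ_subseq_LIMSEQ[OF D r] by (intro tendsto_mult tendsto_const) (simp add: comp_def)
    ultimately have "(\<lambda>n. W2 X (\<sigma> (r n) t) (\<sigma> (r n) s)) \<longlonglongrightarrow> 0 + \<bar>t - s\<bar> * W2 X \<mu>0 \<mu>1"
      using tendsto_add by fastforce
    then show "W2 X (\<mu> t) (\<mu> s) = \<bar>t - s\<bar> * W2 X \<mu>0 \<mu>1"
      using \<open>(\<lambda>n. W2 X (\<sigma> (r n) t) (\<sigma> (r n) s)) \<longlonglongrightarrow> W2 X (\<mu> t) (\<mu> s)\<close> LIMSEQ_unique by fastforce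
  qed (use \<mu>t in auto)
  with r \<mu>t(2) D show thesis by (intro that)
qed

end


section \<open>Affine minorants and Lebesgue decomposition\<close>

text \<open>The pairs (a, b) with b at most minus the Legendre conjugate of U at a, the conjugate
  being taken over [0,\<infinity>).\<close>

definition minorants :: "(real \<Rightarrow> real) \<Rightarrow> (real \<times> real) set" where
  "minorants U = {(a, b). \<forall>r\<ge>0. a * r + b \<le> U r}"

lemma minorantsD: "(a, b) \<in> minorants U \<Longrightarrow> r \<ge> 0 \<Longrightarrow> a * r + b \<le> U r"
  by (auto simp: minorants_def)

lemma minorants_convex:
  assumes "(a, b) \<in> minorants U" "(a', b') \<in> minorants U" "0 \<le> c" "c \<le> 1"
  shows "(c * a + (1 - c) * a', c * b + (1 - c) * b') \<in> minorants U"
  unfolding minorants_def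
proof (clarify)
  fix r :: real assume "r \<ge> 0"
  have "(c * a + (1 - c) * a') * r + (c * b + (1 - c) * b') = c * (a * r + b) + (1 - c) * (a' * r + b')"
    by (simp add: algebra_simps)
  also have "\<dots> \<le> c * U r + (1 - c) * U r"
    using assms \<open>r \<ge> 0\<close> by (intro add_mono mult_left_mono minorantsD) auto
  finally show "(c * a + (1 - c) * a') * r + (c * b + (1 - c) * b') \<le> U r"
    by (simp add: algebra_simps)
qed

lemma minorants_sum:
  assumes "finite I" "\<And>i. i \<in> I \<Longrightarrow> (a i, b i) \<in> minorants U" "\<And>i. i \<in> I \<Longrightarrow> 0 \<le> c i" "(\<Sum>i\<in>I. c i) = 1"
  shows "(\<Sum>i\<in>I. c i * a i, \<Sum>i\<in>I. c i * b i) \<in> minorants U"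
  unfolding minorants_def
proof (clarify)
  fix r :: real assume "r \<ge> 0"
  have "(\<Sum>i\<in>I. c i * a i) * r + (\<Sum>i\<in>I. c i * b i) = (\<Sum>i\<in>I. c i * (a i * r + b i))"
    by (simp add: sum_distrib_left sum_distrib_right sum.distrib algebra_simps)
  also have "\<dots> \<le> (\<Sum>i\<in>I. c i * U r)"
    using assms \<open>r \<ge> 0\<close> by (intro sum_mono mult_left_mono minorantsD) auto
  also have "\<dots> = U r" using assms(4) by (simp add: sum_distrib_right[symmetric])
  finally show "(\<Sum>i\<in>I. c i * a i) * r + (\<Sum>i\<in>I. c i * b i) \<le> U r" .
qed

section \<open>Supporting lines of U and the slope at infinity\<close>

locale convex_nonlinearity =
  fixes U :: "real \<Rightarrow> real"
  assumes U: "U \<in> convex_nonlinearities"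
begin

lemma U_cont: "continuous_on {0..} U" and U_convex: "convex_on {0..} U" and U_0: "U 0 = 0"
  using U by (auto simp: convex_nonlinearities_def)

lemma minorant_nonpos: "(a, b) \<in> minorants U \<Longrightarrow> b \<le> 0"
  using minorantsD[of a b U 0] U_0 by simp

lemma tangent:
  assumes "r > 0"
  obtains a where "(a, U r - a * r) \<in> minorants U"
proof -
  \<comment> \<open>The infimum of the chord slopes to the right of \<open>r\<close>, that is the
    right derivative of U there; it is finite because \<open>r\<close> is an interior point of the
    half-line.\<close>
  define a where "a = Inf ((\<lambda>t. (U r - U t) / (r - t)) ` ({r<..} \<inter> {0..}))"
  have "a * t + (U r - a * r) \<le> U t" if "t \<ge> 0" for t
    using convex_le_Inf_differential[OF U_convex, of r t] assms that
    by (simp add: a_def algebra_simps)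
  then show thesis by (intro that[of a]) (simp add: minorants_def)
qed

text \<open>At \<open>0\<close> the graph of \<open>U\<close> may have a vertical tangent, so the bound is only approximate there.\<close>

lemma minorant_approx:
  assumes "r \<ge> 0" "e > 0"
  obtains a b where "(a, b) \<in> minorants U" "U r - e < a * r + b"
proof (cases "r = 0")
  case False
  with assms have "r > 0" by simp
  then obtain a where "(a, U r - a * r) \<in> minorants U" using tangent by blast
  then show thesis using assms by (intro that[of a "U r - a * r"]) auto
next
  case True
  have "\<exists>d>0. \<forall>t\<in>{0..}. dist t 0 < d \<longrightarrow> dist (U t) (U 0) < e / 4"
    using U_cont[unfolded continuous_on_iff, rule_format, of 0 "e / 4"] assms by simp
  then obtain d where d: "d > 0" "\<And>t. t \<ge> 0 \<Longrightarrow> t < d \<Longrightarrow> \<bar>U t\<bar> < e / 4"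
    using U_0 by (auto simp: dist_real_def)
  define s where "s = d / 3"
  have s: "s > 0" "\<bar>U s\<bar> < e / 4" "\<bar>U (2 * s)\<bar> < e / 4" using d by (auto simp: s_def)
  obtain a where a: "(a, U s - a * s) \<in> minorants U" using tangent[OF s(1)] by blast
  \<comment> \<open>Testing the tangent at s against the point 2s gives a s \<le> U(2s) - U(s). Its
    value at 0 is therefore at least 2 U(s) - U(2s), which exceeds -3e/4.\<close>
  have "a * (2 * s) + (U s - a * s) \<le> U (2 * s)" using s(1) by (intro minorantsD[OF a]) simp
  then have "U s - a * s > - e" using s by linarith
  then show thesis using True U_0 by (intro that[OF a]) simp
qed

text \<open>Lowering slope and intercept to nearby rationals keeps a line below U, since only
  arguments r \<ge> 0 count. Countability allows the best of the first n minorants to be selected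
  measurably.\<close>

lemma countable_minorants:
  obtains A B :: "nat \<Rightarrow> real" where "\<And>n. (A n, B n) \<in> minorants U"
    and "\<And>r e. r \<ge> 0 \<Longrightarrow> e > 0 \<Longrightarrow> \<exists>n. U r - e < A n * r + B n"
proof -
  define Q where "Q = {p \<in> \<rat> \<times> \<rat>. p \<in> minorants U}"
  have cQ: "countable Q"
    unfolding Q_def by (rule countable_subset[OF _ countable_SIGMA[OF countable_rat countable_rat]]) auto
  have approx: "\<exists>p\<in>Q. U r - e < fst p * r + snd p" if re: "r \<ge> 0" "e > 0" for r e
  proof -
    obtain a b where ab: "(a, b) \<in> minorants U" "U r - e / 2 < a * r + b"
      using minorant_approx[OF re(1), of "e / 2"] re by auto
    obtain a' where a': "a' \<in> \<rat>" "a - e / (4 * (r + 1)) < a'" "a' < a"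
      using Rats_dense_in_real[of "a - e / (4 * (r + 1))" a] re by auto
    obtain b' where b': "b' \<in> \<rat>" "b - e / 4 < b'" "b' < b"
      using Rats_dense_in_real[of "b - e / 4" b] re by auto
    have "a' * t + b' \<le> U t" if "t \<ge> 0" for t
    proof -
      have "a' * t \<le> a * t" using a' that by (intro mult_right_mono) auto
      then show ?thesis using minorantsD[OF ab(1) that] b' by linarith
    qed
    then have "(a', b') \<in> Q" using a' b' by (simp add: Q_def minorants_def)
    moreover have "U r - e < a' * r + b'"
    proof -
      have "(a - a') * r \<le> e / (4 * (r + 1)) * r" using a' re by (intro mult_right_mono) auto
      also have "\<dots> \<le> e / 4" using re by (simp add: field_simps)
      finally show ?thesis using ab(2) b'(2) by (simp add: algebra_simps)
    qed
    ultimately show ?thesis by force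
  qed
  have "Q \<noteq> {}" using approx[of 0 1] by auto
  then have rg: "range (from_nat_into Q) = Q" using cQ by (rule range_from_nat_into)
  show thesis
  proof (rule that[of "\<lambda>n. fst (from_nat_into Q n)" "\<lambda>n. snd (from_nat_into Q n)"])
    show "(fst (from_nat_into Q n), snd (from_nat_into Q n)) \<in> minorants U" for n
      using rg by (auto simp: Q_def)
    show "\<exists>n. U r - e < fst (from_nat_into Q n) * r + snd (from_nat_into Q n)" if re: "r \<ge> 0" "e > 0" for r e
    proof -
      obtain p where p: "p \<in> Q" "U r - e < fst p * r + snd p" using approx[OF re] by blast
      then obtain n where "p = from_nat_into Q n" using rg by (metis imageE)
      with p(2) show ?thesis by blast
    qed
  qed
qed

text \<open>A minorant gives U(r)/r \<ge> A n + B n / r, hence the lower bound in the limit.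
  Conversely all intercepts are nonpositive because U(0) = 0, so U(r) cannot exceed r times the
  supremum of the slopes. This also shows that the limit exists.\<close>

lemma U_prime_inf_eq_SUP:
  assumes AB: "\<And>n. (A n, B n) \<in> minorants U"
    and approx: "\<And>r e. r \<ge> 0 \<Longrightarrow> e > 0 \<Longrightarrow> \<exists>n. U r - e < A n * r + B n"
  shows "U_prime_inf U = (SUP n :: nat. ereal (A n))"
proof -
  have "((\<lambda>r. ereal (U r / r)) \<longlongrightarrow> (SUP n. ereal (A n))) at_top"
  proof (rule order_tendstoI)
    fix c assume "c < (SUP n. ereal (A n))"
    then obtain n where n: "c < ereal (A n)" by (auto simp: less_SUP_iff)
    have "((\<lambda>r. ereal (A n + B n * inverse r)) \<longlongrightarrow> ereal (A n + B n * 0)) at_top"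
      by (intro tendsto_intros tendsto_inverse_0_at_top filterlim_ident)
    then have "\<forall>\<^sub>F r in at_top. c < ereal (A n + B n * inverse r)"
      using n by (intro order_tendstoD(1)) auto
    then show "\<forall>\<^sub>F r in at_top. c < ereal (U r / r)"
      using eventually_gt_at_top[of 0]
    proof eventually_elim
      case (elim r)
      have "A n + B n * inverse r = (A n * r + B n) / r" using elim by (simp add: field_simps)
      also have "\<dots> \<le> U r / r"
        using minorantsD[OF AB, of r n] elim by (intro divide_right_mono) auto
      finally have "A n + B n * inverse r \<le> U r / r" .
      with elim(1) show ?case by (meson ereal_less_eq(3) less_le_trans)
    qed
  next
    fix c assume c: "(SUP n. ereal (A n)) < c"
    have "ereal (U r / r) \<le> (SUP n. ereal (A n))" if r: "r > 0" for r
    proof (cases "(SUP n. ereal (A n))")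
      case (real s)
      have "A n \<le> s" for n using SUP_upper[of n UNIV "\<lambda>n. ereal (A n)"] real by simp
      have "U r \<le> s * r"
      proof (rule field_le_epsilon)
        fix e :: real assume "e > 0"
        then obtain n where "U r - e < A n * r + B n" using approx[of r e] r by auto
        moreover have "A n * r \<le> s * r" using \<open>A n \<le> s\<close> r by (intro mult_right_mono) auto
        ultimately show "U r \<le> s * r + e" using minorant_nonpos[OF AB[of n]] by linarith
      qed
      then show ?thesis using real r by (simp add: field_simps)
    next
      case MInf
      then show ?thesis using SUP_upper[of 0 UNIV "\<lambda>n. ereal (A n)"] by simp
    qed simp
    then show "\<forall>\<^sub>F r in at_top. ereal (U r / r) < c"
      using c by (intro eventually_mono[OF eventually_gt_at_top[of 0]]) (rule le_less_trans)
  qed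
  then show ?thesis unfolding U_prime_inf_def by (intro tendsto_Lim) auto
qed

text \<open>Prepended to a countable family that approximates U, the given minorant becomes one of
  the competitors in the supremum of slopes.\<close>

lemma minorant_le_U_prime_inf:
  assumes "(a, b) \<in> minorants U"
  shows "ereal a \<le> U_prime_inf U"
proof -
  obtain A B :: "nat \<Rightarrow> real" where AB: "\<And>n. (A n, B n) \<in> minorants U"
    and approx: "\<And>r e. r \<ge> 0 \<Longrightarrow> e > 0 \<Longrightarrow> \<exists>n. U r - e < A n * r + B n"
    using countable_minorants by blast
  define A' B' where "A' = (\<lambda>n. case n of 0 \<Rightarrow> a | Suc n \<Rightarrow> A n)" and "B' = (\<lambda>n. case n of 0 \<Rightarrow> b | Suc n \<Rightarrow> B n)"
  have "U_prime_inf U = (SUP n :: nat. ereal (A' n))"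
  proof (rule U_prime_inf_eq_SUP)
    show "(A' n, B' n) \<in> minorants U" for n using assms AB by (auto simp: A'_def B'_def split: nat.split)
    show "\<exists>n. U r - e < A' n * r + B' n" if re: "r \<ge> 0" "e > 0" for r e
    proof -
      obtain n where "U r - e < A n * r + B n" using approx[OF re] by blast
      then show ?thesis by (intro exI[of _ "Suc n"]) (simp add: A'_def B'_def)
    qed
  qed
  then show ?thesis using SUP_upper[of 0 UNIV "\<lambda>n. ereal (A' n)"] by (simp add: A'_def)
qed

lemma measurable_comp:
  assumes "\<rho> \<in> borel_measurable M" "\<And>x. x \<in> space M \<Longrightarrow> 0 \<le> \<rho> x"
  shows "(\<lambda>x. U (\<rho> x)) \<in> borel_measurable M"
proof -
  \<comment> \<open>U is continuous only on the half-line; composing with \<open>max 0\<close> gives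
    a continuous function on the whole line with the same values at nonnegative arguments.\<close>
  have "continuous_on UNIV (\<lambda>r. U (max 0 r))"
    by (rule continuous_on_compose2[OF U_cont]) (auto intro!: continuous_intros)
  then have "(\<lambda>r. U (max 0 r)) \<in> borel_measurable borel" by (rule borel_measurable_continuous_onI)
  then have "(\<lambda>x. U (max 0 (\<rho> x))) \<in> borel_measurable M" using assms(1) by measurable
  then show ?thesis by (rule measurable_cong[THEN iffD1, rotated]) (simp add: assms(2) max_def)
qed

end

section \<open>Extended integrals, sums of measures and the Lebesgue decomposition\<close>

lemma ext_integral_integrable:
  assumes "integrable M f"
  shows "ext_integral M f = ereal (integral\<^sup>L M f)"
proof -
  have fin: "(\<integral>\<^sup>+ x. ennreal (f x) \<partial>M) \<noteq> \<infinity>" "(\<integral>\<^sup>+ x. ennreal (- f x) \<partial>M) \<noteq> \<infinity>"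
    using assms by (auto simp: real_integrable_def)
  obtain p where p: "(\<integral>\<^sup>+ x. ennreal (f x) \<partial>M) = ennreal p" "p \<ge> 0"
    using fin(1) by (cases "\<integral>\<^sup>+ x. ennreal (f x) \<partial>M") auto
  obtain q where q: "(\<integral>\<^sup>+ x. ennreal (- f x) \<partial>M) = ennreal q" "q \<ge> 0"
    using fin(2) by (cases "\<integral>\<^sup>+ x. ennreal (- f x) \<partial>M") auto
  show ?thesis
    unfolding ext_integral_def real_lebesgue_integral_def[OF assms] p(1) q(1)
    using p(2) q(2) by (simp add: enn2ereal_ennreal)
qed

text \<open>Once an integrable minorant g is split off, only a nonnegative integral remains, to
  which Fatou's lemma applies. This is how U(\<rho>), whose integral may be infinite, is treated
  later.\<close>

lemma ext_integral_add:
  assumes g: "integrable M g" and h [measurable]: "h \<in> borel_measurable M" and h0: "\<And>x. x \<in> space M \<Longrightarrow> 0 \<le> h x"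
  shows "ext_integral M (\<lambda>x. g x + h x) = ereal (integral\<^sup>L M g) + enn2ereal (\<integral>\<^sup>+ x. ennreal (h x) \<partial>M)"
proof (cases "(\<integral>\<^sup>+ x. ennreal (h x) \<partial>M) = \<infinity>")
  case False
  have hi: "integrable M h"
    by (rule integrableI_nonneg) (use False h0 in \<open>auto simp: less_top\<close>)
  have "(\<integral>\<^sup>+ x. ennreal (h x) \<partial>M) = ennreal (integral\<^sup>L M h)"
    by (rule nn_integral_eq_integral[OF hi]) (use h0 in auto)
  moreover have "0 \<le> integral\<^sup>L M h" using h0 by (intro integral_nonneg_AE AE_I2)
  moreover have "ext_integral M (\<lambda>x. g x + h x) = ereal (integral\<^sup>L M g + integral\<^sup>L M h)"
    using ext_integral_integrable[OF Bochner_Integration.integrable_add[OF g hi]] g hi by simp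
  ultimately show ?thesis by (simp add: enn2ereal_ennreal)
next
  \<comment> \<open>Here h is bounded by the positive part of g + h plus the negative part of g, so
    the former has infinite integral, while the negative part of g + h is bounded by that of g. The
    difference is therefore a genuine \<infinity>.\<close>
  case True
  have [measurable]: "g \<in> borel_measurable M" using g by auto
  have gm: "(\<integral>\<^sup>+ x. ennreal (- g x) \<partial>M) \<noteq> \<infinity>" using g by (simp add: real_integrable_def)
  have "(\<integral>\<^sup>+ x. ennreal (h x) \<partial>M) \<le> (\<integral>\<^sup>+ x. ennreal (g x + h x) + ennreal (- g x) \<partial>M)"
  proof (rule nn_integral_mono)
    fix x
    have "ennreal (h x) \<le> ennreal (max 0 (g x + h x) + max 0 (- g x))" by (rule ennreal_leI) simp
    also have "\<dots> = ennreal (g x + h x) + ennreal (- g x)" by (simp add: ennreal_plus ennreal_neg max_def)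
    finally show "ennreal (h x) \<le> ennreal (g x + h x) + ennreal (- g x)" .
  qed
  also have "\<dots> = (\<integral>\<^sup>+ x. ennreal (g x + h x) \<partial>M) + (\<integral>\<^sup>+ x. ennreal (- g x) \<partial>M)"
    by (rule nn_integral_add) auto
  finally have pos: "(\<integral>\<^sup>+ x. ennreal (g x + h x) \<partial>M) = \<infinity>"
    using True gm by (auto simp: top_unique ennreal_add_eq_top)
  have "(\<integral>\<^sup>+ x. ennreal (- (g x + h x)) \<partial>M) \<le> (\<integral>\<^sup>+ x. ennreal (- g x) \<partial>M)"
    using h0 by (intro nn_integral_mono ennreal_leI) auto
  then have neg: "(\<integral>\<^sup>+ x. ennreal (- (g x + h x)) \<partial>M) \<noteq> \<infinity>" using gm by (auto simp: top_unique)
  then obtain q where "(\<integral>\<^sup>+ x. ennreal (- (g x + h x)) \<partial>M) = ennreal q" "q \<ge> 0"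
    by (cases "\<integral>\<^sup>+ x. ennreal (- (g x + h x)) \<partial>M") auto
  then show ?thesis
    unfolding ext_integral_def pos True by (simp add: enn2ereal_ennreal)
qed

lemma ext_integral_ge:
  assumes "integrable M g" "f \<in> borel_measurable M" "\<And>x. x \<in> space M \<Longrightarrow> g x \<le> f x"
  shows "ereal (integral\<^sup>L M g) \<le> ext_integral M f"
proof -
  have "ext_integral M (\<lambda>x. g x + (f x - g x)) = ereal (integral\<^sup>L M g) + enn2ereal (\<integral>\<^sup>+ x. ennreal (f x - g x) \<partial>M)"
    using assms by (intro ext_integral_add) auto
  then show ?thesis by (simp add: ereal_le_add_self enn2ereal_nonneg)
qed

lemma nn_integral_measure_sum:
  assumes sets: "sets M1 = sets M" "sets M2 = sets M"
    and sum: "\<And>B. B \<in> sets M \<Longrightarrow> emeasure M B = emeasure M1 B + emeasure M2 B"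
    and f: "f \<in> borel_measurable M"
  shows "(\<integral>\<^sup>+ x. f x \<partial>M) = (\<integral>\<^sup>+ x. f x \<partial>M1) + (\<integral>\<^sup>+ x. f x \<partial>M2)"
  using f
proof (induct rule: borel_measurable_induct)
  case (cong f g)
  have "integral\<^sup>N N f = integral\<^sup>N N g" if "sets N = sets M" for N
    using cong(3) sets_eq_imp_space_eq[OF that] by (intro nn_integral_cong) auto
  then show ?case using cong(4) sets by simp
next
  case (set A)
  then show ?case using sum sets by simp
next
  case (mult u c)
  have "u \<in> borel_measurable M1" "u \<in> borel_measurable M2"
    using mult(2) by (simp_all add: measurable_cong_sets[OF sets(1) refl] measurable_cong_sets[OF sets(2) refl])
  with mult show ?case by (simp add: nn_integral_cmult distrib_left)
next
  case (add u v)
  have "u \<in> borel_measurable M1" "u \<in> borel_measurable M2" "v \<in> borel_measurable M1" "v \<in> borel_measurable M2"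
    using add(1,3,4) by (simp_all add: measurable_cong_sets[OF sets(1) refl] measurable_cong_sets[OF sets(2) refl])
  with add show ?case by (simp add: nn_integral_add add_ac)
next
  case (seq F)
  have mc: "(\<integral>\<^sup>+ x. (SUP i. F i) x \<partial>N) = (SUP i. \<integral>\<^sup>+ x. F i x \<partial>N)" if N: "sets N = sets M" for N
  proof -
    have "(\<integral>\<^sup>+ x. (SUP i. F i x) \<partial>N) = (SUP i. \<integral>\<^sup>+ x. F i x \<partial>N)"
      using seq by (intro nn_integral_monotone_convergence_SUP) (simp_all add: measurable_cong_sets[OF N refl])
    then show ?thesis by (simp add: SUP_apply image_comp comp_def)
  qed
  have inc: "incseq (\<lambda>i. \<integral>\<^sup>+ x. F i x \<partial>N)" for N
    using seq(4) by (auto simp: incseq_def le_fun_def intro!: nn_integral_mono)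
  have "(\<integral>\<^sup>+ x. (SUP i. F i) x \<partial>M) = (SUP i. (\<integral>\<^sup>+ x. F i x \<partial>M1) + (\<integral>\<^sup>+ x. F i x \<partial>M2))"
    by (simp only: mc[OF refl] seq)
  also have "\<dots> = (SUP i. \<integral>\<^sup>+ x. F i x \<partial>M1) + (SUP i. \<integral>\<^sup>+ x. F i x \<partial>M2)"
    by (rule ennreal_SUP_add[OF inc inc])
  also have "\<dots> = (\<integral>\<^sup>+ x. (SUP i. F i) x \<partial>M1) + (\<integral>\<^sup>+ x. (SUP i. F i) x \<partial>M2)"
    by (simp only: mc[OF sets(1)] mc[OF sets(2)])
  finally show ?case .
qed

lemma integral_measure_sum:
  fixes f :: "'a \<Rightarrow> real"
  assumes sets: "sets M1 = sets M" "sets M2 = sets M"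
    and sum: "\<And>B. B \<in> sets M \<Longrightarrow> emeasure M B = emeasure M1 B + emeasure M2 B"
    and f: "integrable M f"
  shows "integrable M1 f" "integrable M2 f" "integral\<^sup>L M f = integral\<^sup>L M1 f + integral\<^sup>L M2 f"
proof -
  have fm: "f \<in> borel_measurable M" using f by auto
  have m: "f \<in> borel_measurable M1" "f \<in> borel_measurable M2"
    using fm by (simp_all add: measurable_cong_sets[OF sets(1) refl] measurable_cong_sets[OF sets(2) refl])
  have p: "(\<integral>\<^sup>+ x. ennreal (f x) \<partial>M) = (\<integral>\<^sup>+ x. ennreal (f x) \<partial>M1) + (\<integral>\<^sup>+ x. ennreal (f x) \<partial>M2)"
    "(\<integral>\<^sup>+ x. ennreal (- f x) \<partial>M) = (\<integral>\<^sup>+ x. ennreal (- f x) \<partial>M1) + (\<integral>\<^sup>+ x. ennreal (- f x) \<partial>M2)"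
    using fm by (intro nn_integral_measure_sum[OF sets sum]; simp)+
  have fin: "(\<integral>\<^sup>+ x. ennreal (f x) \<partial>M) \<noteq> \<infinity>" "(\<integral>\<^sup>+ x. ennreal (- f x) \<partial>M) \<noteq> \<infinity>"
    using f by (auto simp: real_integrable_def)
  show i: "integrable M1 f" "integrable M2 f"
    using fin m unfolding p real_integrable_def by (auto simp: ennreal_add_eq_top)
  have "enn2real (a + b) = enn2real a + enn2real b" if "a + b \<noteq> \<infinity>" for a b
    using that by (intro enn2real_plus) (auto simp: ennreal_add_eq_top less_top)
  then show "integral\<^sup>L M f = integral\<^sup>L M1 f + integral\<^sup>L M2 f"
    using fin unfolding real_lebesgue_integral_def[OF f] real_lebesgue_integral_def[OF i(1)] real_lebesgue_integral_def[OF i(2)] p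
    by simp
qed

text \<open>Provides the dominating measure \<nu> + \<mu>, both for the Lebesgue decomposition and
  for almost everywhere limits that must hold under both measures.\<close>

lemma measure_sum_exists:
  assumes sets: "sets M2 = sets M1"
  obtains M where "sets M = sets M1" "\<And>B. B \<in> sets M1 \<Longrightarrow> emeasure M B = emeasure M1 B + emeasure M2 B"
proof -
  define M where "M = measure_of (space M1) (sets M1) (\<lambda>B. emeasure M1 B + emeasure M2 B)"
  have "emeasure M B = emeasure M1 B + emeasure M2 B" if "B \<in> sets M1" for B
    unfolding M_def
  proof (rule emeasure_measure_of_sigma)
    show "sigma_algebra (space M1) (sets M1)" by (rule sets.sigma_algebra_axioms)
    show "positive (sets M1) (\<lambda>B. emeasure M1 B + emeasure M2 B)" by (simp add: positive_def)
    show "countably_additive (sets M1) (\<lambda>B. emeasure M1 B + emeasure M2 B)"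
    proof (rule countably_additiveI)
      fix A :: "nat \<Rightarrow> 'a set" assume A: "range A \<subseteq> sets M1" "disjoint_family A"
      then show "(\<Sum>i. emeasure M1 (A i) + emeasure M2 (A i)) = emeasure M1 (\<Union>i. A i) + emeasure M2 (\<Union>i. A i)"
        using suminf_add[of "\<lambda>i. emeasure M1 (A i)" "\<lambda>i. emeasure M2 (A i)", OF summableI summableI]
        by (simp add: suminf_emeasure sets)
    qed
  qed (fact that)
  moreover have "sets M = sets M1" by (simp add: M_def)
  ultimately show thesis using that by blast
qed

text \<open>Let g be the density of \<nu> with respect to \<kappa> = \<nu> + \<mu>. The singular set
  is A = {g = 0}, which is \<nu>-null. Outside A a \<nu>-null set is \<kappa>-null, hence
  \<mu>-null, so the restriction of \<mu> to the complement of A is absolutely continuous.\<close>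

lemma lebesgue_decomposition_exists:
  assumes \<nu>: "finite_measure \<nu>" and \<mu>: "finite_measure \<mu>" and sets: "sets \<mu> = sets \<nu>"
  obtains \<rho> \<mu>s where "lebesgue_decomposition \<nu> \<mu> \<rho> \<mu>s"
proof -
  interpret \<nu>: finite_measure \<nu> by fact
  interpret \<mu>: finite_measure \<mu> by fact
  have sp: "space \<mu> = space \<nu>" using sets by (rule sets_eq_imp_space_eq)
  obtain \<kappa> where \<kappa>: "sets \<kappa> = sets \<nu>" "\<And>B. B \<in> sets \<nu> \<Longrightarrow> emeasure \<kappa> B = emeasure \<nu> B + emeasure \<mu> B"
    using measure_sum_exists[OF sets] by blast
  have spk: "space \<kappa> = space \<nu>" using \<kappa>(1) by (rule sets_eq_imp_space_eq)
  interpret \<kappa>: finite_measure \<kappa>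
    by (rule finite_measureI) (simp add: \<kappa> spk ennreal_add_eq_top)
  have "absolutely_continuous \<kappa> \<nu>"
    by (auto simp: absolutely_continuous_def null_sets_def \<kappa>)
  then obtain g where g: "g \<in> borel_measurable \<kappa>" "density \<kappa> g = \<nu>"
    using \<kappa>.Radon_Nikodym_finite_measure[OF \<nu>] \<kappa>(1) by auto
  define A where "A = {x \<in> space \<nu>. g x = 0}"
  have A: "A \<in> sets \<nu>" using g(1) unfolding A_def \<kappa>(1)[symmetric] spk[symmetric] by measurable
  have \<nu>A: "emeasure \<nu> A = 0"
  proof -
    have "emeasure \<nu> A = (\<integral>\<^sup>+ x. g x * indicator A x \<partial>\<kappa>)"
      unfolding g(2)[symmetric] using A g(1) by (intro emeasure_density) (simp_all add: \<kappa>)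
    also have "\<dots> = (\<integral>\<^sup>+ x. 0 \<partial>\<kappa>)" by (intro nn_integral_cong) (auto simp: A_def split: split_indicator)
    finally show ?thesis by simp
  qed
  define N where "N = density \<mu> (indicator (space \<nu> - A))"
  define \<mu>s where "\<mu>s = density \<mu> (indicator A)"
  have N_sets: "sets N = sets \<nu>" and s_sets: "sets \<mu>s = sets \<nu>" by (simp_all add: N_def \<mu>s_def sets)
  have N_em: "emeasure N B = emeasure \<mu> (B - A)" and s_em: "emeasure \<mu>s B = emeasure \<mu> (B \<inter> A)" if "B \<in> sets \<nu>" for B
  proof -
    have "emeasure N B = (\<integral>\<^sup>+ x. indicator (space \<nu> - A) x * indicator B x \<partial>\<mu>)"
      unfolding N_def using A that sets by (subst emeasure_density) auto
    also have "\<dots> = (\<integral>\<^sup>+ x. indicator (B - A) x \<partial>\<mu>)"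
      by (intro nn_integral_cong) (auto simp: sp split: split_indicator)
    finally show "emeasure N B = emeasure \<mu> (B - A)" using A that sets by simp
    have "emeasure \<mu>s B = (\<integral>\<^sup>+ x. indicator A x * indicator B x \<partial>\<mu>)"
      unfolding \<mu>s_def using A that sets by (subst emeasure_density) auto
    also have "\<dots> = (\<integral>\<^sup>+ x. indicator (B \<inter> A) x \<partial>\<mu>)"
      by (intro nn_integral_cong) (auto split: split_indicator)
    finally show "emeasure \<mu>s B = emeasure \<mu> (B \<inter> A)" using A that sets by simp
  qed
  have N_fin: "finite_measure N"
    by (rule finite_measureI) (use N_em[of "space \<nu>"] sets_eq_imp_space_eq[OF N_sets] in auto)
  have "absolutely_continuous \<nu> N"
    unfolding absolutely_continuous_def
  proof
    fix B assume B: "B \<in> null_sets \<nu>"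
    then have B': "B \<in> sets \<nu>" "emeasure \<nu> B = 0" by auto
    have gB: "(\<lambda>x. g x * indicator B x) \<in> borel_measurable \<kappa>"
    proof -
      have [measurable]: "B \<in> sets \<kappa>" "g \<in> borel_measurable \<kappa>" using B' g \<kappa> by auto
      show ?thesis by measurable
    qed
    have "(\<integral>\<^sup>+ x. g x * indicator B x \<partial>\<kappa>) = 0"
      using emeasure_density[OF g(1), of B] B' by (simp add: g(2) \<kappa>)
    then have "AE x in \<kappa>. g x * indicator B x = 0"
      using gB by (simp add: nn_integral_0_iff_AE)
    then have "AE x in \<kappa>. x \<notin> B - A"
      using AE_space by eventually_elim (auto simp: A_def spk split: split_indicator_asm)
    then have "emeasure \<kappa> (B - A) = 0"
      using B' A by (subst (asm) AE_iff_measurable[of "B - A"]) (auto simp: \<kappa> spk dest: sets.sets_into_space)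
    then have "emeasure \<mu> (B - A) = 0" using B' A \<kappa>(2)[of "B - A"] by auto
    then show "B \<in> null_sets N" using N_em[OF B'(1)] B' by (auto simp: N_sets)
  qed
  then obtain f where f: "f \<in> borel_measurable \<nu>" "density \<nu> f = N"
    using \<nu>.Radon_Nikodym_finite_measure[OF N_fin N_sets] by auto
  have "(\<integral>\<^sup>+ x. f x \<partial>\<nu>) = emeasure N (space \<nu>)"
    unfolding f(2)[symmetric] using f(1) by (subst emeasure_density) (auto intro!: nn_integral_cong)
  also have "\<dots> \<noteq> \<infinity>" using N_em[OF sets.top] by simp
  finally have "AE x in \<nu>. f x \<noteq> \<infinity>" using f(1) by (intro nn_integral_PInf_AE) auto
  \<comment> \<open>The definition asks for a real-valued density; f is finite almost everywhere
    because N is a finite measure, so the change is invisible to N.\<close>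
  then have dens: "density \<nu> (\<lambda>x. ennreal (enn2real (f x))) = N"
    unfolding f(2)[symmetric] using f(1)
    by (intro density_cong) (auto elim!: eventually_mono simp: less_top)
  have "lebesgue_decomposition \<nu> \<mu> (\<lambda>x. enn2real (f x)) \<mu>s"
    unfolding lebesgue_decomposition_def dens
  proof (intro conjI)
    show "\<exists>A\<in>sets \<nu>. emeasure \<nu> A = 0 \<and> emeasure \<mu>s (space \<nu> - A) = 0"
    proof (intro bexI conjI)
      show "emeasure \<mu>s (space \<nu> - A) = 0" using A s_em[of "space \<nu> - A"] by (simp add: Int_commute)
    qed (use A \<nu>A in auto)
    show "\<forall>B\<in>sets \<nu>. emeasure \<mu> B = emeasure N B + emeasure \<mu>s B"
    proof
      fix B assume B: "B \<in> sets \<nu>"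
      have "emeasure \<mu> (B - A) + emeasure \<mu> (B \<inter> A) = emeasure \<mu> ((B - A) \<union> (B \<inter> A))"
        using B A sets by (intro plus_emeasure) auto
      also have "(B - A) \<union> (B \<inter> A) = B" by auto
      finally show "emeasure \<mu> B = emeasure N B + emeasure \<mu>s B" using B by (simp add: N_em s_em)
    qed
  qed (use f(1) s_sets in auto)
  then show thesis by (rule that)
qed


section \<open>Duality for the functionals\<close>

text \<open>Separates the value of the functional from the decomposition that \<open>SOME\<close>
  picks in \<open>U_functional\<close>; duality then shows that the value depends on the two
  measures alone.\<close>

definition functional_value :: "(real \<Rightarrow> real) \<Rightarrow> 'a measure \<Rightarrow> ('a \<Rightarrow> real) \<Rightarrow> 'a measure \<Rightarrow> ereal" where
  "functional_value U \<nu> \<rho> \<mu>s = ext_integral \<nu> (\<lambda>x. U (\<rho> x)) + U_prime_inf U * enn2ereal (emeasure \<mu>s (space \<nu>))"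

text \<open>The absolutely continuous part comes from integrating \<rho> \<phi> + b \<le> U(\<rho>)
  against \<nu>, the singular part from integrating \<phi> \<le> U'(\<infinity>) against \<mu>s. The
  pair may be any bounded Borel one; this is the form that survives composition with a Borel
  map.\<close>

lemma (in convex_nonlinearity) minorant_pair_le:
  assumes dec: "lebesgue_decomposition \<nu> \<mu> \<rho> \<mu>s"
    and \<nu>: "finite_measure \<nu>" and \<mu>: "finite_measure \<mu>" and sets: "sets \<mu> = sets \<nu>"
    and \<phi> [measurable]: "\<phi> \<in> borel_measurable \<nu>" and b [measurable]: "b \<in> borel_measurable \<nu>"
    and bd: "\<And>x. x \<in> space \<nu> \<Longrightarrow> \<bar>\<phi> x\<bar> \<le> C" "\<And>x. x \<in> space \<nu> \<Longrightarrow> \<bar>b x\<bar> \<le> C"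
    and min: "\<And>x. x \<in> space \<nu> \<Longrightarrow> (\<phi> x, b x) \<in> minorants U"
  shows "ereal (integral\<^sup>L \<mu> \<phi> + integral\<^sup>L \<nu> b)
    \<le> ext_integral \<nu> (\<lambda>x. U (\<rho> x)) + U_prime_inf U * enn2ereal (emeasure \<mu>s (space \<nu>))"
proof -
  interpret \<nu>: finite_measure \<nu> by fact
  interpret \<mu>: finite_measure \<mu> by fact
  have \<rho> [measurable]: "\<rho> \<in> borel_measurable \<nu>" and \<rho>0: "\<And>x. x \<in> space \<nu> \<Longrightarrow> 0 \<le> \<rho> x" and s_sets: "sets \<mu>s = sets \<nu>"
    and sum: "\<And>B. B \<in> sets \<nu> \<Longrightarrow> emeasure \<mu> B = emeasure (density \<nu> (\<lambda>x. ennreal (\<rho> x))) B + emeasure \<mu>s B"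
    using dec by (auto simp: lebesgue_decomposition_def)
  have sp: "space \<mu> = space \<nu>" "space \<mu>s = space \<nu>"
    using sets s_sets by (auto dest: sets_eq_imp_space_eq)
  have ms: "f \<in> borel_measurable \<mu> \<longleftrightarrow> f \<in> borel_measurable \<nu>" for f :: "'a \<Rightarrow> real"
    by (simp add: measurable_cong_sets[OF sets refl])
  have "emeasure \<mu>s (space \<nu>) \<le> emeasure \<mu> (space \<nu>)" using sum[OF sets.top] by simp
  then have s_fin: "emeasure \<mu>s (space \<nu>) \<noteq> \<infinity>" using \<mu>.emeasure_finite by (auto simp: top_unique)
  interpret s: finite_measure \<mu>s by (rule finite_measureI) (use s_fin sp in simp)
  have \<phi>\<mu>: "integrable \<mu> \<phi>"
    by (rule \<mu>.integrable_const_bound[where B = C]) (use bd sp ms in auto)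
  have b\<nu>: "integrable \<nu> b"
    by (rule \<nu>.integrable_const_bound[where B = C]) (use bd in auto)
  note I = integral_measure_sum[of "density \<nu> (\<lambda>x. ennreal (\<rho> x))" \<mu> \<mu>s \<phi>]
  have i1: "integrable (density \<nu> (\<lambda>x. ennreal (\<rho> x))) \<phi>" and i2: "integrable \<mu>s \<phi>"
    and i3: "integral\<^sup>L \<mu> \<phi> = integral\<^sup>L (density \<nu> (\<lambda>x. ennreal (\<rho> x))) \<phi> + integral\<^sup>L \<mu>s \<phi>"
    using I \<phi>\<mu> sets s_sets sum by auto
  have AE\<rho>: "AE x in \<nu>. 0 \<le> \<rho> x" using \<rho>0 by (rule AE_I2)
  have \<rho>\<phi>: "integrable \<nu> (\<lambda>x. \<rho> x * \<phi> x)"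
    using i1 by (simp add: integrable_real_density[OF \<rho> AE\<rho> \<phi>])
  have split: "integral\<^sup>L \<mu> \<phi> + integral\<^sup>L \<nu> b = (\<integral>x. \<rho> x * \<phi> x + b x \<partial>\<nu>) + integral\<^sup>L \<mu>s \<phi>"
    using \<rho>\<phi> b\<nu> by (simp add: i3 integral_real_density[OF \<rho> AE\<rho> \<phi>])
  have ac: "ereal (\<integral>x. \<rho> x * \<phi> x + b x \<partial>\<nu>) \<le> ext_integral \<nu> (\<lambda>x. U (\<rho> x))"
  proof (rule ext_integral_ge)
    show "integrable \<nu> (\<lambda>x. \<rho> x * \<phi> x + b x)" using \<rho>\<phi> b\<nu> by (rule Bochner_Integration.integrable_add)
    show "(\<lambda>x. U (\<rho> x)) \<in> borel_measurable \<nu>" using \<rho> \<rho>0 by (rule measurable_comp)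
    show "\<rho> x * \<phi> x + b x \<le> U (\<rho> x)" if "x \<in> space \<nu>" for x
      using minorantsD[OF min[OF that] \<rho>0[OF that]] by (simp add: mult.commute)
  qed
  have sing: "ereal (integral\<^sup>L \<mu>s \<phi>) \<le> U_prime_inf U * enn2ereal (emeasure \<mu>s (space \<nu>))"
  proof -
    have em: "enn2ereal (emeasure \<mu>s (space \<nu>)) = ereal (measure \<mu>s (space \<nu>))"
      by (simp add: s.emeasure_eq_measure enn2ereal_ennreal)
    have le: "ereal (\<phi> x) \<le> U_prime_inf U" if "x \<in> space \<nu>" for x
      using minorant_le_U_prime_inf[OF min[OF that]] .
    show ?thesis
    \<comment> \<open>With zero singular mass the product is 0 even if U'(\<infinity>) =
      \<infinity>, and both sides vanish. Positive mass yields a point of the space, at which \<phi>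
      rules out the value -\<infinity>.\<close>
    proof (cases "measure \<mu>s (space \<nu>) = 0")
      case True
      have "AE x in \<mu>s. False"
        by (rule AE_I[where N = "space \<nu>"]) (use True sp s_sets in \<open>auto simp: s.emeasure_eq_measure\<close>)
      then have "integral\<^sup>L \<mu>s \<phi> = 0" by (intro integral_eq_zero_AE) (auto elim: eventually_mono)
      then show ?thesis using True by (simp add: em zero_ereal_def[symmetric])
    next
      case False
      then have pos: "measure \<mu>s (space \<nu>) > 0" by (simp add: zero_less_measure_iff)
      then obtain x0 where x0: "x0 \<in> space \<nu>" by (metis measure_empty ex_in_conv less_irrefl)
      show ?thesis
      proof (cases "U_prime_inf U")
        case (real u)
        have "integral\<^sup>L \<mu>s \<phi> \<le> (\<integral>x. u \<partial>\<mu>s)"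
          by (rule integral_mono[OF i2]) (use le real sp in auto)
        then show ?thesis using real em sp by (simp add: mult.commute)
      next
        case PInf
        then show ?thesis using pos em by simp
      next
        case MInf
        then show ?thesis using le[OF x0] by simp
      qed
    qed
  qed
  show ?thesis
    unfolding split plus_ereal.simps(1)[symmetric] by (rule add_mono[OF ac sing])
qed

lemma abs_diff_indicator_le_1:
  fixes c :: real
  assumes "0 \<le> c" "c \<le> 1"
  shows "\<bar>c - indicator E x\<bar> \<le> 1"
  using assms by (auto split: split_indicator)

section \<open>From continuous to Borel families of minorants\<close>

context compact_metric
begin

text \<open>Induction over the sigma-algebra generated by the intersection-stable family of open
  sets, with complements and disjoint unions. The tolerance is quantified inside the statement so
  that the induction hypothesis is available for every tolerance.\<close>

lemma borel_indicator_L1_approx: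
  assumes "finite_measure \<kappa>" and sets: "sets \<kappa> = sets (borel_metric X)"
    and E: "E \<in> sets (borel_metric X)"
  shows "\<forall>\<eta>>0. \<exists>\<xi>. continuous_map (mtopology_of X) euclideanreal \<xi> \<and> (\<forall>x. 0 \<le> \<xi> x \<and> \<xi> x \<le> 1) \<and>
    (\<integral>x. \<bar>\<xi> x - indicator E x\<bar> \<partial>\<kappa>) < \<eta>"
proof -
  interpret \<kappa>: finite_measure \<kappa> by fact
  have sp: "space \<kappa> = mspace X" using sets_eq_imp_space_eq[OF sets] by simp
  have mk: "\<xi> \<in> borel_measurable \<kappa>" if "continuous_map (mtopology_of X) euclideanreal \<xi>" for \<xi>
    using borel_measurable_continuous_map[OF that] by (simp add: measurable_cong_sets[OF sets refl])
  have int: "integrable \<kappa> (\<lambda>x. \<bar>\<xi> x - indicator E x\<bar>)"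
    if "continuous_map (mtopology_of X) euclideanreal \<xi>" "\<forall>x. 0 \<le> \<xi> x \<and> \<xi> x \<le> 1" "E \<in> sets (borel_metric X)" for \<xi> E
    by (rule \<kappa>.integrable_const_bound[where B = 1])
       (use that mk[OF that(1)] sets in \<open>auto intro: abs_diff_indicator_le_1\<close>)
  have "Int_stable {S. openin (mtopology_of X) S}" by (auto simp: Int_stable_def)
  moreover have "{S. openin (mtopology_of X) S} \<subseteq> Pow (mspace X)" using openin_subset by fastforce
  moreover have "E \<in> sigma_sets (mspace X) {S. openin (mtopology_of X) S}"
    using E by (simp add: sets_borel_metric)
  ultimately show ?thesis
  proof (induct rule: sigma_sets_induct_disjoint)
    case (basic S)
    then obtain \<phi> :: "nat \<Rightarrow> 'a \<Rightarrow> real" where \<phi>: "\<And>n. continuous_map (mtopology_of X) euclideanreal (\<phi> n)"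
      "\<And>n x. 0 \<le> \<phi> n x" "\<And>n x. \<phi> n x \<le> 1" "\<And>x. x \<in> mspace X \<Longrightarrow> (\<lambda>n. \<phi> n x) \<longlonglongrightarrow> indicator S x"
      using open_indicator_approx by blast
    have S: "S \<in> sets \<kappa>" using basic by (simp add: sets openin_in_sets_borel_metric)
    have "(\<lambda>n. \<integral>x. \<bar>\<phi> n x - indicator S x\<bar> \<partial>\<kappa>) \<longlonglongrightarrow> (\<integral>x. 0 \<partial>\<kappa>)"
    proof (rule integral_dominated_convergence[where w = "\<lambda>_. 1"])
      show "AE x in \<kappa>. (\<lambda>n. \<bar>\<phi> n x - indicator S x\<bar>) \<longlonglongrightarrow> 0"
      proof (rule AE_I2)
        fix x assume "x \<in> space \<kappa>"
        then have "(\<lambda>n. \<phi> n x - indicator S x) \<longlonglongrightarrow> 0" using \<phi>(4)[of x] by (simp add: sp LIM_zero)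
        then show "(\<lambda>n. \<bar>\<phi> n x - indicator S x\<bar>) \<longlonglongrightarrow> 0" by (rule tendsto_rabs_zero)
      qed
      show "AE x in \<kappa>. norm \<bar>\<phi> n x - indicator S x\<bar> \<le> 1" for n
        using \<phi>(2,3)[of n] by (intro AE_I2) (simp add: abs_diff_indicator_le_1)
      show "(\<lambda>x. \<bar>\<phi> n x - indicator S x\<bar>) \<in> borel_measurable \<kappa>" for n
        using mk[OF \<phi>(1)] S by measurable
    qed auto
    then have lim: "(\<lambda>n. \<integral>x. \<bar>\<phi> n x - indicator S x\<bar> \<partial>\<kappa>) \<longlonglongrightarrow> 0" by simp
    show ?case
    proof (intro allI impI)
      fix \<eta> :: real assume "\<eta> > 0"
      then obtain n where "(\<integral>x. \<bar>\<phi> n x - indicator S x\<bar> \<partial>\<kappa>) < \<eta>"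
        using eventually_happens'[OF sequentially_bot order_tendstoD(2)[OF lim]] by blast
      then show "\<exists>\<xi>. continuous_map (mtopology_of X) euclideanreal \<xi> \<and> (\<forall>x. 0 \<le> \<xi> x \<and> \<xi> x \<le> 1) \<and>
        (\<integral>x. \<bar>\<xi> x - indicator S x\<bar> \<partial>\<kappa>) < \<eta>"
        using \<phi> by blast
    qed
  next
    case empty
    show ?case by (auto intro!: exI[of _ "\<lambda>_. 0"])
  next
    case (compl E)
    show ?case
    proof (intro allI impI)
      fix \<eta> :: real assume "\<eta> > 0"
      then obtain \<xi> where \<xi>: "continuous_map (mtopology_of X) euclideanreal \<xi>" "\<forall>x. 0 \<le> \<xi> x \<and> \<xi> x \<le> 1"
        "(\<integral>x. \<bar>\<xi> x - indicator E x\<bar> \<partial>\<kappa>) < \<eta>" using compl by blast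
      have "(\<integral>x. \<bar>(1 - \<xi> x) - indicator (mspace X - E) x\<bar> \<partial>\<kappa>) = (\<integral>x. \<bar>\<xi> x - indicator E x\<bar> \<partial>\<kappa>)"
        by (rule Bochner_Integration.integral_cong) (auto simp: sp split: split_indicator)
      moreover have "continuous_map (mtopology_of X) euclideanreal (\<lambda>x. 1 - \<xi> x)"
        by (rule continuous_map_diff[OF _ \<xi>(1)]) simp
      ultimately show "\<exists>\<xi>. continuous_map (mtopology_of X) euclideanreal \<xi> \<and> (\<forall>x. 0 \<le> \<xi> x \<and> \<xi> x \<le> 1) \<and>
        (\<integral>x. \<bar>\<xi> x - indicator (mspace X - E) x\<bar> \<partial>\<kappa>) < \<eta>"
        using \<xi> by (intro exI[of _ "\<lambda>x. 1 - \<xi> x"]) simp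
    qed
  next
    case (union E)
    have E: "E i \<in> sets (borel_metric X)" for i using union(2) by (auto simp: sets_borel_metric)
    have Ek: "range E \<subseteq> sets \<kappa>" using E sets by auto
    show ?case
    proof (intro allI impI)
      fix \<eta> :: real assume \<eta>: "\<eta> > 0"
      define F where "F n = (\<Union>i<n. E i)" for n
      have F: "F n \<in> sets \<kappa>" "(\<Union>i. E i) \<in> sets \<kappa>" for n using Ek by (auto simp: F_def)
      have "(\<lambda>n. measure \<kappa> (F n)) \<longlonglongrightarrow> measure \<kappa> (\<Union>n. F n)"
        using F by (intro \<kappa>.finite_Lim_measure_incseq) (force simp: incseq_def F_def)+
      moreover have "(\<Union>n. F n) = (\<Union>i. E i)" by (auto simp: F_def)
      ultimately have lim: "(\<lambda>n. measure \<kappa> (F n)) \<longlonglongrightarrow> measure \<kappa> (\<Union>i. E i)" by simp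
      have "\<forall>\<^sub>F n in sequentially. measure \<kappa> (\<Union>i. E i) - \<eta> / 2 < measure \<kappa> (F n)"
        using \<eta> by (intro order_tendstoD(1)[OF lim]) simp
      then obtain n where n: "measure \<kappa> (\<Union>i. E i) - \<eta> / 2 < measure \<kappa> (F n)"
        using eventually_happens'[OF sequentially_bot] by blast
      \<comment> \<open>The number n of sets is already fixed by the measure of the remaining tail,
        so n errors of size \<eta> / (2 (n + 1)) add up to at most \<eta>/2. The sum is then cut off
        at 1, which does not move it away from an indicator.\<close>
      have "\<forall>i. \<exists>\<xi>. continuous_map (mtopology_of X) euclideanreal \<xi> \<and> (\<forall>x. 0 \<le> \<xi> x \<and> \<xi> x \<le> 1) \<and>
        (\<integral>x. \<bar>\<xi> x - indicator (E i) x\<bar> \<partial>\<kappa>) < \<eta> / (2 * real (Suc n))"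
        using union(3) \<eta> by simp
      then obtain \<xi> where \<xi>: "\<And>i. continuous_map (mtopology_of X) euclideanreal (\<xi> i)" "\<And>i. \<forall>x. 0 \<le> \<xi> i x \<and> \<xi> i x \<le> 1"
        "\<And>i. (\<integral>x. \<bar>\<xi> i x - indicator (E i) x\<bar> \<partial>\<kappa>) < \<eta> / (2 * real (Suc n))" by metis
      define \<psi> where "\<psi> x = min 1 (\<Sum>i<n. \<xi> i x)" for x
      have \<psi>c: "continuous_map (mtopology_of X) euclideanreal \<psi>"
        unfolding \<psi>_def
        by (rule continuous_map_real_min[OF continuous_map_const[THEN iffD2] continuous_map_sum]) (use \<xi> in auto)
      have \<psi>b: "\<forall>x. 0 \<le> \<psi> x \<and> \<psi> x \<le> 1" using \<xi>(2) by (auto simp: \<psi>_def intro!: sum_nonneg)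
      have pt: "\<bar>\<psi> x - indicator (\<Union>i. E i) x\<bar> \<le> (\<Sum>i<n. \<bar>\<xi> i x - indicator (E i) x\<bar>) + indicator ((\<Union>i. E i) - F n) x" for x
      proof -
        have "indicator (F n) x = (\<Sum>i<n. indicator (E i) x :: real)"
          unfolding F_def using union(1) by (intro indicator_UN_disjoint) (auto simp: disjoint_family_on_def)
        then have "\<bar>(\<Sum>i<n. \<xi> i x) - indicator (F n) x\<bar> \<le> (\<Sum>i<n. \<bar>\<xi> i x - indicator (E i) x\<bar>)"
          by (simp add: sum_subtractf[symmetric])
        moreover have "\<bar>\<psi> x - indicator (F n) x\<bar> \<le> \<bar>(\<Sum>i<n. \<xi> i x) - indicator (F n) x\<bar>"
          by (auto simp: \<psi>_def split: split_indicator)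
        moreover have "\<bar>indicator (F n) x - indicator (\<Union>i. E i) x\<bar> = (indicator ((\<Union>i. E i) - F n) x :: real)"
          by (auto simp: F_def split: split_indicator)
        ultimately show ?thesis by linarith
      qed
      have i: "integrable \<kappa> (\<lambda>x. \<bar>\<xi> i x - indicator (E i) x\<bar>)" for i
        using int \<xi> E by blast
      have UE: "(\<Union>i. E i) \<in> sets (borel_metric X)" using F sets by simp
      have FD: "(\<Union>i. E i) - F n \<in> sets \<kappa>" using F by blast
      have iS: "integrable \<kappa> (\<lambda>x. \<Sum>i<n. \<bar>\<xi> i x - indicator (E i) x\<bar>)"
        by (rule Bochner_Integration.integrable_sum[OF i])
      have iR: "integrable \<kappa> (indicator ((\<Union>i. E i) - F n) :: 'a \<Rightarrow> real)"
        using FD by (rule integrable_real_indicator) (simp add: less_top[symmetric])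
      have "(\<integral>x. \<bar>\<psi> x - indicator (\<Union>i. E i) x\<bar> \<partial>\<kappa>)
         \<le> (\<integral>x. (\<Sum>i<n. \<bar>\<xi> i x - indicator (E i) x\<bar>) + indicator ((\<Union>i. E i) - F n) x \<partial>\<kappa>)"
        by (rule integral_mono[OF int[OF \<psi>c \<psi>b UE] Bochner_Integration.integrable_add[OF iS iR] pt])
      also have "\<dots> = (\<integral>x. (\<Sum>i<n. \<bar>\<xi> i x - indicator (E i) x\<bar>) \<partial>\<kappa>) + (\<integral>x. indicator ((\<Union>i. E i) - F n) x \<partial>\<kappa>)"
        by (rule Bochner_Integration.integral_add[OF iS iR])
      also have "(\<integral>x. (\<Sum>i<n. \<bar>\<xi> i x - indicator (E i) x\<bar>) \<partial>\<kappa>) = (\<Sum>i<n. \<integral>x. \<bar>\<xi> i x - indicator (E i) x\<bar> \<partial>\<kappa>)"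
        by (rule Bochner_Integration.integral_sum[OF i])
      also have "(\<integral>x. indicator ((\<Union>i. E i) - F n) x \<partial>\<kappa>) = measure \<kappa> ((\<Union>i. E i) - F n)"
        using sets.sets_into_space[OF FD] by (simp add: Int_absorb2)
      also have "measure \<kappa> ((\<Union>i. E i) - F n) = measure \<kappa> (\<Union>i. E i) - measure \<kappa> (F n)"
        using F by (intro \<kappa>.finite_measure_Diff) (auto simp: F_def)
      also have "(\<Sum>i<n. \<integral>x. \<bar>\<xi> i x - indicator (E i) x\<bar> \<partial>\<kappa>) \<le> (\<Sum>i<n. \<eta> / (2 * real (Suc n)))"
        using \<xi>(3) by (intro sum_mono less_imp_le)
      also have "\<dots> \<le> \<eta> / 2" using \<eta> by (simp add: field_simps)
      finally have "(\<integral>x. \<bar>\<psi> x - indicator (\<Union>i. E i) x\<bar> \<partial>\<kappa>) < \<eta>" using n by simp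
      then show "\<exists>\<xi>. continuous_map (mtopology_of X) euclideanreal \<xi> \<and> (\<forall>x. 0 \<le> \<xi> x \<and> \<xi> x \<le> 1) \<and>
        (\<integral>x. \<bar>\<xi> x - indicator (\<Union>i. E i) x\<bar> \<partial>\<kappa>) < \<eta>"
        using \<psi>c \<psi>b by blast
    qed
  qed
qed

lemma borel_indicator_AE_approx:
  assumes \<kappa>: "finite_measure \<kappa>" and sets: "sets \<kappa> = sets (borel_metric X)"
    and E: "E \<in> sets (borel_metric X)"
  obtains \<xi> :: "nat \<Rightarrow> 'a \<Rightarrow> real" where "\<And>n. continuous_map (mtopology_of X) euclideanreal (\<xi> n)"
    and "\<And>n x. 0 \<le> \<xi> n x" "\<And>n x. \<xi> n x \<le> 1"
    and "AE x in \<kappa>. (\<lambda>n. \<xi> n x) \<longlonglongrightarrow> indicator E x"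
proof -
  interpret \<kappa>: finite_measure \<kappa> by fact
  have "\<forall>n. \<exists>\<xi>. continuous_map (mtopology_of X) euclideanreal \<xi> \<and> (\<forall>x. 0 \<le> \<xi> x \<and> \<xi> x \<le> 1) \<and>
    (\<integral>x. \<bar>\<xi> x - indicator E x\<bar> \<partial>\<kappa>) < inverse (real (Suc n))"
    using borel_indicator_L1_approx[OF assms] by simp
  then obtain \<xi> where \<xi>: "\<And>n. continuous_map (mtopology_of X) euclideanreal (\<xi> n)" "\<And>n x. 0 \<le> \<xi> n x" "\<And>n x. \<xi> n x \<le> 1"
    "\<And>n. (\<integral>x. \<bar>\<xi> n x - indicator E x\<bar> \<partial>\<kappa>) < inverse (real (Suc n))" by metis
  have m: "\<xi> n \<in> borel_measurable \<kappa>" for n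
    using borel_measurable_continuous_map[OF \<xi>(1)] by (simp add: measurable_cong_sets[OF sets refl])
  have "\<exists>r::nat\<Rightarrow>nat. strict_mono r \<and> (AE x in \<kappa>. (\<lambda>n. \<xi> (r n) x - indicator E x) \<longlonglongrightarrow> 0)"
  proof (rule tendsto_L1_AE_subseq)
    show "integrable \<kappa> (\<lambda>x. \<xi> n x - indicator E x)" for n
    proof (rule \<kappa>.integrable_const_bound[where B = 1])
      show "AE x in \<kappa>. norm (\<xi> n x - indicator E x) \<le> 1"
        using \<xi>(2,3)[of n] by (intro AE_I2) (simp add: abs_diff_indicator_le_1)
    qed (use m E sets in auto)
    show "(\<lambda>n. \<integral>x. norm (\<xi> n x - indicator E x) \<partial>\<kappa>) \<longlonglongrightarrow> 0"
    proof (rule tendsto_of_abs_le[OF _ LIMSEQ_inverse_real_of_nat])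
      show "\<bar>(\<integral>x. norm (\<xi> n x - indicator E x) \<partial>\<kappa>) - 0\<bar> \<le> inverse (real (Suc n))" for n
        using \<xi>(4)[of n] by (simp add: abs_of_nonneg integral_nonneg_AE)
    qed
  qed
  then obtain r :: "nat \<Rightarrow> nat" where r: "AE x in \<kappa>. (\<lambda>n. \<xi> (r n) x - indicator E x) \<longlonglongrightarrow> 0" by blast
  show thesis
  proof (rule that[of "\<lambda>n. \<xi> (r n)"])
    show "AE x in \<kappa>. (\<lambda>n. \<xi> (r n) x) \<longlonglongrightarrow> indicator E x"
      using r by eventually_elim (rule LIM_zero_cancel)
  qed (use \<xi> in auto)
qed

text \<open>The competitors of the dual formula: continuous choices of an affine minorant at every
  point. Continuity of both components makes the dual expression pass to weak limits of both
  measures.\<close>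

definition cont_minorants :: "(real \<Rightarrow> real) \<Rightarrow> (('a \<Rightarrow> real) \<times> ('a \<Rightarrow> real)) set" where
  "cont_minorants U = {(\<phi>, b). continuous_map (mtopology_of X) euclideanreal \<phi> \<and>
     continuous_map (mtopology_of X) euclideanreal b \<and> (\<forall>x\<in>mspace X. (\<phi> x, b x) \<in> minorants U)}"

text \<open>Uniformly bounded almost everywhere limits of continuous minorant pairs. The measure
  \<kappa> is meant to be \<nu> + \<mu>, so that one limit serves the integral of \<phi> against
  \<mu> and that of b against \<nu>.\<close>

definition approximable :: "(real \<Rightarrow> real) \<Rightarrow> 'a measure \<Rightarrow> ('a \<Rightarrow> real) \<Rightarrow> ('a \<Rightarrow> real) \<Rightarrow> bool" where
  "approximable U \<kappa> \<phi> b \<longleftrightarrow> (\<exists>\<Phi> B C. (\<forall>n :: nat. (\<Phi> n, B n) \<in> cont_minorants U) \<and>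
     (\<forall>n. \<forall>x\<in>mspace X. \<bar>\<Phi> n x\<bar> \<le> C \<and> \<bar>B n x\<bar> \<le> C) \<and>
     (AE x in \<kappa>. (\<lambda>n. \<Phi> n x) \<longlonglongrightarrow> \<phi> x \<and> (\<lambda>n. B n x) \<longlonglongrightarrow> b x))"

lemma approximable_const:
  assumes "(a, b) \<in> minorants U"
  shows "approximable U \<kappa> (\<lambda>_. a) (\<lambda>_. b)"
  unfolding approximable_def
  by (rule exI[of _ "\<lambda>_ _. a"], rule exI[of _ "\<lambda>_ _. b"], rule exI[of _ "max \<bar>a\<bar> \<bar>b\<bar>"])
     (use assms in \<open>auto simp: cont_minorants_def\<close>)

text \<open>Convex combinations with continuous weights tending to the indicator of E converge to
  the switched pair; they are admissible because the set of minorants is convex.\<close>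

lemma approximable_switch:
  assumes \<kappa>: "finite_measure \<kappa>" "sets \<kappa> = sets (borel_metric X)"
    and "approximable U \<kappa> \<phi> b" "approximable U \<kappa> \<phi>' b'" and E: "E \<in> sets (borel_metric X)"
  shows "approximable U \<kappa> (\<lambda>x. if x \<in> E then \<phi> x else \<phi>' x) (\<lambda>x. if x \<in> E then b x else b' x)"
proof -
  obtain \<Phi> B C where 1: "\<And>n :: nat. (\<Phi> n, B n) \<in> cont_minorants U"
    "\<And>n x. x \<in> mspace X \<Longrightarrow> \<bar>\<Phi> n x\<bar> \<le> C \<and> \<bar>B n x\<bar> \<le> C"
    "AE x in \<kappa>. (\<lambda>n. \<Phi> n x) \<longlonglongrightarrow> \<phi> x \<and> (\<lambda>n. B n x) \<longlonglongrightarrow> b x"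
    using assms(3) unfolding approximable_def by blast
  obtain \<Phi>' B' C' where 2: "\<And>n :: nat. (\<Phi>' n, B' n) \<in> cont_minorants U"
    "\<And>n x. x \<in> mspace X \<Longrightarrow> \<bar>\<Phi>' n x\<bar> \<le> C' \<and> \<bar>B' n x\<bar> \<le> C'"
    "AE x in \<kappa>. (\<lambda>n. \<Phi>' n x) \<longlonglongrightarrow> \<phi>' x \<and> (\<lambda>n. B' n x) \<longlonglongrightarrow> b' x"
    using assms(4) unfolding approximable_def by blast
  obtain \<xi> :: "nat \<Rightarrow> 'a \<Rightarrow> real" where \<xi>: "\<And>n. continuous_map (mtopology_of X) euclideanreal (\<xi> n)"
    "\<And>n x. 0 \<le> \<xi> n x" "\<And>n x. \<xi> n x \<le> 1" "AE x in \<kappa>. (\<lambda>n. \<xi> n x) \<longlonglongrightarrow> indicator E x"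
    by (rule borel_indicator_AE_approx[OF \<kappa> E]) (rule that)
  have bd: "\<bar>c * u + (1 - c) * v\<bar> \<le> \<bar>C\<bar> + \<bar>C'\<bar>" if "0 \<le> c" "c \<le> 1" "\<bar>u\<bar> \<le> C" "\<bar>v\<bar> \<le> C'" for c u v :: real
  proof -
    have "\<bar>c * u + (1 - c) * v\<bar> \<le> c * \<bar>u\<bar> + (1 - c) * \<bar>v\<bar>"
      using that by (intro order_trans[OF abs_triangle_ineq]) (simp add: abs_mult)
    also have "\<dots> \<le> 1 * \<bar>C\<bar> + 1 * \<bar>C'\<bar>" using that by (intro add_mono mult_mono) auto
    finally show ?thesis by simp
  qed
  show ?thesis
    unfolding approximable_def
  proof (intro exI conjI allI ballI)
    fix n
    show "(\<lambda>x. \<xi> n x * \<Phi> n x + (1 - \<xi> n x) * \<Phi>' n x, \<lambda>x. \<xi> n x * B n x + (1 - \<xi> n x) * B' n x) \<in> cont_minorants U"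
      using 1(1)[of n] 2(1)[of n] \<xi>(1)[of n] \<xi>(2,3)[of n] unfolding cont_minorants_def
      by (auto intro!: continuous_map_add continuous_map_real_mult continuous_map_diff minorants_convex)
    fix x assume x: "x \<in> mspace X"
    show "\<bar>\<xi> n x * \<Phi> n x + (1 - \<xi> n x) * \<Phi>' n x\<bar> \<le> \<bar>C\<bar> + \<bar>C'\<bar>"
      by (rule bd) (use 1(2)[OF x] 2(2)[OF x] \<xi>(2,3) in auto)
    show "\<bar>\<xi> n x * B n x + (1 - \<xi> n x) * B' n x\<bar> \<le> \<bar>C\<bar> + \<bar>C'\<bar>"
      by (rule bd) (use 1(2)[OF x] 2(2)[OF x] \<xi>(2,3) in auto)
  next
    show "AE x in \<kappa>. (\<lambda>n. \<xi> n x * \<Phi> n x + (1 - \<xi> n x) * \<Phi>' n x) \<longlonglongrightarrow> (if x \<in> E then \<phi> x else \<phi>' x) \<and>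
      (\<lambda>n. \<xi> n x * B n x + (1 - \<xi> n x) * B' n x) \<longlonglongrightarrow> (if x \<in> E then b x else b' x)"
      using 1(3) 2(3) \<xi>(4)
    proof eventually_elim
      case (elim x)
      have "(\<lambda>n. \<xi> n x * \<Phi> n x + (1 - \<xi> n x) * \<Phi>' n x) \<longlonglongrightarrow> indicator E x * \<phi> x + (1 - indicator E x) * \<phi>' x"
        using elim by (intro tendsto_intros) auto
      moreover have "(\<lambda>n. \<xi> n x * B n x + (1 - \<xi> n x) * B' n x) \<longlonglongrightarrow> indicator E x * b x + (1 - indicator E x) * b' x"
        using elim by (intro tendsto_intros) auto
      ultimately show ?case by (simp split: split_indicator_asm)
    qed
  qed
qed

text \<open>Dominated convergence under \<mu> and under \<nu> carries an upper bound of the dual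
  values from continuous pairs to approximable ones.\<close>

lemma approximable_value_le:
  assumes \<mu>: "\<mu> \<in> P2 X" and \<nu>: "\<nu> \<in> P2 X" and app: "approximable U \<kappa> \<phi> b"
    and ac: "\<And>Q. AE x in \<kappa>. Q x \<Longrightarrow> (AE x in \<mu>. Q x) \<and> (AE x in \<nu>. Q x)"
    and m: "\<phi> \<in> borel_measurable (borel_metric X)" "b \<in> borel_measurable (borel_metric X)"
    and S: "\<And>\<Phi> B. (\<Phi>, B) \<in> cont_minorants U \<Longrightarrow> ereal (integral\<^sup>L \<mu> \<Phi> + integral\<^sup>L \<nu> B) \<le> S"
  shows "ereal (integral\<^sup>L \<mu> \<phi> + integral\<^sup>L \<nu> b) \<le> S"
proof -
  interpret \<mu>: prob_space \<mu> using P2_D[OF \<mu>] by blast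
  interpret \<nu>: prob_space \<nu> using P2_D[OF \<nu>] by blast
  obtain \<Phi> B C where 1: "\<And>n :: nat. (\<Phi> n, B n) \<in> cont_minorants U"
    "\<And>n x. x \<in> mspace X \<Longrightarrow> \<bar>\<Phi> n x\<bar> \<le> C \<and> \<bar>B n x\<bar> \<le> C"
    "AE x in \<kappa>. (\<lambda>n. \<Phi> n x) \<longlonglongrightarrow> \<phi> x \<and> (\<lambda>n. B n x) \<longlonglongrightarrow> b x"
    using app unfolding approximable_def by blast
  have c: "continuous_map (mtopology_of X) euclideanreal (\<Phi> n)" "continuous_map (mtopology_of X) euclideanreal (B n)" for n
    using 1(1)[of n] by (auto simp: cont_minorants_def)
  have "(\<lambda>n. integral\<^sup>L \<mu> (\<Phi> n)) \<longlonglongrightarrow> integral\<^sup>L \<mu> \<phi>"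
  proof (rule integral_dominated_convergence[where w = "\<lambda>_. C"])
    show "AE x in \<mu>. (\<lambda>n. \<Phi> n x) \<longlonglongrightarrow> \<phi> x" using ac[OF 1(3)] by (auto elim: eventually_mono)
  qed (use m 1(2) borel_measurable_continuous_map[OF c(1)] in \<open>auto simp: measurable_P2[OF \<mu>] P2_D[OF \<mu>]\<close>)
  moreover have "(\<lambda>n. integral\<^sup>L \<nu> (B n)) \<longlonglongrightarrow> integral\<^sup>L \<nu> b"
  proof (rule integral_dominated_convergence[where w = "\<lambda>_. C"])
    show "AE x in \<nu>. (\<lambda>n. B n x) \<longlonglongrightarrow> b x" using ac[OF 1(3)] by (auto elim: eventually_mono)
  qed (use m 1(2) borel_measurable_continuous_map[OF c(2)] in \<open>auto simp: measurable_P2[OF \<nu>] P2_D[OF \<nu>]\<close>)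
  ultimately have "(\<lambda>n. ereal (integral\<^sup>L \<mu> (\<Phi> n) + integral\<^sup>L \<nu> (B n))) \<longlonglongrightarrow> ereal (integral\<^sup>L \<mu> \<phi> + integral\<^sup>L \<nu> b)"
    by (intro tendsto_ereal tendsto_add)
  then show ?thesis by (rule Lim_bounded[where M = 0]) (use S[OF 1(1)] in auto)
qed

text \<open>The value of the functional is approached by simple pairs \<open>(A (k n), B (k n))\<close>, where \<open>k n x\<close>
  is the index of the best of the first \<open>n\<close> minorants at \<open>x\<close>; on the singular set \<open>N\<close> only the
  slope counts.\<close>

lemma functional_le_SUP_minorants:
  assumes U: "U \<in> convex_nonlinearities" and \<mu>: "\<mu> \<in> P2 X" and \<nu>: "\<nu> \<in> P2 X"
    and dec: "lebesgue_decomposition \<nu> \<mu> \<rho> \<mu>s"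
    and S: "\<And>\<Phi> B. (\<Phi>, B) \<in> cont_minorants U \<Longrightarrow> ereal (integral\<^sup>L \<mu> \<Phi> + integral\<^sup>L \<nu> B) \<le> S"
  shows "ext_integral \<nu> (\<lambda>x. U (\<rho> x)) + U_prime_inf U * enn2ereal (emeasure \<mu>s (space \<nu>)) \<le> S"
proof -
  interpret convex_nonlinearity U by standard (rule U)
  note m = P2_D[OF \<mu>] and n = P2_D[OF \<nu>]
  interpret \<mu>: prob_space \<mu> by (fact m)
  interpret \<nu>: prob_space \<nu> by (fact n)
  have sets: "sets \<mu> = sets \<nu>" by (simp add: m n)
  obtain \<kappa> where \<kappa>: "sets \<kappa> = sets \<nu>" "\<And>B. B \<in> sets \<nu> \<Longrightarrow> emeasure \<kappa> B = emeasure \<nu> B + emeasure \<mu> B"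
    using measure_sum_exists[OF sets] by blast
  have spk: "space \<kappa> = mspace X" using sets_eq_imp_space_eq[OF \<kappa>(1)] by (simp add: n)
  have \<kappa>f: "finite_measure \<kappa>"
  proof (rule finite_measureI)
    have "emeasure \<kappa> (space \<nu>) = emeasure \<nu> (space \<nu>) + emeasure \<mu> (space \<nu>)" by (rule \<kappa>(2)) simp
    then show "emeasure \<kappa> (space \<kappa>) \<noteq> \<infinity>" by (simp add: spk n ennreal_add_eq_top)
  qed
  have \<kappa>s: "sets \<kappa> = sets (borel_metric X)" by (simp add: \<kappa> n)
  have ac: "(AE x in \<mu>. Q x) \<and> (AE x in \<nu>. Q x)" if Q: "AE x in \<kappa>. Q x" for Q
  proof -
    obtain Z where Z: "{x \<in> space \<kappa>. \<not> Q x} \<subseteq> Z" "emeasure \<kappa> Z = 0" "Z \<in> sets \<kappa>" using AE_E[OF Q] by metis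
    then have "emeasure \<nu> Z = 0" "emeasure \<mu> Z = 0" using \<kappa> by auto
    then show ?thesis using Z \<kappa>(1) sets spk by (auto intro!: AE_I[of _ _ Z] simp: m n)
  qed
  have \<rho> [measurable]: "\<rho> \<in> borel_measurable \<nu>" and \<rho>0: "\<And>x. x \<in> space \<nu> \<Longrightarrow> 0 \<le> \<rho> x" and s_sets: "sets \<mu>s = sets \<nu>"
    and sum: "\<And>B. B \<in> sets \<nu> \<Longrightarrow> emeasure \<mu> B = emeasure (density \<nu> (\<lambda>x. ennreal (\<rho> x))) B + emeasure \<mu>s B"
    using dec by (auto simp: lebesgue_decomposition_def)
  obtain N where N: "N \<in> sets \<nu>" "emeasure \<nu> N = 0" "emeasure \<mu>s (space \<nu> - N) = 0"
    using dec by (auto simp: lebesgue_decomposition_def)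
  have sps: "space \<mu>s = space \<nu>" using s_sets by (rule sets_eq_imp_space_eq)
  have "emeasure \<mu>s (space \<nu>) \<le> emeasure \<mu> (space \<nu>)" using sum[OF sets.top] by simp
  then have s_fin: "emeasure \<mu>s (space \<nu>) \<noteq> \<infinity>" by (auto simp: top_unique)
  interpret s: finite_measure \<mu>s by (rule finite_measureI) (use s_fin sps in simp)
  define d where "d = measure \<mu>s (space \<nu>)"
  have em: "enn2ereal (emeasure \<mu>s (space \<nu>)) = ereal d"
    by (simp add: d_def s.emeasure_eq_measure enn2ereal_ennreal)
  have AE_N: "AE x in \<nu>. x \<notin> N" by (rule AE_I[of _ _ N]) (use N in auto)
  have AE_s: "AE x in \<mu>s. x \<in> N" by (rule AE_I[of _ _ "space \<nu> - N"]) (use N s_sets sps in auto)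
  obtain A B :: "nat \<Rightarrow> real" where AB: "\<And>n. (A n, B n) \<in> minorants U"
    and approx: "\<And>r e. r \<ge> 0 \<Longrightarrow> e > 0 \<Longrightarrow> \<exists>n. U r - e < A n * r + B n"
    by (rule countable_minorants) (rule that)
  define better where "better n i x \<longleftrightarrow> (if x \<in> N then A i < A (Suc n) else A i * \<rho> x + B i < A (Suc n) * \<rho> x + B (Suc n))" for n i x
  define k where "k = rec_nat (\<lambda>x. 0) (\<lambda>n kn x. if better n (kn x) x then Suc n else kn x)"
  have k0: "k 0 x = 0" and kS: "k (Suc n) x = (if better n (k n x) x then Suc n else k n x)" for n x
    by (simp_all add: k_def)
  define E where "E n = {x \<in> space \<nu>. better n (k n x) x}" for n
  have [measurable]: "N \<in> sets \<nu>" by (fact N)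
  have k_meas: "k n \<in> measurable \<nu> (count_space UNIV)" and E_sets: "E n \<in> sets \<nu>" for n
  proof -
    have step: "E n \<in> sets \<nu>" if [measurable]: "k n \<in> measurable \<nu> (count_space UNIV)" for n
    proof -
      have [measurable]: "(\<lambda>x. A (k n x)) \<in> borel_measurable \<nu>" "(\<lambda>x. B (k n x)) \<in> borel_measurable \<nu>"
        by (rule measurable_compose[OF that]; simp)+
      show ?thesis unfolding E_def better_def by measurable
    qed
    show k: "k n \<in> measurable \<nu> (count_space UNIV)" for n
    proof (induction n)
      case 0
      have "k 0 = (\<lambda>x. 0)" using k0 by auto
      then show ?case by simp
    next
      case (Suc n)
      have [measurable]: "E n \<in> sets \<nu>" "k n \<in> measurable \<nu> (count_space UNIV)" using step Suc by auto
      have "(\<lambda>x. if x \<in> E n then Suc n else k n x) \<in> measurable \<nu> (count_space UNIV)" by measurable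
      then show ?case
        by (rule measurable_cong[THEN iffD1, rotated]) (auto simp: kS E_def)
    qed
    show "E n \<in> sets \<nu>" for n by (rule step[OF k])
  qed
  define \<phi> \<beta> where "\<phi> n x = A (k n x)" and "\<beta> n x = B (k n x)" for n x
  have meas [measurable]: "\<phi> n \<in> borel_measurable \<nu>" "\<beta> n \<in> borel_measurable \<nu>" for n
    unfolding \<phi>_def \<beta>_def by (rule measurable_compose[OF k_meas]; simp)+
  \<comment> \<open>Outside the space the pair is frozen at \<open>A 0\<close>, \<open>B 0\<close>:
    the sets \<open>E n\<close> lie inside the space, so switching on them reproduces the recursion
    of \<open>k\<close> only there.\<close>
  have app: "approximable U \<kappa> (\<lambda>x. if x \<in> mspace X then \<phi> n x else A 0) (\<lambda>x. if x \<in> mspace X then \<beta> n x else B 0)" for n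
  proof (induction n)
    case 0
    then show ?case using approximable_const[OF AB[of 0]] by (simp add: \<phi>_def \<beta>_def k0 cong: if_cong)
  next
    case (Suc n)
    have "approximable U \<kappa> (\<lambda>x. if x \<in> E n then A (Suc n) else if x \<in> mspace X then \<phi> n x else A 0)
       (\<lambda>x. if x \<in> E n then B (Suc n) else if x \<in> mspace X then \<beta> n x else B 0)"
      using Suc E_sets[of n] by (intro approximable_switch[OF \<kappa>f \<kappa>s approximable_const[OF AB]]) (simp_all add: n)
    moreover have "(\<lambda>x. if x \<in> E n then A (Suc n) else if x \<in> mspace X then \<phi> n x else A 0) = (\<lambda>x. if x \<in> mspace X then \<phi> (Suc n) x else A 0)"
      "(\<lambda>x. if x \<in> E n then B (Suc n) else if x \<in> mspace X then \<beta> n x else B 0) = (\<lambda>x. if x \<in> mspace X then \<beta> (Suc n) x else B 0)"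
      by (auto simp: E_def kS \<phi>_def \<beta>_def n)
    ultimately show ?case by simp
  qed
  have k_le: "k n x \<le> n" for n x
  proof (induction n)
    case (Suc n)
    then show ?case by (auto simp: kS)
  qed (simp add: k0)
  define C where "C n = (\<Sum>i\<le>n. \<bar>A i\<bar> + \<bar>B i\<bar>)" for n
  have C: "\<bar>\<phi> n x\<bar> \<le> C n" "\<bar>\<beta> n x\<bar> \<le> C n" for n x
  proof -
    have "\<bar>A (k n x)\<bar> + \<bar>B (k n x)\<bar> \<le> C n"
      unfolding C_def using k_le[of n x] by (intro member_le_sum[of "k n x" "{..n}" "\<lambda>i. \<bar>A i\<bar> + \<bar>B i\<bar>"]) auto
    then show "\<bar>\<phi> n x\<bar> \<le> C n" "\<bar>\<beta> n x\<bar> \<le> C n" by (auto simp: \<phi>_def \<beta>_def)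
  qed
  have value_le: "ereal (integral\<^sup>L \<mu> (\<phi> n) + integral\<^sup>L \<nu> (\<beta> n)) \<le> S" for n
  proof -
    have "ereal (integral\<^sup>L \<mu> (\<lambda>x. if x \<in> mspace X then \<phi> n x else A 0) + integral\<^sup>L \<nu> (\<lambda>x. if x \<in> mspace X then \<beta> n x else B 0)) \<le> S"
    proof (rule approximable_value_le[OF \<mu> \<nu> app ac _ _ S])
      show "(\<lambda>x. if x \<in> mspace X then \<phi> n x else A 0) \<in> borel_measurable (borel_metric X)"
        "(\<lambda>x. if x \<in> mspace X then \<beta> n x else B 0) \<in> borel_measurable (borel_metric X)"
        using meas[of n] unfolding measurable_P2[OF \<nu>]
        by (auto intro: measurable_cong[THEN iffD1, rotated])
    qed
    moreover have "integral\<^sup>L \<mu> (\<lambda>x. if x \<in> mspace X then \<phi> n x else A 0) = integral\<^sup>L \<mu> (\<phi> n)"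
      "integral\<^sup>L \<nu> (\<lambda>x. if x \<in> mspace X then \<beta> n x else B 0) = integral\<^sup>L \<nu> (\<beta> n)"
      by (rule Bochner_Integration.integral_cong; simp add: m n)+
    ultimately show ?thesis by simp
  qed
  define g where "g n x = \<rho> x * \<phi> n x + \<beta> n x" for n x
  have g_best: "A j * \<rho> x + B j \<le> g n x" if "x \<notin> N" "j \<le> n" for j n x
    using that(2)
  proof (induction n)
    case 0
    then show ?case by (simp add: g_def \<phi>_def \<beta>_def k0 mult.commute)
  next
    case (Suc n)
    have "g n x \<le> g (Suc n) x \<and> A (Suc n) * \<rho> x + B (Suc n) \<le> g (Suc n) x"
      using that(1) by (auto simp: g_def \<phi>_def \<beta>_def kS better_def mult.commute)
    then show ?case using Suc by (cases "j = Suc n") auto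
  qed
  \<comment> \<open>The running maximum of the slopes, which is the constant value of
    \<open>\<phi> n\<close> on the singular set.\<close>
  define a where "a n = rec_nat (A 0) (\<lambda>n an. if an < A (Suc n) then A (Suc n) else an) n" for n
  have a0: "a 0 = A 0" and aS: "a (Suc n) = max (a n) (A (Suc n))" for n by (auto simp: a_def max_def)
  have \<phi>_N: "\<phi> n x = a n" if "x \<in> N" for n x
  proof (induction n)
    case (Suc n)
    then show ?case using that by (auto simp: \<phi>_def aS kS better_def)
  qed (simp add: \<phi>_def a0 k0)
  have a_ge: "A j \<le> a n" if "j \<le> n" for j n
    using that
  proof (induction n)
    case (Suc n)
    then show ?case by (cases "j = Suc n") (auto simp: aS)
  qed (simp add: a0)
  have \<rho>_int: "integrable \<nu> \<rho>"
  proof (rule integrableI_nonneg)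
    have "(\<integral>\<^sup>+ x. ennreal (\<rho> x) \<partial>\<nu>) = emeasure (density \<nu> (\<lambda>x. ennreal (\<rho> x))) (space \<nu>)"
      by (subst emeasure_density) (auto intro!: nn_integral_cong)
    also have "\<dots> \<le> emeasure \<mu> (space \<nu>)" using sum[OF sets.top] by simp
    also have "\<dots> < \<infinity>" by (simp add: less_top[symmetric])
    finally show "(\<integral>\<^sup>+ x. ennreal (\<rho> x) \<partial>\<nu>) < \<infinity>" .
  qed (use \<rho> \<rho>0 in auto)
  have \<beta>_int: "integrable \<nu> (\<beta> n)" for n
    by (rule \<nu>.integrable_const_bound[where B = "C n"]) (use C in auto)
  have \<phi>\<mu>: "integrable \<mu> (\<phi> n)" for n
    by (rule \<mu>.integrable_const_bound[where B = "C n"]) (use C meas in \<open>auto simp: measurable_cong_sets[OF sets refl]\<close>)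
  have AE\<rho>: "AE x in \<nu>. 0 \<le> \<rho> x" using \<rho>0 by (rule AE_I2)
  have I: "integrable (density \<nu> (\<lambda>x. ennreal (\<rho> x))) (\<phi> n)"
    "integral\<^sup>L \<mu> (\<phi> n) = integral\<^sup>L (density \<nu> (\<lambda>x. ennreal (\<rho> x))) (\<phi> n) + integral\<^sup>L \<mu>s (\<phi> n)" for n
    using integral_measure_sum[of "density \<nu> (\<lambda>x. ennreal (\<rho> x))" \<mu> \<mu>s "\<phi> n"] \<phi>\<mu> sets s_sets sum by auto
  have \<rho>\<phi>: "integrable \<nu> (\<lambda>x. \<rho> x * \<phi> n x)" for n
    using I(1)[of n] by (simp add: integrable_real_density[OF \<rho> AE\<rho> meas(1)])
  have g_int: "integrable \<nu> (g n)" for n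
    unfolding g_def using \<rho>\<phi> \<beta>_int by (rule Bochner_Integration.integrable_add)
  have sing: "integral\<^sup>L \<mu>s (\<phi> n) = a n * d" for n
  proof -
    have "integral\<^sup>L \<mu>s (\<phi> n) = (\<integral>x. a n \<partial>\<mu>s)"
      by (rule integral_cong_AE) (use AE_s \<phi>_N meas in \<open>auto simp: measurable_cong_sets[OF s_sets refl] elim: eventually_mono\<close>)
    then show ?thesis by (simp add: d_def sps mult.commute)
  qed
  have val: "ereal (integral\<^sup>L \<nu> (g n) + a n * d) \<le> S" for n
  proof -
    have "integral\<^sup>L \<nu> (g n) = (\<integral>x. \<rho> x * \<phi> n x \<partial>\<nu>) + integral\<^sup>L \<nu> (\<beta> n)"
      unfolding g_def by (rule Bochner_Integration.integral_add[OF \<rho>\<phi> \<beta>_int])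
    then have "integral\<^sup>L \<mu> (\<phi> n) + integral\<^sup>L \<nu> (\<beta> n) = integral\<^sup>L \<nu> (g n) + a n * d"
      by (simp add: I(2) integral_real_density[OF \<rho> AE\<rho> meas(1)] sing)
    then show ?thesis using value_le[of n] by simp
  qed
  show ?thesis
  proof (cases S)
    case PInf
    then show ?thesis by simp
  next
    case MInf
    then show ?thesis using val[of 0] by simp
  next
    case (real s)
    have d0: "d \<ge> 0" by (simp add: d_def)
    have g_mono: "integral\<^sup>L \<nu> (g i) \<le> integral\<^sup>L \<nu> (g j)" if "i \<le> j" for i j
    proof (rule integral_mono_AE[OF g_int g_int])
      have "g i x \<le> g j x" if "x \<notin> N" for x
        using g_best[OF that, of "k i x" j] k_le[of i x] \<open>i \<le> j\<close> by (simp add: g_def[of i] \<phi>_def \<beta>_def mult.commute)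
      then show "AE x in \<nu>. g i x \<le> g j x" using AE_N by (auto elim: eventually_mono)
    qed
    \<comment> \<open>Both the integral of \<open>g n\<close> and the slope \<open>a n\<close> are
      nondecreasing in n, so the indices in the two terms can be chosen independently. The
      absolutely continuous and the singular part then pass to their limits separately.\<close>
    have bound: "integral\<^sup>L \<nu> (g n) + A j * d \<le> s" for n j
    proof -
      have "integral\<^sup>L \<nu> (g n) \<le> integral\<^sup>L \<nu> (g (max n j))" by (rule g_mono) simp
      moreover have "A j * d \<le> a (max n j) * d" using d0 by (intro mult_right_mono a_ge) auto
      ultimately show ?thesis using val[of "max n j"] real by simp
    qed
    have U_meas: "(\<lambda>x. U (\<rho> x)) \<in> borel_measurable \<nu>" using \<rho> \<rho>0 by (rule measurable_comp)
    have g0_le: "g 0 x \<le> U (\<rho> x)" if "x \<in> space \<nu>" for x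
      using minorantsD[OF AB[of 0] \<rho>0[OF that]] by (simp add: g_def \<phi>_def \<beta>_def k0 mult.commute)
    have ext: "ext_integral \<nu> (\<lambda>x. U (\<rho> x)) = ereal (integral\<^sup>L \<nu> (g 0)) + enn2ereal (\<integral>\<^sup>+ x. ennreal (U (\<rho> x) - g 0 x) \<partial>\<nu>)"
      using ext_integral_add[OF g_int[of 0], of "\<lambda>x. U (\<rho> x) - g 0 x"] U_meas g_int g0_le by auto
    have lim: "(\<lambda>n. g n x) \<longlonglongrightarrow> U (\<rho> x)" if x: "x \<in> space \<nu>" "x \<notin> N" for x
    proof (rule LIMSEQ_I)
      fix e :: real assume "e > 0"
      then obtain j where j: "U (\<rho> x) - e < A j * \<rho> x + B j" using approx \<rho>0 x by blast
      have "norm (g n x - U (\<rho> x)) < e" if "n \<ge> j" for n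
      proof -
        have "g n x \<le> U (\<rho> x)"
          using minorantsD[OF AB[of "k n x"] \<rho>0[OF x(1)]] by (simp add: g_def \<phi>_def \<beta>_def mult.commute)
        then show ?thesis using g_best[OF x(2) that] j by simp
      qed
      then show "\<exists>no. \<forall>n\<ge>no. norm (g n x - U (\<rho> x)) < e" by blast
    qed
    \<comment> \<open>Fatou's lemma for the functions g n - g 0, which are nonnegative off N and
      converge there to U(\<rho>) - g 0.\<close>
    have ext_le: "ext_integral \<nu> (\<lambda>x. U (\<rho> x)) \<le> ereal c" if c: "\<And>n. integral\<^sup>L \<nu> (g n) \<le> c" for c
    proof -
      have "(\<integral>\<^sup>+ x. ennreal (U (\<rho> x) - g 0 x) \<partial>\<nu>) = (\<integral>\<^sup>+ x. liminf (\<lambda>n. ennreal (g n x - g 0 x)) \<partial>\<nu>)"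
      proof (rule nn_integral_cong_AE)
        show "AE x in \<nu>. ennreal (U (\<rho> x) - g 0 x) = liminf (\<lambda>n. ennreal (g n x - g 0 x))"
          using AE_N AE_space
        proof eventually_elim
          case (elim x)
          have "(\<lambda>n. ennreal (g n x - g 0 x)) \<longlonglongrightarrow> ennreal (U (\<rho> x) - g 0 x)"
            by (intro tendsto_ennrealI tendsto_diff tendsto_const lim) (use elim in auto)
          then show ?case by (intro lim_imp_Liminf[symmetric]) auto
        qed
      qed
      also have "\<dots> \<le> liminf (\<lambda>n. \<integral>\<^sup>+ x. ennreal (g n x - g 0 x) \<partial>\<nu>)"
        by (rule nn_integral_liminf) (use g_int in auto)
      also have "\<dots> \<le> ennreal (c - integral\<^sup>L \<nu> (g 0))"
      proof (rule Liminf_le)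
        have "(\<integral>\<^sup>+ x. ennreal (g n x - g 0 x) \<partial>\<nu>) = ennreal (integral\<^sup>L \<nu> (g n) - integral\<^sup>L \<nu> (g 0))" for n
        proof -
          have "AE x in \<nu>. 0 \<le> g n x - g 0 x"
            using AE_N
          proof eventually_elim
            case (elim x)
            then show ?case using g_best[OF elim, of 0 n] by (simp add: g_def[of 0] \<phi>_def \<beta>_def k0 mult.commute)
          qed
          then have "(\<integral>\<^sup>+ x. ennreal (g n x - g 0 x) \<partial>\<nu>) = ennreal (\<integral>x. g n x - g 0 x \<partial>\<nu>)"
            by (intro nn_integral_eq_integral Bochner_Integration.integrable_diff g_int)
          then show ?thesis by (simp add: Bochner_Integration.integral_diff[OF g_int g_int])
        qed
        then show "\<forall>\<^sub>F n in sequentially. (\<integral>\<^sup>+ x. ennreal (g n x - g 0 x) \<partial>\<nu>) \<le> ennreal (c - integral\<^sup>L \<nu> (g 0))"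
          using c by (auto intro!: always_eventually ennreal_leI)
      qed auto
      finally have "enn2ereal (\<integral>\<^sup>+ x. ennreal (U (\<rho> x) - g 0 x) \<partial>\<nu>) \<le> enn2ereal (ennreal (c - integral\<^sup>L \<nu> (g 0)))"
        by (simp add: less_eq_ennreal.rep_eq)
      also have "\<dots> = ereal (c - integral\<^sup>L \<nu> (g 0))" using c[of 0] by (simp add: enn2ereal_ennreal)
      finally have "ext_integral \<nu> (\<lambda>x. U (\<rho> x)) \<le> ereal (integral\<^sup>L \<nu> (g 0)) + ereal (c - integral\<^sup>L \<nu> (g 0))"
        unfolding ext by (intro add_left_mono)
      then show ?thesis by simp
    qed
    have le: "ext_integral \<nu> (\<lambda>x. U (\<rho> x)) \<le> ereal (s - A j * d)" for j
      using bound[of _ j] by (intro ext_le) (simp add: algebra_simps)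
    have "ereal (integral\<^sup>L \<nu> (g 0)) \<le> ext_integral \<nu> (\<lambda>x. U (\<rho> x))"
      unfolding ext by (simp add: ereal_le_add_self enn2ereal_nonneg)
    with le[of 0] obtain i where i: "ext_integral \<nu> (\<lambda>x. U (\<rho> x)) = ereal i"
      by (cases "ext_integral \<nu> (\<lambda>x. U (\<rho> x))") auto
    show ?thesis
    \<comment> \<open>Without singular mass the slope at infinity may well be infinite. With
      positive mass d the bound forces every slope below (s - i) / d, so U'(\<infinity>) is finite
      and the product can be estimated.\<close>
    proof (cases "d = 0")
      case True
      then show ?thesis using le[of 0] real em by (simp add: zero_ereal_def[symmetric])
    next
      case False
      then have d: "d > 0" using d0 by simp
      have "A j \<le> (s - i) / d" for j using le[of j] i d by (simp add: field_simps)
      then have "(SUP j. ereal (A j)) \<le> ereal ((s - i) / d)" by (intro SUP_least) simp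
      moreover have "U_prime_inf U = (SUP j. ereal (A j))" using AB approx by (rule U_prime_inf_eq_SUP)
      ultimately have "U_prime_inf U \<le> ereal ((s - i) / d)" by simp
      then have "U_prime_inf U * ereal d \<le> ereal ((s - i) / d) * ereal d"
        using d by (intro ereal_mult_right_mono) auto
      then have "ereal i + U_prime_inf U * ereal d \<le> ereal i + ereal (s - i)"
        using d by (intro add_left_mono) simp
      then show ?thesis using i em real by simp
    qed
  qed
qed

text \<open>The right-hand side mentions only U, \<mu> and \<nu>, so the value is the same for every
  Lebesgue decomposition. For fixed U it is a supremum of expressions affine in \<mu> and \<nu>, the
  source of joint lower semicontinuity.\<close>

lemma functional_value_eq_SUP:
  assumes U: "U \<in> convex_nonlinearities" and \<mu>: "\<mu> \<in> P2 X" and \<nu>: "\<nu> \<in> P2 X"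
    and dec: "lebesgue_decomposition \<nu> \<mu> \<rho> \<mu>s"
  shows "functional_value U \<nu> \<rho> \<mu>s = (SUP (\<phi>, b)\<in>cont_minorants U. ereal (integral\<^sup>L \<mu> \<phi> + integral\<^sup>L \<nu> b))"
proof (rule antisym)
  note m = P2_D[OF \<mu>] and n = P2_D[OF \<nu>]
  interpret convex_nonlinearity U by standard (rule U)
  interpret \<mu>: prob_space \<mu> by (fact m)
  interpret \<nu>: prob_space \<nu> by (fact n)
  show "functional_value U \<nu> \<rho> \<mu>s \<le> (SUP (\<phi>, b)\<in>cont_minorants U. ereal (integral\<^sup>L \<mu> \<phi> + integral\<^sup>L \<nu> b))"
    unfolding functional_value_def
  proof (rule functional_le_SUP_minorants[OF U \<mu> \<nu> dec])
    fix \<Phi> B assume "(\<Phi>, B) \<in> cont_minorants U"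
    then show "ereal (integral\<^sup>L \<mu> \<Phi> + integral\<^sup>L \<nu> B) \<le> (SUP (\<phi>, b)\<in>cont_minorants U. ereal (integral\<^sup>L \<mu> \<phi> + integral\<^sup>L \<nu> b))"
      by (rule SUP_upper2) simp
  qed
  show "(SUP (\<phi>, b)\<in>cont_minorants U. ereal (integral\<^sup>L \<mu> \<phi> + integral\<^sup>L \<nu> b)) \<le> functional_value U \<nu> \<rho> \<mu>s"
  proof (rule SUP_least, clarify)
    fix \<phi> b assume p: "(\<phi>, b) \<in> cont_minorants U"
    then have c: "continuous_map (mtopology_of X) euclideanreal \<phi>" "continuous_map (mtopology_of X) euclideanreal b"
      by (auto simp: cont_minorants_def)
    obtain C1 where C1: "C1 > 0" "\<And>x. x \<in> mspace X \<Longrightarrow> \<bar>\<phi> x\<bar> \<le> C1"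
      using bounded_continuous[OF c(1)] by metis
    obtain C2 where C2: "C2 > 0" "\<And>x. x \<in> mspace X \<Longrightarrow> \<bar>b x\<bar> \<le> C2"
      using bounded_continuous[OF c(2)] by metis
    show "ereal (integral\<^sup>L \<mu> \<phi> + integral\<^sup>L \<nu> b) \<le> functional_value U \<nu> \<rho> \<mu>s"
      unfolding functional_value_def
    proof (rule minorant_pair_le[OF dec, where C = "max C1 C2"])
      show "\<phi> \<in> borel_measurable \<nu>" "b \<in> borel_measurable \<nu>"
        using borel_measurable_continuous_map[OF c(1)] borel_measurable_continuous_map[OF c(2)] by (simp_all add: measurable_P2[OF \<nu>])
      show "finite_measure \<mu>" "finite_measure \<nu>" by unfold_locales
      show "\<bar>\<phi> x\<bar> \<le> max C1 C2" "\<bar>b x\<bar> \<le> max C1 C2" if "x \<in> space \<nu>" for x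
        using C1(2)[of x] C2(2)[of x] that by (auto simp: n)
      show "(\<phi> x, b x) \<in> minorants U" if "x \<in> space \<nu>" for x
        using p that by (auto simp: cont_minorants_def n)
    qed (simp add: m n)
  qed
qed

end


section \<open>Mollification\<close>

context compact_metric
begin

text \<open>The choice made by \<open>SOME\<close> does not involve U, so one decomposition serves
  all functionals.\<close>

lemma U_functional_decomposition:
  assumes \<mu>: "\<mu> \<in> P2 X" and \<nu>: "\<nu> \<in> P2 X"
  obtains \<rho> \<mu>s where "lebesgue_decomposition \<nu> \<mu> \<rho> \<mu>s" "\<And>U. U_functional U \<nu> \<mu> = functional_value U \<nu> \<rho> \<mu>s"
proof -
  define p where "p = (SOME (\<rho>, \<mu>s). lebesgue_decomposition \<nu> \<mu> \<rho> \<mu>s)"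
  have fin: "finite_measure \<nu>" "finite_measure \<mu>"
    using P2_D(2)[OF \<mu>] P2_D(2)[OF \<nu>] by (simp_all add: prob_space_def)
  obtain \<rho> \<mu>s where "lebesgue_decomposition \<nu> \<mu> \<rho> \<mu>s"
    using lebesgue_decomposition_exists[OF fin] P2_D(1)[OF \<mu>] P2_D(1)[OF \<nu>] by metis
  then have "case (\<rho>, \<mu>s) of (\<rho>, \<mu>s) \<Rightarrow> lebesgue_decomposition \<nu> \<mu> \<rho> \<mu>s" by simp
  then have "case p of (\<rho>, \<mu>s) \<Rightarrow> lebesgue_decomposition \<nu> \<mu> \<rho> \<mu>s"
    unfolding p_def by (rule someI)
  then have "lebesgue_decomposition \<nu> \<mu> (fst p) (snd p)" by (simp add: case_prod_beta)
  moreover have "U_functional U \<nu> \<mu> = functional_value U \<nu> (fst p) (snd p)" for U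
    unfolding U_functional_def p_def[symmetric] functional_value_def Let_def by (simp add: case_prod_beta)
  ultimately show thesis by (rule that)
qed

lemma U_functional_eq_SUP:
  assumes "U \<in> convex_nonlinearities" "\<mu> \<in> P2 X" "\<nu> \<in> P2 X"
  shows "U_functional U \<nu> \<mu> = (SUP (\<phi>, b)\<in>cont_minorants U. ereal (integral\<^sup>L \<mu> \<phi> + integral\<^sup>L \<nu> b))"
  by (rule U_functional_decomposition[OF assms(2,3)]) (use functional_value_eq_SUP[OF assms] in simp)

lemma U_functional_eq_value:
  assumes "U \<in> convex_nonlinearities" "\<mu> \<in> P2 X" "\<nu> \<in> P2 X" "lebesgue_decomposition \<nu> \<mu> \<rho> \<mu>s"
  shows "U_functional U \<nu> \<mu> = functional_value U \<nu> \<rho> \<mu>s"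
  using U_functional_eq_SUP[OF assms(1-3)] functional_value_eq_SUP[OF assms] by simp

lemma minorant_pair_le_U_functional:
  assumes U: "U \<in> convex_nonlinearities" and \<mu>: "\<mu> \<in> P2 X" and \<nu>: "\<nu> \<in> P2 X"
    and m: "\<phi> \<in> borel_measurable (borel_metric X)" "b \<in> borel_measurable (borel_metric X)"
    and bd: "\<And>x. x \<in> mspace X \<Longrightarrow> \<bar>\<phi> x\<bar> \<le> C" "\<And>x. x \<in> mspace X \<Longrightarrow> \<bar>b x\<bar> \<le> C"
    and min: "\<And>x. x \<in> mspace X \<Longrightarrow> (\<phi> x, b x) \<in> minorants U"
  shows "ereal (integral\<^sup>L \<mu> \<phi> + integral\<^sup>L \<nu> b) \<le> U_functional U \<nu> \<mu>"
proof -
  interpret convex_nonlinearity U by standard (rule U)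
  obtain \<rho> \<mu>s where dec: "lebesgue_decomposition \<nu> \<mu> \<rho> \<mu>s" "\<And>U. U_functional U \<nu> \<mu> = functional_value U \<nu> \<rho> \<mu>s"
    by (rule U_functional_decomposition[OF \<mu> \<nu>]) (rule that)
  show ?thesis
    unfolding dec(2) functional_value_def
  proof (rule minorant_pair_le[OF dec(1), where C = C])
    show "finite_measure \<nu>" "finite_measure \<mu>"
      using P2_D(2)[OF \<mu>] P2_D(2)[OF \<nu>] by (simp_all add: prob_space_def)
  qed (use m bd min in \<open>simp_all add: P2_D[OF \<mu>] P2_D[OF \<nu>] measurable_P2[OF \<nu>]\<close>)
qed

lemma U_functional_not_MInf:
  assumes "U \<in> convex_nonlinearities" "\<mu> \<in> P2 X" "\<nu> \<in> P2 X"
  shows "U_functional U \<nu> \<mu> \<noteq> -\<infinity>"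
proof -
  interpret convex_nonlinearity U by standard (rule assms)
  obtain a where ab: "(a, U 1 - a * 1) \<in> minorants U" using tangent zero_less_one by blast
  define b where "b = U 1 - a * 1"
  have "ereal (integral\<^sup>L \<mu> (\<lambda>_. a) + integral\<^sup>L \<nu> (\<lambda>_. b)) \<le> U_functional U \<nu> \<mu>"
    by (rule minorant_pair_le_U_functional[OF assms, where C = "max \<bar>a\<bar> \<bar>b\<bar>"]) (use ab in \<open>auto simp: b_def\<close>)
  then show ?thesis by auto
qed

lemma density_in_P2:
  assumes \<nu>: "\<nu> \<in> P2 X" and m: "\<rho> \<in> borel_measurable (borel_metric X)"
    and \<rho>: "\<And>x. x \<in> mspace X \<Longrightarrow> 0 \<le> \<rho> x" "integrable \<nu> \<rho>" "integral\<^sup>L \<nu> \<rho> = 1"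
  shows "density \<nu> (\<lambda>x. ennreal (\<rho> x)) \<in> P2 X"
proof -
  have "emeasure (density \<nu> (\<lambda>x. ennreal (\<rho> x))) (space \<nu>) = (\<integral>\<^sup>+ x. ennreal (\<rho> x) \<partial>\<nu>)"
    using m by (subst emeasure_density) (auto simp: measurable_P2[OF \<nu>] intro!: nn_integral_cong)
  also have "\<dots> = 1"
    using nn_integral_eq_integral[OF \<rho>(2) AE_I2] \<rho>(1,3) by (simp add: P2_D[OF \<nu>])
  finally have "prob_space (density \<nu> (\<lambda>x. ennreal (\<rho> x)))" by (intro prob_spaceI) simp
  then show ?thesis by (simp add: P2_def P2_D[OF \<nu>])
qed

lemma integral_density_P2:
  fixes \<phi> :: "'a \<Rightarrow> real"
  assumes \<nu>: "\<nu> \<in> P2 X" and m: "\<rho> \<in> borel_measurable (borel_metric X)" "\<phi> \<in> borel_measurable (borel_metric X)"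
    and \<rho>: "\<And>x. x \<in> mspace X \<Longrightarrow> 0 \<le> \<rho> x"
  shows "integral\<^sup>L (density \<nu> (\<lambda>x. ennreal (\<rho> x))) \<phi> = (\<integral>x. \<rho> x * \<phi> x \<partial>\<nu>)"
  using assms by (intro integral_real_density AE_I2) (auto simp: measurable_P2[OF \<nu>] P2_D[OF \<nu>])

lemma bounded_U_comp:
  assumes U: "U \<in> convex_nonlinearities"
  obtains B where "\<And>r. 0 \<le> r \<Longrightarrow> r \<le> C \<Longrightarrow> \<bar>U r\<bar> \<le> B"
proof -
  interpret convex_nonlinearity U by standard (rule U)
  have "compact (U ` {0..C})"
    using U_cont by (intro compact_continuous_image) (auto elim: continuous_on_subset)
  then have "bounded (U ` {0..C})" by (rule compact_imp_bounded)
  then obtain B where "\<forall>y\<in>U ` {0..C}. \<bar>y\<bar> \<le> B" by (auto simp: bounded_iff)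
  then show thesis by (intro that[of B]) auto
qed

lemma U_functional_density:
  assumes U: "U \<in> convex_nonlinearities" and \<nu>: "\<nu> \<in> P2 X" and m: "\<rho> \<in> borel_measurable (borel_metric X)"
    and \<rho>: "\<And>x. x \<in> mspace X \<Longrightarrow> 0 \<le> \<rho> x" "\<And>x. x \<in> mspace X \<Longrightarrow> \<rho> x \<le> C"
    and P: "density \<nu> (\<lambda>x. ennreal (\<rho> x)) \<in> P2 X"
  shows "integrable \<nu> (\<lambda>x. U (\<rho> x))"
    and "U_functional U \<nu> (density \<nu> (\<lambda>x. ennreal (\<rho> x))) = ereal (\<integral>x. U (\<rho> x) \<partial>\<nu>)"
proof -
  interpret convex_nonlinearity U by standard (rule U)
  obtain B where B: "\<And>r. 0 \<le> r \<Longrightarrow> r \<le> C \<Longrightarrow> \<bar>U r\<bar> \<le> B" using bounded_U_comp[OF U, of C] by metis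
  show i: "integrable \<nu> (\<lambda>x. U (\<rho> x))"
  proof (rule integrable_bounded[OF \<nu>])
    show "(\<lambda>x. U (\<rho> x)) \<in> borel_measurable (borel_metric X)"
      using m \<rho>(1) by (intro measurable_comp) auto
    show "\<bar>U (\<rho> x)\<bar> \<le> B" if "x \<in> mspace X" for x using \<rho>[OF that] by (rule B)
  qed
  have "lebesgue_decomposition \<nu> (density \<nu> (\<lambda>x. ennreal (\<rho> x))) \<rho> (null_measure \<nu>)"
    unfolding lebesgue_decomposition_def using m \<rho>(1)
    by (auto simp: measurable_P2[OF \<nu>] P2_D[OF \<nu>] intro!: bexI[of _ "{}"])
  then have "U_functional U \<nu> (density \<nu> (\<lambda>x. ennreal (\<rho> x))) = functional_value U \<nu> \<rho> (null_measure \<nu>)"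
    by (rule U_functional_eq_value[OF U P \<nu>])
  then show "U_functional U \<nu> (density \<nu> (\<lambda>x. ennreal (\<rho> x))) = ereal (\<integral>x. U (\<rho> x) \<partial>\<nu>)"
    by (simp add: functional_value_def ext_integral_integrable[OF i] zero_ennreal.rep_eq)
qed

text \<open>A point outside the support has a null open neighbourhood, and this contains a small
  ball around a net point that still contains the given point. Only countably many such balls exist,
  so S is covered by a countable union of null sets.\<close>

lemma emeasure_compl_support:
  assumes \<mu>: "\<mu> \<in> P2 X" and O: "openin (mtopology_of X) S" "S \<inter> measure_support X \<mu> = {}"
  shows "emeasure \<mu> S = 0"
proof -
  have "\<exists>K. finite K \<and> K \<subseteq> mspace X \<and> (\<forall>x\<in>mspace X. \<exists>y\<in>K. mdist X y x < inverse (Suc m))" for m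
    by (rule finite_net[of "inverse (Suc m)"]) auto
  then obtain K where K: "\<And>m. finite (K m)" "\<And>m. K m \<subseteq> mspace X"
    "\<And>m x. x \<in> mspace X \<Longrightarrow> \<exists>y\<in>K m. mdist X y x < inverse (real (Suc m))" by metis
  define I where "I = {(m, y). y \<in> K m \<and> emeasure \<mu> (mball y (inverse (Suc m))) = 0}"
  have "countable (SIGMA m:UNIV. K m)"
    using K(1) by (intro countable_SIGMA) (auto intro: countable_finite)
  then have cI: "countable I" by (rule countable_subset[rotated]) (auto simp: I_def)
  have ball: "mball y r \<in> sets \<mu>" for y r
    by (simp add: P2_D[OF \<mu>] openin_in_sets_borel_metric mtopology_eq)
  have "(\<Union>(m, y)\<in>I. mball y (inverse (Suc m))) \<in> null_sets \<mu>"
    using cI ball by (intro null_sets_UN') (auto simp: I_def)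
  moreover have "S \<subseteq> (\<Union>(m, y)\<in>I. mball y (inverse (Suc m)))"
  proof
    fix x assume x: "x \<in> S"
    have xX: "x \<in> mspace X" using x openin_subset[OF O(1)] by auto
    have "x \<notin> measure_support X \<mu>" using x O(2) by blast
    with xX obtain T where T: "openin (mtopology_of X) T" "x \<in> T" "emeasure \<mu> T = 0"
      by (auto simp: measure_support_def zero_less_iff_neq_zero)
    then obtain r where r: "r > 0" "mball x r \<subseteq> T" by (auto simp: mtopology_eq openin_mtopology)
    obtain m where m: "inverse (real (Suc m)) < r / 2" using reals_Archimedean[of "r / 2"] r by auto
    obtain y where y: "y \<in> K m" "mdist X y x < inverse (real (Suc m))" using K(3)[OF xX] by blast
    have yX: "y \<in> mspace X" using y K by auto
    have "mball y (inverse (real (Suc m))) \<subseteq> T"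
    proof
      fix z assume "z \<in> mball y (inverse (real (Suc m)))"
      then have z: "z \<in> mspace X" "mdist X y z < inverse (real (Suc m))" by auto
      have "mdist X x z \<le> mdist X y x + mdist X y z" by (rule triangle''[OF xX yX z(1)])
      then show "z \<in> T" using r(2) z y m xX by auto
    qed
    then have "emeasure \<mu> (mball y (inverse (real (Suc m)))) = 0"
      using T(3) emeasure_mono[of "mball y (inverse (real (Suc m)))" T \<mu>] T(1)
      by (simp add: P2_D[OF \<mu>] openin_in_sets_borel_metric)
    then have "(m, y) \<in> I" using y by (simp add: I_def)
    moreover have "x \<in> mball y (inverse (real (Suc m)))" using y xX yX by simp
    ultimately show "x \<in> (\<Union>(m, y)\<in>I. mball y (inverse (Suc m)))" by blast
  qed
  moreover have "S \<in> sets \<mu>" using O(1) by (simp add: P2_D[OF \<mu>] openin_in_sets_borel_metric)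
  ultimately show ?thesis using null_sets_subset by blast
qed

text \<open>The density is \<open>\<Sum>\<^sub>j \<xi>\<^sub>j \<integral>\<xi>\<^sub>j d\<mu> / \<integral>\<xi>\<^sub>j d\<nu>\<close> for a partition of unity
  \<open>\<xi>\<close> into functions of small support. By Jensen's inequality this averaging does not increase
  the functional.\<close>

lemma mollify:
  assumes \<mu>: "\<mu> \<in> P2 X" and \<nu>: "\<nu> \<in> P2 X" and supp: "measure_support X \<mu> \<subseteq> measure_support X \<nu>" and "\<delta> > 0"
  obtains \<rho> where "continuous_map (mtopology_of X) euclideanreal \<rho>" "\<And>x. x \<in> mspace X \<Longrightarrow> 0 \<le> \<rho> x"
    "density \<nu> (\<lambda>x. ennreal (\<rho> x)) \<in> P2 X"
    "\<And>U. U \<in> convex_nonlinearities \<Longrightarrow> U_functional U \<nu> (density \<nu> (\<lambda>x. ennreal (\<rho> x))) \<le> U_functional U \<nu> \<mu>"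
    "\<And>\<phi> \<eta>. \<lbrakk>continuous_map (mtopology_of X) euclideanreal \<phi>;
        \<forall>x\<in>mspace X. \<forall>y\<in>mspace X. mdist X x y < \<delta> \<longrightarrow> \<bar>\<phi> x - \<phi> y\<bar> \<le> \<eta>\<rbrakk>
      \<Longrightarrow> \<bar>integral\<^sup>L (density \<nu> (\<lambda>x. ennreal (\<rho> x))) \<phi> - integral\<^sup>L \<mu> \<phi>\<bar> \<le> 2 * \<eta>"
proof -
  interpret \<mu>: prob_space \<mu> using P2_D[OF \<mu>] by blast
  interpret \<nu>: prob_space \<nu> using P2_D[OF \<nu>] by blast
  obtain K where K: "finite K" "K \<subseteq> mspace X" "\<And>x. x \<in> mspace X \<Longrightarrow> \<exists>y\<in>K. mdist X y x < \<delta>"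
    using finite_net[OF \<open>\<delta> > 0\<close>] by metis
  \<comment> \<open>Tent functions at the net points. At each point of the space one of them is
    positive, so dividing by their sum gives a partition of unity subordinate to the
    \<delta>-balls.\<close>
  define h where "h y x = max 0 (\<delta> - mdist X y x)" for y x
  define H where "H x = (\<Sum>y\<in>K. h y x)" for x
  define \<xi> where "\<xi> y x = h y x / H x" for y x
  have h_cont: "continuous_map (mtopology_of X) euclideanreal (h y)" if "y \<in> K" for y
  proof -
    have "y \<in> mspace X" using that K by auto
    then show ?thesis
      unfolding h_def by (intro continuous_map_real_max continuous_map_diff mdist_continuous) auto
  qed
  have H_cont: "continuous_map (mtopology_of X) euclideanreal H"
    unfolding H_def using h_cont K(1) by (intro continuous_map_sum) auto
  have h0: "0 \<le> h y x" for y x by (simp add: h_def)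
  have H_pos: "H x > 0" if x: "x \<in> mspace X" for x
  proof -
    obtain y where y: "y \<in> K" "mdist X y x < \<delta>" using K(3)[OF x] by blast
    have "0 < h y x" using y by (simp add: h_def)
    also have "\<dots> \<le> H x" unfolding H_def using K(1) y h0 by (intro member_le_sum) auto
    finally show ?thesis .
  qed
  have \<xi>_cont: "continuous_map (mtopology_of X) euclideanreal (\<xi> y)" if "y \<in> K" for y
  proof -
    have "H x \<noteq> 0" if "x \<in> topspace (mtopology_of X)" for x using H_pos[of x] that by simp
    then show ?thesis
      unfolding \<xi>_def using h_cont[OF that] H_cont by (intro continuous_map_real_divide) auto
  qed
  have \<xi>0: "0 \<le> \<xi> y x" if "x \<in> mspace X" for y x using H_pos[OF that] h0[of y x] by (simp add: \<xi>_def)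
  have \<xi>_sum: "(\<Sum>y\<in>K. \<xi> y x) = 1" if "x \<in> mspace X" for x
    using H_pos[OF that] by (simp add: \<xi>_def sum_divide_distrib[symmetric] H_def[symmetric])
  have \<xi>_supp: "mdist X x y < \<delta>" if "\<xi> y x \<noteq> 0" for x y
    using that by (auto simp: \<xi>_def h_def commute[of x y] max_def split: if_splits)
  have int: "integrable M f" if "M \<in> P2 X" "continuous_map (mtopology_of X) euclideanreal f" for M f
    by (rule integrable_continuous[OF that])
  define m n where "m y = integral\<^sup>L \<mu> (\<xi> y)" and "n y = integral\<^sup>L \<nu> (\<xi> y)" for y
  have m0: "0 \<le> m y" and n0: "0 \<le> n y" for y
    unfolding m_def n_def by (auto intro!: integral_nonneg_AE AE_I2 \<xi>0 simp: P2_D[OF \<mu>] P2_D[OF \<nu>])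
  have sum_int: "(\<Sum>y\<in>K. integral\<^sup>L M (\<xi> y)) = 1" if M: "M \<in> P2 X" for M
  proof -
    have "(\<Sum>y\<in>K. integral\<^sup>L M (\<xi> y)) = (\<integral>x. (\<Sum>y\<in>K. \<xi> y x) \<partial>M)"
      using int[OF M \<xi>_cont] by (intro Bochner_Integration.integral_sum[symmetric]) auto
    also have "\<dots> = (\<integral>x. 1 \<partial>M)"
      using \<xi>_sum P2_D(3)[OF M] by (intro Bochner_Integration.integral_cong) auto
    also have "\<dots> = 1" using prob_space.prob_space[OF P2_D(2)[OF M]] by simp
    finally show ?thesis .
  qed
  have m_sum: "(\<Sum>y\<in>K. m y) = 1" and n_sum: "(\<Sum>y\<in>K. n y) = 1"
    unfolding m_def n_def by (rule sum_int[OF \<mu>], rule sum_int[OF \<nu>])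
  \<comment> \<open>Here the support hypothesis enters. If \<xi> y has \<nu>-integral 0, the open
    set where it is positive misses the support of \<nu>, hence that of \<mu>, and is \<mu>-null. So
    the convention x / 0 = 0 in the density loses no mass.\<close>
  have m_zero: "m y = 0" if y: "y \<in> K" "n y = 0" for y
  proof -
    define S where "S = {x \<in> topspace (mtopology_of X). \<xi> y x \<in> {0<..}}"
    have S: "openin (mtopology_of X) S"
      unfolding S_def by (rule openin_continuous_map_preimage[OF \<xi>_cont[OF y(1)]]) auto
    have "AE x in \<nu>. \<xi> y x = 0"
      using y(2) integral_nonneg_eq_0_iff_AE[OF int[OF \<nu> \<xi>_cont[OF y(1)]] AE_I2] \<xi>0
      by (simp add: n_def P2_D[OF \<nu>])
    then have "AE x in \<nu>. x \<notin> S" by (auto simp: S_def elim: eventually_mono)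
    then have "emeasure \<nu> S = 0"
      using openin_in_sets_borel_metric[OF S] openin_subset[OF S]
      by (subst (asm) AE_iff_measurable[of S]) (auto simp: P2_D[OF \<nu>])
    then have "S \<inter> measure_support X \<nu> = {}" using S by (auto simp: measure_support_def)
    then have "emeasure \<mu> S = 0" using supp by (intro emeasure_compl_support[OF \<mu> S]) blast
    then have "AE x in \<mu>. x \<notin> S"
      using openin_in_sets_borel_metric[OF S] by (intro AE_not_in) (auto simp: null_sets_def P2_D[OF \<mu>])
    then have "AE x in \<mu>. \<xi> y x = 0"
      using AE_space
    proof eventually_elim
      case (elim x)
      then show ?case using \<xi>0[of x y] by (auto simp: S_def P2_D[OF \<mu>])
    qed
    then show ?thesis unfolding m_def by (rule integral_eq_zero_AE)
  qed
  define \<rho> where "\<rho> x = (\<Sum>y\<in>K. \<xi> y x * (m y / n y))" for x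
  have \<rho>_cont: "continuous_map (mtopology_of X) euclideanreal \<rho>"
    unfolding \<rho>_def using \<xi>_cont K(1) by (intro continuous_map_sum continuous_map_real_mult) auto
  have \<rho>0: "0 \<le> \<rho> x" if "x \<in> mspace X" for x
    unfolding \<rho>_def using \<xi>0[OF that] m0 n0 by (intro sum_nonneg mult_nonneg_nonneg divide_nonneg_nonneg) auto
  obtain C where C: "C > 0" "\<And>x. x \<in> mspace X \<Longrightarrow> \<bar>\<rho> x\<bar> \<le> C" using bounded_continuous[OF \<rho>_cont] by metis
  have \<rho>m: "\<rho> \<in> borel_measurable (borel_metric X)" by (rule borel_measurable_continuous_map[OF \<rho>_cont])
  have weighted: "(\<integral>x. \<rho> x * f x \<partial>\<nu>) = (\<Sum>y\<in>K. (m y / n y) * (\<integral>x. \<xi> y x * f x \<partial>\<nu>))"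
    if f: "continuous_map (mtopology_of X) euclideanreal f" for f
  proof -
    have i: "integrable \<nu> (\<lambda>x. \<xi> y x * f x)" if "y \<in> K" for y
      by (rule int[OF \<nu> continuous_map_real_mult[OF \<xi>_cont[OF that] f]])
    have "(\<integral>x. \<rho> x * f x \<partial>\<nu>) = (\<integral>x. (\<Sum>y\<in>K. (m y / n y) * (\<xi> y x * f x)) \<partial>\<nu>)"
      by (rule Bochner_Integration.integral_cong) (auto simp: \<rho>_def sum_distrib_right sum_distrib_left mult_ac)
    also have "\<dots> = (\<Sum>y\<in>K. \<integral>x. (m y / n y) * (\<xi> y x * f x) \<partial>\<nu>)"
      by (rule Bochner_Integration.integral_sum) (rule integrable_mult_right, rule i)
    finally show ?thesis by simp
  qed
  have "(\<integral>x. \<rho> x * 1 \<partial>\<nu>) = (\<Sum>y\<in>K. (m y / n y) * n y)"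
    using weighted[of "\<lambda>_. 1"] by (simp add: n_def)
  also have "\<dots> = (\<Sum>y\<in>K. m y)" using m_zero by (intro sum.cong) auto
  finally have \<rho>1: "integral\<^sup>L \<nu> \<rho> = 1" by (simp add: m_sum)
  have P: "density \<nu> (\<lambda>x. ennreal (\<rho> x)) \<in> P2 X"
    using \<rho>0 \<rho>1 \<rho>m int[OF \<nu> \<rho>_cont] by (intro density_in_P2[OF \<nu>])
  show thesis
  proof (rule that[OF \<rho>_cont \<rho>0 P])
    fix U assume U: "U \<in> convex_nonlinearities"
    interpret convex_nonlinearity U by standard (rule U)
    show "U_functional U \<nu> (density \<nu> (\<lambda>x. ennreal (\<rho> x))) \<le> U_functional U \<nu> \<mu>"
    proof (rule ereal_le_epsilon2)
      fix e :: real assume e: "e > 0"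
      have r0: "0 \<le> m y / n y" for y using m0 n0 by simp
      \<comment> \<open>The quotient can be 0, where U may have no supporting line of finite slope;
        hence minorants that are optimal only up to e.\<close>
      have "\<forall>y. \<exists>p. p \<in> minorants U \<and> U (m y / n y) - e < fst p * (m y / n y) + snd p"
        using minorant_approx[OF r0 e] by (metis fst_conv snd_conv)
      then obtain p where p: "\<And>y. p y \<in> minorants U" "\<And>y. U (m y / n y) - e < fst (p y) * (m y / n y) + snd (p y)"
        by metis
      define a b where "a y = fst (p y)" and "b y = snd (p y)" for y
      have ab: "(a y, b y) \<in> minorants U" "U (m y / n y) - e \<le> a y * (m y / n y) + b y" for y
        using p[of y] by (auto simp: a_def b_def)
      \<comment> \<open>The dual competitor blends these nearly optimal lines with the partition of
        unity. Its dual value is the sum of the terms n y (a y (m y / n y) + b y), within e of the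
        sum of n y U(m y / n y), which by Jensen dominates the functional of the averaged
        density.\<close>
      define \<phi> \<beta> where "\<phi> x = (\<Sum>y\<in>K. \<xi> y x * a y)" and "\<beta> x = (\<Sum>y\<in>K. \<xi> y x * b y)" for x
      have c: "continuous_map (mtopology_of X) euclideanreal \<phi>" "continuous_map (mtopology_of X) euclideanreal \<beta>"
        unfolding \<phi>_def \<beta>_def using \<xi>_cont K(1) by (auto intro!: continuous_map_sum continuous_map_real_mult)
      have pair: "(\<phi>, \<beta>) \<in> cont_minorants U"
        unfolding cont_minorants_def using c
        by (auto simp: \<phi>_def \<beta>_def intro!: minorants_sum K(1) ab \<xi>0 \<xi>_sum)
      have "ereal (integral\<^sup>L \<mu> \<phi> + integral\<^sup>L \<nu> \<beta>) \<le> U_functional U \<nu> \<mu>"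
        unfolding U_functional_eq_SUP[OF U \<mu> \<nu>] by (rule SUP_upper2[OF pair]) simp
      moreover have "integral\<^sup>L \<mu> \<phi> = (\<Sum>y\<in>K. m y * a y)" "integral\<^sup>L \<nu> \<beta> = (\<Sum>y\<in>K. n y * b y)"
        unfolding \<phi>_def \<beta>_def m_def n_def
        using int[OF \<mu> \<xi>_cont] int[OF \<nu> \<xi>_cont] by (simp_all add: Bochner_Integration.integral_sum)
      moreover have "(\<integral>x. U (\<rho> x) \<partial>\<nu>) \<le> (\<Sum>y\<in>K. m y * a y) + (\<Sum>y\<in>K. n y * b y) + e"
      proof -
        have "(\<integral>x. U (\<rho> x) \<partial>\<nu>) \<le> (\<integral>x. (\<Sum>y\<in>K. \<xi> y x * U (m y / n y)) \<partial>\<nu>)"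
        proof (rule integral_mono)
          show "integrable \<nu> (\<lambda>x. U (\<rho> x))"
            using C by (intro U_functional_density(1)[OF U \<nu> \<rho>m \<rho>0 _ P, of C]) (auto simp: abs_le_iff)
          show "integrable \<nu> (\<lambda>x. \<Sum>y\<in>K. \<xi> y x * U (m y / n y))"
            using int[OF \<nu> \<xi>_cont] by (intro Bochner_Integration.integrable_sum integrable_mult_left) auto
          fix x assume "x \<in> space \<nu>"
          then have x: "x \<in> mspace X" by (simp add: P2_D[OF \<nu>])
          have "K \<noteq> {}" using \<xi>_sum[OF x] by auto
          then show "U (\<rho> x) \<le> (\<Sum>y\<in>K. \<xi> y x * U (m y / n y))"
            using convex_on_sum[OF K(1) _ U_convex \<xi>_sum[OF x] \<xi>0[OF x], of "\<lambda>y. m y / n y"] r0 by (simp add: \<rho>_def)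
        qed
        also have "\<dots> = (\<Sum>y\<in>K. n y * U (m y / n y))"
          unfolding n_def using int[OF \<nu> \<xi>_cont] by (simp add: Bochner_Integration.integral_sum)
        also have "\<dots> \<le> (\<Sum>y\<in>K. n y * (a y * (m y / n y) + b y + e))"
        proof (intro sum_mono mult_left_mono n0)
          show "U (m y / n y) \<le> a y * (m y / n y) + b y + e" for y using ab(2)[of y] by linarith
        qed
        also have "\<dots> = (\<Sum>y\<in>K. m y * a y + n y * b y + n y * e)"
        proof (rule sum.cong[OF refl])
          fix y assume "y \<in> K"
          then show "n y * (a y * (m y / n y) + b y + e) = m y * a y + n y * b y + n y * e"
            using m_zero[of y] by (cases "n y = 0") (simp_all add: field_simps)
        qed
        also have "\<dots> = (\<Sum>y\<in>K. m y * a y) + (\<Sum>y\<in>K. n y * b y) + e"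
          by (simp add: sum.distrib sum_distrib_right[symmetric] n_sum)
        finally show ?thesis .
      qed
      moreover have "U_functional U \<nu> (density \<nu> (\<lambda>x. ennreal (\<rho> x))) = ereal (\<integral>x. U (\<rho> x) \<partial>\<nu>)"
        using C by (intro U_functional_density(2)[OF U \<nu> \<rho>m \<rho>0 _ P, of C]) (auto simp: abs_le_iff)
      ultimately show "U_functional U \<nu> (density \<nu> (\<lambda>x. ennreal (\<rho> x))) \<le> U_functional U \<nu> \<mu> + ereal e"
        by (cases "U_functional U \<nu> \<mu>") auto
    qed
  next
    fix \<phi> \<eta> assume \<phi>: "continuous_map (mtopology_of X) euclideanreal \<phi>"
      and osc: "\<forall>x\<in>mspace X. \<forall>y\<in>mspace X. mdist X x y < \<delta> \<longrightarrow> \<bar>\<phi> x - \<phi> y\<bar> \<le> \<eta>"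
    have local: "\<bar>(\<integral>x. \<xi> y x * \<phi> x \<partial>M) - \<phi> y * integral\<^sup>L M (\<xi> y)\<bar> \<le> \<eta> * integral\<^sup>L M (\<xi> y)"
      if y: "y \<in> K" and M: "M \<in> P2 X" for y M
    proof -
      have i1: "integrable M (\<lambda>x. \<xi> y x * \<phi> x)"
        by (rule int[OF M continuous_map_real_mult[OF \<xi>_cont[OF y] \<phi>]])
      have i2: "integrable M (\<xi> y)" by (rule int[OF M \<xi>_cont[OF y]])
      have "(\<integral>x. \<xi> y x * \<phi> x \<partial>M) - \<phi> y * integral\<^sup>L M (\<xi> y) = (\<integral>x. \<xi> y x * \<phi> x - \<phi> y * \<xi> y x \<partial>M)"
        using i1 i2 by simp
      also have "\<bar>\<dots>\<bar> \<le> (\<integral>x. \<bar>\<xi> y x * \<phi> x - \<phi> y * \<xi> y x\<bar> \<partial>M)" by (rule integral_abs_bound)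
      also have "\<dots> \<le> (\<integral>x. \<eta> * \<xi> y x \<partial>M)"
      proof (rule integral_mono)
        fix x assume "x \<in> space M"
        then have x: "x \<in> mspace X" by (simp add: P2_D[OF M])
        show "\<bar>\<xi> y x * \<phi> x - \<phi> y * \<xi> y x\<bar> \<le> \<eta> * \<xi> y x"
        proof (cases "\<xi> y x = 0")
          case False
          have "\<bar>\<phi> x - \<phi> y\<bar> \<le> \<eta>" using osc \<xi>_supp[OF False] x y K(2) by auto
          then have "\<xi> y x * \<bar>\<phi> x - \<phi> y\<bar> \<le> \<xi> y x * \<eta>" using \<xi>0[OF x] by (intro mult_left_mono)
          moreover have "\<bar>\<xi> y x * \<phi> x - \<phi> y * \<xi> y x\<bar> = \<xi> y x * \<bar>\<phi> x - \<phi> y\<bar>"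
          proof -
            have "\<xi> y x * \<phi> x - \<phi> y * \<xi> y x = \<xi> y x * (\<phi> x - \<phi> y)" by (simp add: algebra_simps)
            then show ?thesis using \<xi>0[OF x, of y] by (simp add: abs_mult)
          qed
          ultimately show ?thesis by (simp add: mult.commute)
        qed simp
      qed (use i1 i2 in auto)
      finally show ?thesis using i2 by simp
    qed
    have eq1: "integral\<^sup>L (density \<nu> (\<lambda>x. ennreal (\<rho> x))) \<phi> = (\<Sum>y\<in>K. (m y / n y) * (\<integral>x. \<xi> y x * \<phi> x \<partial>\<nu>))"
      using integral_density_P2[OF \<nu> \<rho>m borel_measurable_continuous_map[OF \<phi>] \<rho>0] weighted[OF \<phi>] by simp
    have "integral\<^sup>L \<mu> \<phi> = (\<integral>x. (\<Sum>y\<in>K. \<xi> y x * \<phi> x) \<partial>\<mu>)"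
      using \<xi>_sum by (intro Bochner_Integration.integral_cong) (simp_all add: P2_D[OF \<mu>] sum_distrib_right[symmetric])
    also have "\<dots> = (\<Sum>y\<in>K. \<integral>x. \<xi> y x * \<phi> x \<partial>\<mu>)"
      by (rule Bochner_Integration.integral_sum) (rule int[OF \<mu> continuous_map_real_mult[OF \<xi>_cont \<phi>]])
    finally have eq2: "integral\<^sup>L \<mu> \<phi> = (\<Sum>y\<in>K. \<integral>x. \<xi> y x * \<phi> x \<partial>\<mu>)" .
    have "\<bar>integral\<^sup>L (density \<nu> (\<lambda>x. ennreal (\<rho> x))) \<phi> - integral\<^sup>L \<mu> \<phi>\<bar>
       \<le> (\<Sum>y\<in>K. \<bar>(m y / n y) * (\<integral>x. \<xi> y x * \<phi> x \<partial>\<nu>) - (\<integral>x. \<xi> y x * \<phi> x \<partial>\<mu>)\<bar>)"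
      unfolding eq1 eq2 sum_subtractf[symmetric] by (rule sum_abs)
    \<comment> \<open>Both terms are compared with \<phi>(y) m y; each comparison costs at most
      \<eta> m y because \<phi> varies by at most \<eta> on the support of \<xi> y.\<close>
    also have "\<dots> \<le> (\<Sum>y\<in>K. 2 * \<eta> * m y)"
    proof (rule sum_mono)
      fix y assume y: "y \<in> K"
      have "\<bar>(m y / n y) * (\<integral>x. \<xi> y x * \<phi> x \<partial>\<nu>) - \<phi> y * m y\<bar> \<le> \<eta> * m y"
      proof (cases "n y = 0")
        case True
        then show ?thesis using m_zero[OF y] by simp
      next
        case False
        have "\<phi> y * m y = (m y / n y) * (\<phi> y * n y)" using False by simp
        then have "\<bar>(m y / n y) * (\<integral>x. \<xi> y x * \<phi> x \<partial>\<nu>) - \<phi> y * m y\<bar>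
            = \<bar>(m y / n y) * ((\<integral>x. \<xi> y x * \<phi> x \<partial>\<nu>) - \<phi> y * n y)\<bar>"
          by (simp only: right_diff_distrib)
        also have "\<dots> = (m y / n y) * \<bar>(\<integral>x. \<xi> y x * \<phi> x \<partial>\<nu>) - \<phi> y * n y\<bar>"
          using m0[of y] n0[of y] by (simp add: abs_mult)
        also have "\<dots> \<le> (m y / n y) * (\<eta> * n y)"
          using local[OF y \<nu>] m0[of y] n0[of y] by (intro mult_left_mono) (auto simp: n_def)
        also have "\<dots> = \<eta> * m y" using False by simp
        finally show ?thesis .
      qed
      moreover have "\<bar>(\<integral>x. \<xi> y x * \<phi> x \<partial>\<mu>) - \<phi> y * m y\<bar> \<le> \<eta> * m y"
        using local[OF y \<mu>] by (simp add: m_def)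
      ultimately show "\<bar>(m y / n y) * (\<integral>x. \<xi> y x * \<phi> x \<partial>\<nu>) - (\<integral>x. \<xi> y x * \<phi> x \<partial>\<mu>)\<bar> \<le> 2 * \<eta> * m y"
        by linarith
    qed
    also have "\<dots> = 2 * \<eta>" by (simp add: sum_distrib_left[symmetric] m_sum)
    finally show "\<bar>integral\<^sup>L (density \<nu> (\<lambda>x. ennreal (\<rho> x))) \<phi> - integral\<^sup>L \<mu> \<phi>\<bar> \<le> 2 * \<eta>" .
  qed
qed

end


section \<open>Stability\<close>

text \<open>The common form of the two curvature conditions for fixed end points, with
  \<open>lam\<close> zero in the finite-dimensional case. The geodesic is quantified before U and
  t.\<close>

definition displacement_convex ::
    "(real \<Rightarrow> real) set \<Rightarrow> ((real \<Rightarrow> real) \<Rightarrow> ereal) \<Rightarrow> 'a metric \<Rightarrow> 'a measure \<Rightarrow> 'a measure \<Rightarrow> 'a measure \<Rightarrow> bool" where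
  "displacement_convex F lam X \<nu> \<mu>0 \<mu>1 \<longleftrightarrow>
    (\<exists>\<mu>. wasserstein_geodesic X \<mu>0 \<mu>1 \<mu> \<and>
      (\<forall>U\<in>F. \<forall>t\<in>{0..1}.
         U_functional U \<nu> (\<mu> t)
           \<le> ereal t * U_functional U \<nu> \<mu>1 + ereal (1 - t) * U_functional U \<nu> \<mu>0
             - ereal (1 / 2) * lam U * ereal (t * (1 - t) * (W2 X \<mu>0 \<mu>1)\<^sup>2)))"

lemma distr_P2_GH:
  assumes "GH_approximation \<epsilon> X Y f" "\<mu> \<in> P2 X"
  shows "distr \<mu> (borel_metric Y) f \<in> P2 Y"
  using assms P2_D[OF assms(2)] by (intro distr_in_P2) (auto simp: GH_approximation_def measurable_P2[OF assms(2)])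

lemma integral_distr_P2:
  fixes \<phi> :: "'b \<Rightarrow> real"
  assumes "f \<in> measurable (borel_metric X) (borel_metric Y)" "\<mu> \<in> P2 X" "\<phi> \<in> borel_measurable (borel_metric Y)"
  shows "integral\<^sup>L (distr \<mu> (borel_metric Y) f) \<phi> = (\<integral>x. \<phi> (f x) \<partial>\<mu>)"
  using assms by (intro integral_distr) (auto simp: measurable_P2[OF assms(2)])

text \<open>Serves both passages to the limit: along the spaces \<open>X n\<close>, and along
  mollified end points on the constant space Y with the identity map. The end points enter through
  upper bounds whose errors e n tend to 0 and may depend on U; the subsequence comes from the
  geodesics alone and is the same for all U.\<close>

lemma displacement_convex_limit:
  fixes X :: "nat \<Rightarrow> 'a metric" and Y :: "'b metric"
  assumes Y: "compact_metric Y" and X: "\<And>n. compact_metric (X n)"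
    and \<nu>: "\<And>n. \<nu> n \<in> P2 (X n)" and \<nu>': "\<nu>' \<in> P2 Y"
    and GH: "\<And>n. GH_approximation (\<epsilon> n) (X n) Y (f n)" and \<epsilon>: "\<epsilon> \<longlonglongrightarrow> 0"
    and w\<nu>: "weak_star_converges Y (\<lambda>n. distr (\<nu> n) (borel_metric Y) (f n)) \<nu>'"
    and \<alpha>: "\<And>n. \<alpha> n \<in> P2 (X n)" and \<beta>: "\<And>n. \<beta> n \<in> P2 (X n)"
    and \<mu>0: "\<mu>0 \<in> P2 Y" and \<mu>1: "\<mu>1 \<in> P2 Y"
    and w\<alpha>: "weak_star_converges Y (\<lambda>n. distr (\<alpha> n) (borel_metric Y) (f n)) \<mu>0"
    and w\<beta>: "weak_star_converges Y (\<lambda>n. distr (\<beta> n) (borel_metric Y) (f n)) \<mu>1"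
    and dc: "\<And>n. displacement_convex F lam (X n) (\<nu> n) (\<alpha> n) (\<beta> n)"
    and F: "F \<subseteq> convex_nonlinearities" and lam: "\<And>U. U \<in> F \<Longrightarrow> lam U \<noteq> \<infinity>"
    and e\<alpha>: "\<And>U. U \<in> F \<Longrightarrow> \<exists>e. e \<longlonglongrightarrow> 0 \<and> (\<forall>n. U_functional U (\<nu> n) (\<alpha> n) \<le> U_functional U \<nu>' \<mu>0 + ereal (e n))"
    and e\<beta>: "\<And>U. U \<in> F \<Longrightarrow> \<exists>e. e \<longlonglongrightarrow> 0 \<and> (\<forall>n. U_functional U (\<nu> n) (\<beta> n) \<le> U_functional U \<nu>' \<mu>1 + ereal (e n))"
  shows "displacement_convex F lam Y \<nu>' \<mu>0 \<mu>1"
proof -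
  interpret Y: compact_metric Y by fact
  have fm: "f n \<in> measurable (borel_metric (X n)) (borel_metric Y)" for n
    using GH[of n] by (simp add: GH_approximation_def)
  have "\<forall>n. \<exists>\<gamma>. wasserstein_geodesic (X n) (\<alpha> n) (\<beta> n) \<gamma> \<and> (\<forall>U\<in>F. \<forall>t\<in>{0..1}.
      U_functional U (\<nu> n) (\<gamma> t) \<le> ereal t * U_functional U (\<nu> n) (\<beta> n) + ereal (1 - t) * U_functional U (\<nu> n) (\<alpha> n)
        - ereal (1 / 2) * lam U * ereal (t * (1 - t) * (W2 (X n) (\<alpha> n) (\<beta> n))\<^sup>2))"
    using dc unfolding displacement_convex_def by blast
  then obtain \<gamma> where geo: "\<And>n. wasserstein_geodesic (X n) (\<alpha> n) (\<beta> n) (\<gamma> n)"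
    and ineq: "\<And>n U t. U \<in> F \<Longrightarrow> t \<in> {0..1} \<Longrightarrow>
      U_functional U (\<nu> n) (\<gamma> n t) \<le> ereal t * U_functional U (\<nu> n) (\<beta> n) + ereal (1 - t) * U_functional U (\<nu> n) (\<alpha> n)
        - ereal (1 / 2) * lam U * ereal (t * (1 - t) * (W2 (X n) (\<alpha> n) (\<beta> n))\<^sup>2)"
    by metis
  define D where "D n = W2 (X n) (\<alpha> n) (\<beta> n)" for n
  have \<gamma>: "\<gamma> n t \<in> P2 (X n)" if "t \<in> {0..1}" for n t
    using geo[of n] that by (simp add: wasserstein_geodesic_def)
  have \<gamma>W: "W2 (X n) (\<gamma> n s) (\<gamma> n t) = \<bar>s - t\<bar> * D n" if "s \<in> {0..1}" "t \<in> {0..1}" for n s t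
    using geo[of n] that by (simp add: wasserstein_geodesic_def D_def)
  have \<gamma>01: "\<gamma> n 0 = \<alpha> n" "\<gamma> n 1 = \<beta> n" for n using geo[of n] by (simp_all add: wasserstein_geodesic_def)
  define \<sigma> where "\<sigma> n t = distr (\<gamma> n t) (borel_metric Y) (f n)" for n t
  have \<sigma>: "\<sigma> n t \<in> P2 Y" if "t \<in> {0..1}" for n t
    unfolding \<sigma>_def by (rule distr_P2_GH[OF GH \<gamma>[OF that]])
  have approx: "\<bar>W2 Y (\<sigma> n s) (\<sigma> n t) - \<bar>s - t\<bar> * D n\<bar> \<le> \<epsilon> n" if "s \<in> {0..1}" "t \<in> {0..1}" for n s t
    using W2_GH_approximation[OF X Y GH \<gamma>[OF that(1)] \<gamma>[OF that(2)]] unfolding \<gamma>W[OF that] \<sigma>_def .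
  have lim0: "(\<lambda>n. W2 Y (\<sigma> n 0) \<mu>0) \<longlonglongrightarrow> 0"
    using Y.W2_if_weak_star[OF distr_P2_GH[OF GH \<alpha>] \<mu>0 w\<alpha>] by (simp add: \<sigma>_def \<gamma>01)
  have lim1: "(\<lambda>n. W2 Y (\<sigma> n 1) \<mu>1) \<longlonglongrightarrow> 0"
    using Y.W2_if_weak_star[OF distr_P2_GH[OF GH \<beta>] \<mu>1 w\<beta>] by (simp add: \<sigma>_def \<gamma>01)
  obtain r \<mu> where r: "strict_mono (r :: nat \<Rightarrow> nat)" and g\<mu>: "wasserstein_geodesic Y \<mu>0 \<mu>1 \<mu>"
    and \<mu>lim: "\<And>t. t \<in> {0..1} \<Longrightarrow> (\<lambda>n. W2 Y (\<sigma> (r n) t) (\<mu> t)) \<longlonglongrightarrow> 0" and D: "D \<longlonglongrightarrow> W2 Y \<mu>0 \<mu>1"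
    using Y.wasserstein_geodesic_limit[OF \<sigma> approx \<epsilon> \<mu>0 \<mu>1 lim0 lim1] by blast
  have \<mu>: "\<mu> t \<in> P2 Y" if "t \<in> {0..1}" for t using g\<mu> that by (simp add: wasserstein_geodesic_def)
  have \<mu>01: "\<mu> 0 = \<mu>0" "\<mu> 1 = \<mu>1" using g\<mu> by (simp_all add: wasserstein_geodesic_def)
  have "U_functional U \<nu>' (\<mu> t) \<le> ereal t * U_functional U \<nu>' \<mu>1 + ereal (1 - t) * U_functional U \<nu>' \<mu>0
        - ereal (1 / 2) * lam U * ereal (t * (1 - t) * (W2 Y \<mu>0 \<mu>1)\<^sup>2)" if UF: "U \<in> F" and t: "t \<in> {0..1}" for U t
  proof -
    have U: "U \<in> convex_nonlinearities" using UF F by blast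
    interpret convex_nonlinearity U by standard (rule U)
    have nM: "U_functional U \<nu>' \<mu>0 \<noteq> -\<infinity>" "U_functional U \<nu>' \<mu>1 \<noteq> -\<infinity>"
      using Y.U_functional_not_MInf[OF U _ \<nu>'] \<mu>0 \<mu>1 by auto
    \<comment> \<open>At the end times one weight is 0 and \<open>0 * \<infinity> = 0\<close>, so
      the claim is an equality. At interior times an infinite end value makes the right-hand side
      infinite, since the correction term Z is not \<infinity>.\<close>
    consider "t = 0" | "t = 1" | "0 < t" "t < 1" using t by fastforce
    then show ?thesis
    proof cases
      case 1
      then show ?thesis by (simp add: \<mu>01 zero_ereal_def[symmetric] one_ereal_def[symmetric])
    next
      case 2
      then show ?thesis by (simp add: \<mu>01 zero_ereal_def[symmetric] one_ereal_def[symmetric])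
    next
      case 3
      define Z where "Z = ereal (1 / 2) * lam U * ereal (t * (1 - t) * (W2 Y \<mu>0 \<mu>1)\<^sup>2)"
      have c0: "0 \<le> t * (1 - t) * (W2 Y \<mu>0 \<mu>1)\<^sup>2" using 3 by simp
      have Z: "Z \<noteq> \<infinity>"
        using lam[OF UF] c0 3 by (cases "lam U") (auto simp: Z_def)
      show ?thesis
      proof (cases "U_functional U \<nu>' \<mu>0 = \<infinity> \<or> U_functional U \<nu>' \<mu>1 = \<infinity>")
        case True
        then have inf: "ereal t * U_functional U \<nu>' \<mu>1 + ereal (1 - t) * U_functional U \<nu>' \<mu>0 = \<infinity>"
          using nM 3 by (cases "U_functional U \<nu>' \<mu>0"; cases "U_functional U \<nu>' \<mu>1") auto
        show ?thesis unfolding Z_def[symmetric] inf using Z by (cases Z) auto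
      next
        case False
        obtain u0 where u0: "U_functional U \<nu>' \<mu>0 = ereal u0" using False nM by (cases "U_functional U \<nu>' \<mu>0") auto
        obtain u1 where u1: "U_functional U \<nu>' \<mu>1 = ereal u1" using False nM by (cases "U_functional U \<nu>' \<mu>1") auto
        show ?thesis
        \<comment> \<open>If \<open>lam U\<close> is -\<infinity>, the correction vanishes at
          distance 0 but may be infinite along the sequence, so no limit can be taken. At distance 0
          the geodesic is constant and the claim is immediate; at positive distance this
          \<open>lam\<close> makes the right-hand side infinite.\<close>
        proof (cases "W2 Y \<mu>0 \<mu>1 = 0")
          case True
          then have "\<mu>0 = \<mu>1" by (rule Y.W2_eq_0[OF \<mu>0 \<mu>1])
          have "W2 Y (\<mu> t) (\<mu> 0) = \<bar>t - 0\<bar> * W2 Y \<mu>0 \<mu>1"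
            using g\<mu> t unfolding wasserstein_geodesic_def by (meson atLeastAtMost_iff order_refl zero_le_one)
          then have "W2 Y (\<mu> t) (\<mu> 0) = 0" using True by simp
          then have "\<mu> t = \<mu>0" using Y.W2_eq_0[OF \<mu>[OF t] \<mu>0] \<mu>01 by simp
          then show ?thesis using u0 u1 True \<open>\<mu>0 = \<mu>1\<close>
            by (simp add: zero_ereal_def[symmetric] algebra_simps)
        next
          case False
          show ?thesis
          proof (cases "lam U")
            case MInf
            have "0 < t * (1 - t) * (W2 Y \<mu>0 \<mu>1)\<^sup>2" using False 3 by simp
            then have "Z = -\<infinity>" using MInf False 3 by (simp add: Z_def)
            then show ?thesis unfolding Z_def[symmetric] u0 u1 by simp
          next
            case PInf
            then show ?thesis using lam[OF UF] by simp
          next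
            case (real l)
            obtain e0 where e0: "e0 \<longlonglongrightarrow> 0" "\<And>n. U_functional U (\<nu> n) (\<alpha> n) \<le> U_functional U \<nu>' \<mu>0 + ereal (e0 n)"
              using e\<alpha>[OF UF] by blast
            obtain e1 where e1: "e1 \<longlonglongrightarrow> 0" "\<And>n. U_functional U (\<nu> n) (\<beta> n) \<le> U_functional U \<nu>' \<mu>1 + ereal (e1 n)"
              using e\<beta>[OF UF] by blast
            define q where "q n = t * (u1 + e1 n) + (1 - t) * (u0 + e0 n) - 1 / 2 * l * (t * (1 - t) * (D n)\<^sup>2)" for n
            have q: "U_functional U (\<nu> n) (\<gamma> n t) \<le> ereal (q n)" for n
            proof -
              have "ereal t * U_functional U (\<nu> n) (\<beta> n) \<le> ereal t * ereal (u1 + e1 n)"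
                using e1(2)[of n] 3 by (intro ereal_mult_left_mono) (auto simp: u1)
              moreover have "ereal (1 - t) * U_functional U (\<nu> n) (\<alpha> n) \<le> ereal (1 - t) * ereal (u0 + e0 n)"
                using e0(2)[of n] 3 by (intro ereal_mult_left_mono) (auto simp: u0)
              ultimately have "ereal t * U_functional U (\<nu> n) (\<beta> n) + ereal (1 - t) * U_functional U (\<nu> n) (\<alpha> n)
                  - ereal (1 / 2) * lam U * ereal (t * (1 - t) * (D n)\<^sup>2)
                \<le> ereal t * ereal (u1 + e1 n) + ereal (1 - t) * ereal (u0 + e0 n)
                  - ereal (1 / 2) * lam U * ereal (t * (1 - t) * (D n)\<^sup>2)"
                by (intro ereal_minus_mono add_mono order_refl)
              also have "\<dots> = ereal (q n)" by (simp add: q_def real)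
              finally show ?thesis using ineq[OF UF t, of n] by (simp add: D_def)
            qed
            have "q \<longlonglongrightarrow> t * (u1 + 0) + (1 - t) * (u0 + 0) - 1 / 2 * l * (t * (1 - t) * (W2 Y \<mu>0 \<mu>1)\<^sup>2)"
              unfolding q_def using e0(1) e1(1) D by (intro tendsto_intros)
            then have qlim: "(\<lambda>n. q (r n)) \<longlonglongrightarrow> t * u1 + (1 - t) * u0 - 1 / 2 * l * (t * (1 - t) * (W2 Y \<mu>0 \<mu>1)\<^sup>2)"
              using LIMSEQ_subseq_LIMSEQ[OF _ r] by (fastforce simp: comp_def)
            \<comment> \<open>Lower semicontinuity and comparison under push-forward in one step: a
              single continuous pair is pulled back along \<open>f n\<close>, bounded by the
              functional on \<open>X n\<close>, and sent to the limit, where its dual value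
              converges by weak convergence. The supremum over pairs is taken last.\<close>
            have "U_functional U \<nu>' (\<mu> t) \<le> ereal (t * u1 + (1 - t) * u0 - 1 / 2 * l * (t * (1 - t) * (W2 Y \<mu>0 \<mu>1)\<^sup>2))"
              unfolding Y.U_functional_eq_SUP[OF U \<mu>[OF t] \<nu>']
            proof (rule SUP_least, clarify)
              fix \<phi> b assume pair: "(\<phi>, b) \<in> Y.cont_minorants U"
              then have c: "continuous_map (mtopology_of Y) euclideanreal \<phi>" "continuous_map (mtopology_of Y) euclideanreal b"
                and mn: "\<And>y. y \<in> mspace Y \<Longrightarrow> (\<phi> y, b y) \<in> minorants U"
                by (auto simp: Y.cont_minorants_def)
              note cm = borel_measurable_continuous_map[OF c(1)] borel_measurable_continuous_map[OF c(2)]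
              obtain C1 where C1: "C1 > 0" "\<And>y. y \<in> mspace Y \<Longrightarrow> \<bar>\<phi> y\<bar> \<le> C1"
                using Y.bounded_continuous[OF c(1)] by metis
              obtain C2 where C2: "C2 > 0" "\<And>y. y \<in> mspace Y \<Longrightarrow> \<bar>b y\<bar> \<le> C2"
                using Y.bounded_continuous[OF c(2)] by metis
              define p where "p n = integral\<^sup>L (\<sigma> n t) \<phi> + integral\<^sup>L (distr (\<nu> n) (borel_metric Y) (f n)) b" for n
              have "ereal (p n) \<le> U_functional U (\<nu> n) (\<gamma> n t)" for n
              proof -
                have fX: "f n x \<in> mspace Y" if "x \<in> mspace (X n)" for x
                  using measurable_space[OF fm, of x n] that by simp
                have "ereal (integral\<^sup>L (\<gamma> n t) (\<lambda>x. \<phi> (f n x)) + integral\<^sup>L (\<nu> n) (\<lambda>x. b (f n x))) \<le> U_functional U (\<nu> n) (\<gamma> n t)"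
                proof (rule compact_metric.minorant_pair_le_U_functional[OF X U \<gamma>[OF t] \<nu>, where C = "max C1 C2"])
                  show "(\<lambda>x. \<phi> (f n x)) \<in> borel_measurable (borel_metric (X n))" "(\<lambda>x. b (f n x)) \<in> borel_measurable (borel_metric (X n))"
                    using measurable_compose[OF fm cm(1)] measurable_compose[OF fm cm(2)] .
                  show "\<bar>\<phi> (f n x)\<bar> \<le> max C1 C2" "\<bar>b (f n x)\<bar> \<le> max C1 C2" if "x \<in> mspace (X n)" for x
                    using C1(2)[OF fX[OF that]] C2(2)[OF fX[OF that]] by auto
                  show "(\<phi> (f n x), b (f n x)) \<in> minorants U" if "x \<in> mspace (X n)" for x
                    by (rule mn[OF fX[OF that]])
                qed
                then show ?thesis
                  unfolding p_def \<sigma>_def integral_distr_P2[OF fm \<gamma>[OF t] cm(1)] integral_distr_P2[OF fm \<nu> cm(2)] .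
              qed
              then have "ereal (p n) \<le> ereal (q n)" for n using q[of n] order_trans by blast
              then have pq: "p (r n) \<le> q (r n)" for n by simp
              have "weak_star_converges Y (\<lambda>n. \<sigma> (r n) t) (\<mu> t)"
                using \<sigma>[OF t] \<mu>[OF t] \<mu>lim[OF t] by (rule Y.weak_star_if_W2)
              then have p1: "(\<lambda>n. integral\<^sup>L (\<sigma> (r n) t) \<phi>) \<longlonglongrightarrow> integral\<^sup>L (\<mu> t) \<phi>"
                using c(1) by (simp add: weak_star_converges_def)
              have "(\<lambda>n. integral\<^sup>L (distr (\<nu> n) (borel_metric Y) (f n)) b) \<longlonglongrightarrow> integral\<^sup>L \<nu>' b"
                using w\<nu> c(2) by (simp add: weak_star_converges_def)
              from LIMSEQ_subseq_LIMSEQ[OF this r]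
              have p2: "(\<lambda>n. integral\<^sup>L (distr (\<nu> (r n)) (borel_metric Y) (f (r n))) b) \<longlonglongrightarrow> integral\<^sup>L \<nu>' b"
                by (simp add: comp_def)
              have "(\<lambda>n. p (r n)) \<longlonglongrightarrow> integral\<^sup>L (\<mu> t) \<phi> + integral\<^sup>L \<nu>' b"
                unfolding p_def by (rule tendsto_add[OF p1 p2])
              from LIMSEQ_le[OF this qlim] pq
              show "ereal (integral\<^sup>L (\<mu> t) \<phi> + integral\<^sup>L \<nu>' b)
                \<le> ereal (t * u1 + (1 - t) * u0 - 1 / 2 * l * (t * (1 - t) * (W2 Y \<mu>0 \<mu>1)\<^sup>2))"
                by auto
            qed
            then show ?thesis by (simp add: u0 u1 real)
          qed
        qed
      qed
    qed
  qed
  with g\<mu> show ?thesis unfolding displacement_convex_def by blast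
qed

text \<open>The pulled-back density has mass c n instead of 1, hence the division. Since U(\<rho>)
  is continuous on Y, its integral converges along the push-forwards of \<nu> n, and uniform
  continuity of U on [0, 2R] absorbs the factor 1 / c n. The bound c n > 1/2 is what keeps the
  normalised densities inside that interval.\<close>

lemma pullback_density:
  fixes X :: "nat \<Rightarrow> 'a metric" and Y :: "'b metric"
  assumes Y: "compact_metric Y" and X: "\<And>n. compact_metric (X n)"
    and \<nu>: "\<And>n. \<nu> n \<in> P2 (X n)" and \<nu>': "\<nu>' \<in> P2 Y"
    and fm: "\<And>n. f n \<in> measurable (borel_metric (X n)) (borel_metric Y)"
    and w\<nu>: "weak_star_converges Y (\<lambda>n. distr (\<nu> n) (borel_metric Y) (f n)) \<nu>'"
    and \<rho>_cont: "continuous_map (mtopology_of Y) euclideanreal \<rho>" and \<rho>_nonneg: "\<forall>y\<in>mspace Y. 0 \<le> \<rho> y"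
    and P: "density \<nu>' (\<lambda>y. ennreal (\<rho> y)) \<in> P2 Y"
    and c: "\<And>n. c n = (\<integral>x. \<rho> (f n x) \<partial>\<nu> n)" "\<And>n. c n > 1/2" "c \<longlonglongrightarrow> 1"
    and \<alpha>: "\<And>n. \<alpha> n = density (\<nu> n) (\<lambda>x. ennreal (\<rho> (f n x) / c n))"
  shows "\<alpha> n \<in> P2 (X n)" "measure_support (X n) (\<alpha> n) \<subseteq> measure_support (X n) (\<nu> n)"
    "weak_star_converges Y (\<lambda>n. distr (\<alpha> n) (borel_metric Y) (f n)) (density \<nu>' (\<lambda>y. ennreal (\<rho> y)))"
    "U \<in> convex_nonlinearities \<Longrightarrow> \<exists>e. e \<longlonglongrightarrow> 0 \<and>
      (\<forall>n. U_functional U (\<nu> n) (\<alpha> n) \<le> U_functional U \<nu>' (density \<nu>' (\<lambda>y. ennreal (\<rho> y))) + ereal (e n))"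
proof -
  interpret Y: compact_metric Y by fact
  interpret X: compact_metric "X n" for n by fact
  note \<rho> = \<rho>_cont \<rho>_nonneg[rule_format]
  note \<rho>m = borel_measurable_continuous_map[OF \<rho>(1)]
  obtain R where R: "R > 0" "\<And>y. y \<in> mspace Y \<Longrightarrow> \<bar>\<rho> y\<bar> \<le> R" using Y.bounded_continuous[OF \<rho>(1)] by metis
  have fX: "f n x \<in> mspace Y" if "x \<in> mspace (X n)" for n x
    using measurable_space[OF fm, of x n] that by simp
  have cp: "c n > 0" for n using c(2)[of n] by simp
  have m1: "(\<lambda>x. \<rho> (f n x)) \<in> borel_measurable (borel_metric (X n))" for n
    by (rule measurable_compose[OF fm \<rho>m])
  have m2: "(\<lambda>x. \<rho> (f n x) / c n) \<in> borel_measurable (borel_metric (X n))" for n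
    by (rule borel_measurable_divide[OF m1]) simp
  have i1: "integrable (\<nu> n) (\<lambda>x. \<rho> (f n x))" for n
    by (rule X.integrable_bounded[OF \<nu> m1]) (use R(2) fX in auto)
  have d0: "0 \<le> \<rho> (f n x) / c n" if "x \<in> mspace (X n)" for n x
    using \<rho>(2)[OF fX[OF that]] cp[of n] by simp
  have d2: "\<rho> (f n x) / c n \<le> 2 * R" if "x \<in> mspace (X n)" for n x
  proof -
    have "\<rho> (f n x) \<le> R * 1" using R(2)[OF fX[OF that]] by simp
    also have "\<dots> \<le> R * (2 * c n)" using c(2)[of n] R(1) by (intro mult_left_mono) auto
    finally show ?thesis using cp[of n] by (simp add: field_simps)
  qed
  show \<alpha>P: "\<alpha> n \<in> P2 (X n)" for n
    unfolding \<alpha>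
  proof (rule X.density_in_P2[OF \<nu> m2 d0])
    show "integrable (\<nu> n) (\<lambda>x. \<rho> (f n x) / c n)" using i1 by simp
    show "(\<integral>x. \<rho> (f n x) / c n \<partial>\<nu> n) = 1" using c(1)[of n] cp[of n] by simp
  qed
  show "measure_support (X n) (\<alpha> n) \<subseteq> measure_support (X n) (\<nu> n)" for n
  proof
    fix x assume x: "x \<in> measure_support (X n) (\<alpha> n)"
    have "emeasure (\<nu> n) S > 0" if S: "openin (mtopology_of (X n)) S" "x \<in> S" for S
    proof (rule ccontr)
      assume "\<not> emeasure (\<nu> n) S > 0"
      then have "S \<in> null_sets (\<nu> n)"
        using openin_in_sets_borel_metric[OF S(1)] by (simp add: null_sets_def P2_D[OF \<nu>])
      moreover have "absolutely_continuous (\<nu> n) (\<alpha> n)"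
        unfolding \<alpha> using m2 by (intro absolutely_continuousI_density) (simp add: measurable_P2[OF \<nu>])
      ultimately have "emeasure (\<alpha> n) S = 0" by (auto simp: absolutely_continuous_def)
      then show False using x S by (auto simp: measure_support_def)
    qed
    then show "x \<in> measure_support (X n) (\<nu> n)" using x by (auto simp: measure_support_def)
  qed
  have lim: "(\<lambda>n. \<integral>x. \<phi> (f n x) \<partial>\<nu> n) \<longlonglongrightarrow> integral\<^sup>L \<nu>' \<phi>" if \<phi>: "continuous_map (mtopology_of Y) euclideanreal \<phi>" for \<phi>
    using w\<nu>[unfolded weak_star_converges_def, rule_format, OF \<phi>]
    by (simp add: integral_distr_P2[OF fm \<nu> borel_measurable_continuous_map[OF \<phi>]])
  show "weak_star_converges Y (\<lambda>n. distr (\<alpha> n) (borel_metric Y) (f n)) (density \<nu>' (\<lambda>y. ennreal (\<rho> y)))"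
    unfolding weak_star_converges_def
  proof (intro allI impI)
    fix \<phi> assume \<phi>: "continuous_map (mtopology_of Y) euclideanreal \<phi>"
    note \<phi>m = borel_measurable_continuous_map[OF \<phi>]
    have "integral\<^sup>L (distr (\<alpha> n) (borel_metric Y) (f n)) \<phi> = (\<integral>x. \<rho> (f n x) * \<phi> (f n x) \<partial>\<nu> n) / c n" for n
    proof -
      have "integral\<^sup>L (distr (\<alpha> n) (borel_metric Y) (f n)) \<phi> = (\<integral>x. \<phi> (f n x) \<partial>\<alpha> n)"
        by (rule integral_distr_P2[OF fm \<alpha>P \<phi>m])
      also have "\<dots> = (\<integral>x. \<rho> (f n x) / c n * \<phi> (f n x) \<partial>\<nu> n)"
        unfolding \<alpha> by (rule X.integral_density_P2[OF \<nu> m2 measurable_compose[OF fm \<phi>m] d0])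
      finally show ?thesis by simp
    qed
    moreover have "(\<lambda>n. (\<integral>x. \<rho> (f n x) * \<phi> (f n x) \<partial>\<nu> n) / c n) \<longlonglongrightarrow> (\<integral>y. \<rho> y * \<phi> y \<partial>\<nu>') / 1"
      by (rule tendsto_divide[OF lim[OF continuous_map_real_mult[OF \<rho>(1) \<phi>]] c(3)]) simp
    ultimately show "(\<lambda>n. integral\<^sup>L (distr (\<alpha> n) (borel_metric Y) (f n)) \<phi>) \<longlonglongrightarrow> integral\<^sup>L (density \<nu>' (\<lambda>y. ennreal (\<rho> y))) \<phi>"
      by (simp add: Y.integral_density_P2[OF \<nu>' \<rho>m \<phi>m \<rho>(2)])
  qed
  assume U: "U \<in> convex_nonlinearities"
  interpret convex_nonlinearity U by standard (rule U)
  \<comment> \<open>Extends U from the half-line to a continuous function on the line, so that its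
    composition with \<rho> is a test function on Y.\<close>
  define V where "V r = U (max 0 r)" for r
  have V_cont: "continuous_on UNIV V"
    unfolding V_def by (rule continuous_on_compose2[OF U_cont]) (auto intro!: continuous_intros)
  have V\<rho>: "continuous_map (mtopology_of Y) euclideanreal (\<lambda>y. V (\<rho> y))"
    using continuous_map_compose[OF \<rho>(1), of euclideanreal V] V_cont by (simp add: comp_def)
  have U1: "U_functional U (\<nu> n) (\<alpha> n) = ereal (\<integral>x. U (\<rho> (f n x) / c n) \<partial>\<nu> n)"
    and iU1: "integrable (\<nu> n) (\<lambda>x. U (\<rho> (f n x) / c n))" for n
    using X.U_functional_density[OF U \<nu> m2 d0 d2] \<alpha>P[of n] unfolding \<alpha> by auto
  have U2: "U_functional U \<nu>' (density \<nu>' (\<lambda>y. ennreal (\<rho> y))) = ereal (\<integral>y. U (\<rho> y) \<partial>\<nu>')"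
    by (rule Y.U_functional_density(2)[OF U \<nu>' \<rho>m \<rho>(2) _ P, of R]) (use R(2) in \<open>auto simp: abs_le_iff\<close>)
  have V_eq: "(\<integral>y. V (\<rho> y) \<partial>\<nu>') = (\<integral>y. U (\<rho> y) \<partial>\<nu>')"
    by (rule Bochner_Integration.integral_cong) (auto simp: V_def P2_D[OF \<nu>'] \<rho>(2) max_def antisym)
  have iV: "integrable (\<nu> n) (\<lambda>x. V (\<rho> (f n x)))" for n
  proof -
    obtain B where B: "\<And>r. 0 \<le> r \<Longrightarrow> r \<le> R \<Longrightarrow> \<bar>U r\<bar> \<le> B" using Y.bounded_U_comp[OF U, of R] by metis
    show ?thesis
    proof (rule X.integrable_bounded[OF \<nu>])
      show "(\<lambda>x. V (\<rho> (f n x))) \<in> borel_measurable (borel_metric (X n))"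
        by (rule measurable_compose[OF fm borel_measurable_continuous_map[OF V\<rho>]])
      show "\<bar>V (\<rho> (f n x))\<bar> \<le> B" if "x \<in> mspace (X n)" for x
        unfolding V_def using R(2)[OF fX[OF that]] \<rho>(2)[OF fX[OF that]] by (intro B) auto
    qed
  qed
  \<comment> \<open>The error caused by normalisation alone; what remains is the weak convergence
    error for the test function V(\<rho>).\<close>
  define e1 where "e1 n = (\<integral>x. U (\<rho> (f n x) / c n) \<partial>\<nu> n) - (\<integral>x. V (\<rho> (f n x)) \<partial>\<nu> n)" for n
  have "e1 \<longlonglongrightarrow> 0"
  proof (rule LIMSEQ_I)
    fix \<eta> :: real assume "\<eta> > 0"
    have "uniformly_continuous_on {0..2 * R} U"
      using U_cont by (intro compact_uniformly_continuous) (auto elim: continuous_on_subset)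
    then obtain d where d: "d > 0" "\<And>r s. r \<in> {0..2 * R} \<Longrightarrow> s \<in> {0..2 * R} \<Longrightarrow> dist s r < d \<Longrightarrow> dist (U s) (U r) < \<eta> / 2"
      using \<open>\<eta> > 0\<close> unfolding uniformly_continuous_on_def by (metis half_gt_zero)
    have "(\<lambda>n. R * \<bar>1 / c n - 1\<bar>) \<longlonglongrightarrow> R * \<bar>1 / 1 - 1\<bar>"
      by (intro tendsto_intros c(3)) simp
    then have "\<forall>\<^sub>F n in sequentially. R * \<bar>1 / c n - 1\<bar> < d"
      using d(1) by (intro order_tendstoD(2)) auto
    then obtain n0 where n0: "\<And>n. n \<ge> n0 \<Longrightarrow> R * \<bar>1 / c n - 1\<bar> < d" by (auto simp: eventually_sequentially)
    have "norm (e1 n - 0) < \<eta>" if "n \<ge> n0" for n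
    proof -
      interpret \<nu>: prob_space "\<nu> n" using P2_D[OF \<nu>] by blast
      have pt: "\<bar>U (\<rho> (f n x) / c n) - V (\<rho> (f n x))\<bar> \<le> \<eta> / 2" if x: "x \<in> mspace (X n)" for x
      proof -
        have "\<rho> (f n x) / c n - \<rho> (f n x) = \<rho> (f n x) * (1 / c n - 1)" by (simp add: algebra_simps)
        then have "\<bar>\<rho> (f n x) / c n - \<rho> (f n x)\<bar> = \<bar>\<rho> (f n x)\<bar> * \<bar>1 / c n - 1\<bar>" by (simp only: abs_mult)
        also have "\<dots> \<le> R * \<bar>1 / c n - 1\<bar>" using R(2)[OF fX[OF x]] by (intro mult_right_mono) auto
        also have "\<dots> < d" using n0[OF \<open>n \<ge> n0\<close>] .
        finally have "dist (\<rho> (f n x) / c n) (\<rho> (f n x)) < d" by (simp add: dist_real_def)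
        then have "dist (U (\<rho> (f n x) / c n)) (U (\<rho> (f n x))) < \<eta> / 2"
          using d0[OF x] d2[OF x] R(1) R(2)[OF fX[OF x]] \<rho>(2)[OF fX[OF x]] by (intro d(2)) auto
        then show ?thesis using \<rho>(2)[OF fX[OF x]] by (simp add: V_def dist_real_def)
      qed
      have "\<bar>e1 n\<bar> = \<bar>\<integral>x. U (\<rho> (f n x) / c n) - V (\<rho> (f n x)) \<partial>\<nu> n\<bar>"
        using iU1[of n] iV[of n] by (simp add: e1_def)
      also have "\<dots> \<le> (\<integral>x. \<bar>U (\<rho> (f n x) / c n) - V (\<rho> (f n x))\<bar> \<partial>\<nu> n)" by (rule integral_abs_bound)
      also have "\<dots> \<le> (\<integral>x. \<eta> / 2 \<partial>\<nu> n)"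
        by (rule integral_mono) (use iU1[of n] iV[of n] pt in \<open>auto simp: P2_D[OF \<nu>]\<close>)
      also have "\<dots> = \<eta> / 2" by (simp add: \<nu>.prob_space)
      finally show ?thesis using \<open>\<eta> > 0\<close> by simp
    qed
    then show "\<exists>no. \<forall>n\<ge>no. norm (e1 n - 0) < \<eta>" by blast
  qed
  moreover have "(\<lambda>n. (\<integral>x. V (\<rho> (f n x)) \<partial>\<nu> n) - (\<integral>y. V (\<rho> y) \<partial>\<nu>')) \<longlonglongrightarrow> 0"
    using lim[OF V\<rho>] by (rule LIM_zero)
  ultimately have "(\<lambda>n. e1 n + ((\<integral>x. V (\<rho> (f n x)) \<partial>\<nu> n) - (\<integral>y. V (\<rho> y) \<partial>\<nu>'))) \<longlonglongrightarrow> 0 + 0"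
    by (rule tendsto_add)
  then have "(\<lambda>n. (\<integral>x. U (\<rho> (f n x) / c n) \<partial>\<nu> n) - (\<integral>y. U (\<rho> y) \<partial>\<nu>')) \<longlonglongrightarrow> 0"
    by (simp add: e1_def V_eq)
  then show "\<exists>e. e \<longlonglongrightarrow> 0 \<and>
      (\<forall>n. U_functional U (\<nu> n) (\<alpha> n) \<le> U_functional U \<nu>' (density \<nu>' (\<lambda>y. ennreal (\<rho> y))) + ereal (e n))"
    unfolding U1 U2 by (intro exI[of _ "\<lambda>n. (\<integral>x. U (\<rho> (f n x) / c n) \<partial>\<nu> n) - (\<integral>y. U (\<rho> y) \<partial>\<nu>')"]) simp
qed

lemma displacement_convex_cont_density:
  fixes X :: "nat \<Rightarrow> 'a metric" and Y :: "'b metric"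
  assumes Y: "compact_metric Y" and X: "\<And>n. compact_metric (X n)"
    and \<nu>: "\<And>n. \<nu> n \<in> P2 (X n)" and \<nu>': "\<nu>' \<in> P2 Y"
    and GH: "\<And>n. GH_approximation (\<epsilon> n) (X n) Y (f n)" and \<epsilon>: "\<epsilon> \<longlonglongrightarrow> 0"
    and w\<nu>: "weak_star_converges Y (\<lambda>n. distr (\<nu> n) (borel_metric Y) (f n)) \<nu>'"
    and F: "F \<subseteq> convex_nonlinearities" and lam: "\<And>U. U \<in> F \<Longrightarrow> lam U \<noteq> \<infinity>"
    and dc: "\<And>n \<mu>0 \<mu>1. \<lbrakk>\<mu>0 \<in> P2 (X n); \<mu>1 \<in> P2 (X n); measure_support (X n) \<mu>0 \<subseteq> measure_support (X n) (\<nu> n);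
      measure_support (X n) \<mu>1 \<subseteq> measure_support (X n) (\<nu> n)\<rbrakk> \<Longrightarrow> displacement_convex F lam (X n) (\<nu> n) \<mu>0 \<mu>1"
    and \<rho>0: "continuous_map (mtopology_of Y) euclideanreal \<rho>0" "\<And>y. y \<in> mspace Y \<Longrightarrow> 0 \<le> \<rho>0 y"
      "density \<nu>' (\<lambda>y. ennreal (\<rho>0 y)) \<in> P2 Y"
    and \<rho>1: "continuous_map (mtopology_of Y) euclideanreal \<rho>1" "\<And>y. y \<in> mspace Y \<Longrightarrow> 0 \<le> \<rho>1 y"
      "density \<nu>' (\<lambda>y. ennreal (\<rho>1 y)) \<in> P2 Y"
  shows "displacement_convex F lam Y \<nu>' (density \<nu>' (\<lambda>y. ennreal (\<rho>0 y))) (density \<nu>' (\<lambda>y. ennreal (\<rho>1 y)))"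
proof -
  interpret Y: compact_metric Y by fact
  have fm: "f n \<in> measurable (borel_metric (X n)) (borel_metric Y)" for n
    using GH[of n] by (simp add: GH_approximation_def)
  have c_lim: "(\<lambda>n. \<integral>x. \<rho> (f n x) \<partial>\<nu> n) \<longlonglongrightarrow> 1"
    if \<rho>: "continuous_map (mtopology_of Y) euclideanreal \<rho>" "\<And>y. y \<in> mspace Y \<Longrightarrow> 0 \<le> \<rho> y"
      "density \<nu>' (\<lambda>y. ennreal (\<rho> y)) \<in> P2 Y" for \<rho>
  proof -
    note \<rho>m = borel_measurable_continuous_map[OF \<rho>(1)]
    have "integral\<^sup>L \<nu>' \<rho> = integral\<^sup>L (density \<nu>' (\<lambda>y. ennreal (\<rho> y))) (\<lambda>_. 1)"
      using Y.integral_density_P2[OF \<nu>' \<rho>m _ \<rho>(2), of "\<lambda>_. 1"] by simp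
    also have "\<dots> = 1" using prob_space.prob_space[OF P2_D(2)[OF \<rho>(3)]] by simp
    finally show ?thesis
      using w\<nu>[unfolded weak_star_converges_def, rule_format, OF \<rho>(1)]
      by (simp add: integral_distr_P2[OF fm \<nu> \<rho>m])
  qed
  define c0 c1 where "c0 n = (\<integral>x. \<rho>0 (f n x) \<partial>\<nu> n)" and "c1 n = (\<integral>x. \<rho>1 (f n x) \<partial>\<nu> n)" for n
  have c: "c0 \<longlonglongrightarrow> 1" "c1 \<longlonglongrightarrow> 1" unfolding c0_def c1_def by (rule c_lim; fact)+
  have "\<forall>\<^sub>F n in sequentially. c0 n > 1/2 \<and> c1 n > 1/2"
    by (intro eventually_conj order_tendstoD(1)[OF c(1)] order_tendstoD(1)[OF c(2)]) auto
  then obtain N where N: "\<And>n. n \<ge> N \<Longrightarrow> c0 n > 1/2" "\<And>n. n \<ge> N \<Longrightarrow> c1 n > 1/2"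
    by (auto simp: eventually_sequentially)
  \<comment> \<open>The masses exceed 1/2 only eventually; the shift drops the finitely many other
    indices.\<close>
  define s where "s n = n + N" for n
  have s: "strict_mono s" by (auto simp: s_def strict_mono_def)
  define \<alpha> where "\<alpha> n = density (\<nu> (s n)) (\<lambda>x. ennreal (\<rho>0 (f (s n) x) / c0 (s n)))" for n
  define \<beta> where "\<beta> n = density (\<nu> (s n)) (\<lambda>x. ennreal (\<rho>1 (f (s n) x) / c1 (s n)))" for n
  have w': "weak_star_converges Y (\<lambda>n. distr (\<nu> (s n)) (borel_metric Y) (f (s n))) \<nu>'"
    using w\<nu> LIMSEQ_subseq_LIMSEQ[OF _ s] unfolding weak_star_converges_def by (fastforce simp: comp_def)
  have cs: "(\<lambda>n. c0 (s n)) \<longlonglongrightarrow> 1" "(\<lambda>n. c1 (s n)) \<longlonglongrightarrow> 1" "(\<lambda>n. \<epsilon> (s n)) \<longlonglongrightarrow> 0"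
    using LIMSEQ_subseq_LIMSEQ[OF c(1) s] LIMSEQ_subseq_LIMSEQ[OF c(2) s] LIMSEQ_subseq_LIMSEQ[OF \<epsilon> s] by (simp_all add: comp_def)
  have Ns: "c0 (s n) > 1/2" "c1 (s n) > 1/2" for n using N by (auto simp: s_def)
  have nonneg: "\<forall>y\<in>mspace Y. 0 \<le> \<rho>0 y" "\<forall>y\<in>mspace Y. 0 \<le> \<rho>1 y" using \<rho>0(2) \<rho>1(2) by blast+
  note pb0 = pullback_density[where X = "\<lambda>n. X (s n)" and \<nu> = "\<lambda>n. \<nu> (s n)" and f = "\<lambda>n. f (s n)" and c = "\<lambda>n. c0 (s n)" and \<alpha> = \<alpha>,
      OF Y X \<nu> \<nu>' fm w' \<rho>0(1) nonneg(1) \<rho>0(3) c0_def Ns(1) cs(1) \<alpha>_def]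
  note pb1 = pullback_density[where X = "\<lambda>n. X (s n)" and \<nu> = "\<lambda>n. \<nu> (s n)" and f = "\<lambda>n. f (s n)" and c = "\<lambda>n. c1 (s n)" and \<alpha> = \<beta>,
      OF Y X \<nu> \<nu>' fm w' \<rho>1(1) nonneg(2) \<rho>1(3) c1_def Ns(2) cs(2) \<beta>_def]
  show ?thesis
  proof (rule displacement_convex_limit[where X = "\<lambda>n. X (s n)" and \<nu> = "\<lambda>n. \<nu> (s n)" and f = "\<lambda>n. f (s n)" and \<epsilon> = "\<lambda>n. \<epsilon> (s n)" and \<alpha> = \<alpha> and \<beta> = \<beta>,
      OF Y X \<nu> \<nu>' GH cs(3) w'])
    show "displacement_convex F lam (X (s n)) (\<nu> (s n)) (\<alpha> n) (\<beta> n)" for n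
      by (rule dc[OF pb0(1) pb1(1) pb0(2) pb1(2)])
    show "\<alpha> n \<in> P2 (X (s n))" for n by (rule pb0(1))
    show "\<beta> n \<in> P2 (X (s n))" for n by (rule pb1(1))
    show "density \<nu>' (\<lambda>y. ennreal (\<rho>0 y)) \<in> P2 Y" "density \<nu>' (\<lambda>y. ennreal (\<rho>1 y)) \<in> P2 Y" by fact+
    show "weak_star_converges Y (\<lambda>n. distr (\<alpha> n) (borel_metric Y) (f (s n))) (density \<nu>' (\<lambda>y. ennreal (\<rho>0 y)))"
      by (rule pb0(3))
    show "weak_star_converges Y (\<lambda>n. distr (\<beta> n) (borel_metric Y) (f (s n))) (density \<nu>' (\<lambda>y. ennreal (\<rho>1 y)))"
      by (rule pb1(3))
    fix U assume "U \<in> F"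
    then have U: "U \<in> convex_nonlinearities" using F by blast
    show "\<exists>e. e \<longlonglongrightarrow> 0 \<and> (\<forall>n. U_functional U (\<nu> (s n)) (\<alpha> n) \<le> U_functional U \<nu>' (density \<nu>' (\<lambda>y. ennreal (\<rho>0 y))) + ereal (e n))"
      by (rule pb0(4)[OF U])
    show "\<exists>e. e \<longlonglongrightarrow> 0 \<and> (\<forall>n. U_functional U (\<nu> (s n)) (\<beta> n) \<le> U_functional U \<nu>' (density \<nu>' (\<lambda>y. ennreal (\<rho>1 y))) + ereal (e n))"
      by (rule pb1(4)[OF U])
  qed (use F lam in auto)
qed

text \<open>At scale \<delta> = 1 / (n + 1) the oscillation of a fixed continuous test function
  tends to 0 by uniform continuity, which gives weak convergence.\<close>

lemma (in compact_metric) mollify_sequence: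
  assumes \<mu>: "\<mu> \<in> P2 X" and \<nu>: "\<nu> \<in> P2 X" and supp: "measure_support X \<mu> \<subseteq> measure_support X \<nu>"
  obtains \<rho> where "\<And>n :: nat. continuous_map (mtopology_of X) euclideanreal (\<rho> n)" "\<And>n x. x \<in> mspace X \<Longrightarrow> 0 \<le> \<rho> n x"
    "\<And>n. density \<nu> (\<lambda>x. ennreal (\<rho> n x)) \<in> P2 X"
    "\<And>n U. U \<in> convex_nonlinearities \<Longrightarrow> U_functional U \<nu> (density \<nu> (\<lambda>x. ennreal (\<rho> n x))) \<le> U_functional U \<nu> \<mu>"
    "weak_star_converges X (\<lambda>n. density \<nu> (\<lambda>x. ennreal (\<rho> n x))) \<mu>"
proof -
  have "\<forall>n. \<exists>\<rho>. continuous_map (mtopology_of X) euclideanreal \<rho> \<and> (\<forall>x\<in>mspace X. 0 \<le> \<rho> x) \<and>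
    density \<nu> (\<lambda>x. ennreal (\<rho> x)) \<in> P2 X \<and>
    (\<forall>U\<in>convex_nonlinearities. U_functional U \<nu> (density \<nu> (\<lambda>x. ennreal (\<rho> x))) \<le> U_functional U \<nu> \<mu>) \<and>
    (\<forall>\<phi> \<eta>. continuous_map (mtopology_of X) euclideanreal \<phi> \<and>
        (\<forall>x\<in>mspace X. \<forall>y\<in>mspace X. mdist X x y < inverse (real (Suc n)) \<longrightarrow> \<bar>\<phi> x - \<phi> y\<bar> \<le> \<eta>)
      \<longrightarrow> \<bar>integral\<^sup>L (density \<nu> (\<lambda>x. ennreal (\<rho> x))) \<phi> - integral\<^sup>L \<mu> \<phi>\<bar> \<le> 2 * \<eta>)"
    (is "\<forall>n. \<exists>\<rho>. ?P n \<rho>")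
  proof
    fix n
    show "\<exists>\<rho>. ?P n \<rho>"
      by (rule mollify[OF assms, of "inverse (real (Suc n))"]) (simp, blast)
  qed
  then obtain \<rho> where \<rho>: "\<And>n. ?P n (\<rho> n)" by metis
  have "weak_star_converges X (\<lambda>n. density \<nu> (\<lambda>x. ennreal (\<rho> n x))) \<mu>"
    unfolding weak_star_converges_def
  proof (intro allI impI LIMSEQ_I)
    fix \<phi> and e :: real assume \<phi>: "continuous_map (mtopology_of X) euclideanreal \<phi>" and e: "e > 0"
    obtain d where d: "d > 0" "\<And>x y. \<lbrakk>x \<in> mspace X; y \<in> mspace X; mdist X x y < d\<rbrakk> \<Longrightarrow> \<bar>\<phi> x - \<phi> y\<bar> < e / 4"
      using uniformly_continuous[OF \<phi>, of "e / 4"] e by auto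
    obtain N where N: "inverse (real (Suc N)) < d" using reals_Archimedean[OF d(1)] by blast
    have "norm (integral\<^sup>L (density \<nu> (\<lambda>x. ennreal (\<rho> n x))) \<phi> - integral\<^sup>L \<mu> \<phi>) < e" if "n \<ge> N" for n
    proof -
      have "inverse (real (Suc n)) \<le> inverse (real (Suc N))" using that by (intro le_imp_inverse_le) auto
      then have "\<forall>x\<in>mspace X. \<forall>y\<in>mspace X. mdist X x y < inverse (real (Suc n)) \<longrightarrow> \<bar>\<phi> x - \<phi> y\<bar> \<le> e / 4"
        using d(2) N by (meson less_imp_le less_le_trans order_less_trans)
      then have "\<bar>integral\<^sup>L (density \<nu> (\<lambda>x. ennreal (\<rho> n x))) \<phi> - integral\<^sup>L \<mu> \<phi>\<bar> \<le> 2 * (e / 4)"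
        using \<rho>[of n] \<phi> by blast
      then show ?thesis using e by simp
    qed
    then show "\<exists>no. \<forall>n\<ge>no. norm (integral\<^sup>L (density \<nu> (\<lambda>x. ennreal (\<rho> n x))) \<phi> - integral\<^sup>L \<mu> \<phi>) < e" by blast
  qed
  with \<rho> show thesis by (intro that[of \<rho>]) blast+
qed

text \<open>The case of continuous densities supplies displacement convexity between mollified end
  points on Y. A second use of \<open>displacement_convex_limit\<close>, with all spaces equal to Y
  and the identity as approximation, removes the mollification; as it never increases the
  functionals, the errors at the end points can be taken to be 0.\<close>

theorem displacement_convex_stable:
  fixes X :: "nat \<Rightarrow> 'a metric" and Y :: "'b metric"
  assumes Y: "compact_metric Y" and X: "\<And>n. compact_metric (X n)"
    and \<nu>: "\<And>n. \<nu> n \<in> P2 (X n)" and \<nu>': "\<nu>' \<in> P2 Y" and mGH: "mGH_converges X \<nu> Y \<nu>'"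
    and F: "F \<subseteq> convex_nonlinearities" and lam: "\<And>U. U \<in> F \<Longrightarrow> lam U \<noteq> \<infinity>"
    and dc: "\<And>n \<mu>0 \<mu>1. \<lbrakk>\<mu>0 \<in> P2 (X n); \<mu>1 \<in> P2 (X n); measure_support (X n) \<mu>0 \<subseteq> measure_support (X n) (\<nu> n);
      measure_support (X n) \<mu>1 \<subseteq> measure_support (X n) (\<nu> n)\<rbrakk> \<Longrightarrow> displacement_convex F lam (X n) (\<nu> n) \<mu>0 \<mu>1"
    and \<mu>0: "\<mu>0 \<in> P2 Y" "measure_support Y \<mu>0 \<subseteq> measure_support Y \<nu>'"
    and \<mu>1: "\<mu>1 \<in> P2 Y" "measure_support Y \<mu>1 \<subseteq> measure_support Y \<nu>'"
  shows "displacement_convex F lam Y \<nu>' \<mu>0 \<mu>1"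
proof -
  interpret Y: compact_metric Y by fact
  obtain f \<epsilon> where GH: "\<And>n. GH_approximation (\<epsilon> n) (X n) Y (f n)" and \<epsilon>: "\<epsilon> \<longlonglongrightarrow> 0"
    and w\<nu>: "weak_star_converges Y (\<lambda>n. distr (\<nu> n) (borel_metric Y) (f n)) \<nu>'"
    using mGH unfolding mGH_converges_def by blast
  obtain \<rho>0 where \<rho>0: "\<And>n :: nat. continuous_map (mtopology_of Y) euclideanreal (\<rho>0 n)" "\<And>n x. x \<in> mspace Y \<Longrightarrow> 0 \<le> \<rho>0 n x"
    "\<And>n. density \<nu>' (\<lambda>x. ennreal (\<rho>0 n x)) \<in> P2 Y"
    "\<And>n U. U \<in> convex_nonlinearities \<Longrightarrow> U_functional U \<nu>' (density \<nu>' (\<lambda>x. ennreal (\<rho>0 n x))) \<le> U_functional U \<nu>' \<mu>0"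
    "weak_star_converges Y (\<lambda>n. density \<nu>' (\<lambda>x. ennreal (\<rho>0 n x))) \<mu>0"
    by (rule Y.mollify_sequence[OF \<mu>0(1) \<nu>' \<mu>0(2)]) (rule that)
  obtain \<rho>1 where \<rho>1: "\<And>n :: nat. continuous_map (mtopology_of Y) euclideanreal (\<rho>1 n)" "\<And>n x. x \<in> mspace Y \<Longrightarrow> 0 \<le> \<rho>1 n x"
    "\<And>n. density \<nu>' (\<lambda>x. ennreal (\<rho>1 n x)) \<in> P2 Y"
    "\<And>n U. U \<in> convex_nonlinearities \<Longrightarrow> U_functional U \<nu>' (density \<nu>' (\<lambda>x. ennreal (\<rho>1 n x))) \<le> U_functional U \<nu>' \<mu>1"
    "weak_star_converges Y (\<lambda>n. density \<nu>' (\<lambda>x. ennreal (\<rho>1 n x))) \<mu>1"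
    by (rule Y.mollify_sequence[OF \<mu>1(1) \<nu>' \<mu>1(2)]) (rule that)
  have distr_id: "distr M (borel_metric Y) (\<lambda>x. x) = M" if "M \<in> P2 Y" for M
    by (rule distr_id2) (simp add: P2_D[OF that])
  show ?thesis
  proof (rule displacement_convex_limit[where X = "\<lambda>_. Y" and \<nu> = "\<lambda>_. \<nu>'" and f = "\<lambda>_ x. x" and \<epsilon> = "\<lambda>_. 0"
        and \<alpha> = "\<lambda>n. density \<nu>' (\<lambda>x. ennreal (\<rho>0 n x))" and \<beta> = "\<lambda>n. density \<nu>' (\<lambda>x. ennreal (\<rho>1 n x))"])
    show "GH_approximation 0 Y Y (\<lambda>x. x)"
      by (auto simp: GH_approximation_def intro!: bexI)
    show "weak_star_converges Y (\<lambda>n. distr \<nu>' (borel_metric Y) (\<lambda>x. x)) \<nu>'"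
      by (simp add: distr_id[OF \<nu>'] weak_star_converges_def)
    show "weak_star_converges Y (\<lambda>n. distr (density \<nu>' (\<lambda>x. ennreal (\<rho>0 n x))) (borel_metric Y) (\<lambda>x. x)) \<mu>0"
      unfolding distr_id[OF \<rho>0(3)] by (rule \<rho>0(5))
    show "weak_star_converges Y (\<lambda>n. distr (density \<nu>' (\<lambda>x. ennreal (\<rho>1 n x))) (borel_metric Y) (\<lambda>x. x)) \<mu>1"
      unfolding distr_id[OF \<rho>1(3)] by (rule \<rho>1(5))
    show "displacement_convex F lam Y \<nu>' (density \<nu>' (\<lambda>x. ennreal (\<rho>0 n x))) (density \<nu>' (\<lambda>x. ennreal (\<rho>1 n x)))" for n
      by (rule displacement_convex_cont_density[OF Y X \<nu> \<nu>' GH \<epsilon> w\<nu> F lam dc \<rho>0(1,2,3) \<rho>1(1,2,3)])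
    fix U assume "U \<in> F"
    then have U: "U \<in> convex_nonlinearities" using F by blast
    show "\<exists>e. e \<longlonglongrightarrow> 0 \<and> (\<forall>n. U_functional U \<nu>' (density \<nu>' (\<lambda>x. ennreal (\<rho>0 n x))) \<le> U_functional U \<nu>' \<mu>0 + ereal (e n))"
      using \<rho>0(4)[OF U] by (intro exI[of _ "\<lambda>_. 0"]) (simp add: zero_ereal_def[symmetric])
    show "\<exists>e. e \<longlonglongrightarrow> 0 \<and> (\<forall>n. U_functional U \<nu>' (density \<nu>' (\<lambda>x. ennreal (\<rho>1 n x))) \<le> U_functional U \<nu>' \<mu>1 + ereal (e n))"
      using \<rho>1(4)[OF U] by (intro exI[of _ "\<lambda>_. 0"]) (simp add: zero_ereal_def[symmetric])
  qed (use Y \<nu>' \<mu>0 \<mu>1 \<rho>0(3) \<rho>1(3) F lam in auto)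
qed

section \<open>The two curvature conditions as instances of displacement convexity\<close>

lemma nonneg_N_Ricci_iff:
  "nonneg_N_Ricci N X \<nu> \<longleftrightarrow> (\<forall>\<mu>0\<in>P2 X. \<forall>\<mu>1\<in>P2 X.
     measure_support X \<mu>0 \<subseteq> measure_support X \<nu> \<and> measure_support X \<mu>1 \<subseteq> measure_support X \<nu> \<longrightarrow>
     displacement_convex (DC N) (\<lambda>_. 0) X \<nu> \<mu>0 \<mu>1)"
  unfolding nonneg_N_Ricci_def displacement_convex_def by simp

lemma inf_Ricci_ge_iff:
  "inf_Ricci_ge K X \<nu> \<longleftrightarrow> (\<forall>\<mu>0\<in>P2 X. \<forall>\<mu>1\<in>P2 X.
     measure_support X \<mu>0 \<subseteq> measure_support X \<nu> \<and> measure_support X \<mu>1 \<subseteq> measure_support X \<nu> \<longrightarrow>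
     displacement_convex DC_inf (lambda_K K) X \<nu> \<mu>0 \<mu>1)"
  unfolding inf_Ricci_ge_def displacement_convex_def ..

theorem theorem0p13:
  fixes X :: "nat \<Rightarrow> 'a metric" and \<nu> :: "nat \<Rightarrow> 'a measure"
    and X' :: "'b metric" and \<nu>' :: "'b measure"
  assumes "\<And>i. compact_measured_length_space (X i) (\<nu> i)"
    and "compact_space (mtopology_of X')" and "\<nu>' \<in> P2 X'"
    and "mGH_converges X \<nu> X' \<nu>'"
  shows "(\<forall>N::real. N \<ge> 1 \<longrightarrow> (\<forall>i. nonneg_N_Ricci N (X i) (\<nu> i)) \<longrightarrow> nonneg_N_Ricci N X' \<nu>') \<and>
    (\<forall>K::real. (\<forall>i. inf_Ricci_ge K (X i) (\<nu> i)) \<longrightarrow> inf_Ricci_ge K X' \<nu>')"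
proof -
  have X: "compact_metric (X i)" and \<nu>: "\<nu> i \<in> P2 (X i)" for i
    using assms(1)[of i] by (simp_all add: compact_measured_length_space_def compact_metric_def)
  have X': "compact_metric X'" using assms(2) by (simp add: compact_metric_def)
  note stable = displacement_convex_stable[OF X' X \<nu> assms(3,4)]
  have DC: "DC N \<subseteq> convex_nonlinearities" "DC_inf \<subseteq> convex_nonlinearities" for N
    by (auto simp: DC_def DC_inf_def)
  \<comment> \<open>A single value of r, here 1, bounds the infimum from above; the value
    -\<infinity> remains possible.\<close>
  have lam: "lambda_K K U \<noteq> \<infinity>" for K U
  proof -
    have "lambda_K K U \<le> ereal (K * (pressure U 1 / 1))"
      unfolding lambda_K_def by (rule INF_lower) simp
    then show ?thesis by auto
  qed
  show ?thesis
  proof (intro conjI allI impI)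
    fix N :: real assume "\<forall>i. nonneg_N_Ricci N (X i) (\<nu> i)"
    then have "displacement_convex (DC N) (\<lambda>_. 0) (X i) (\<nu> i) \<mu>0 \<mu>1"
      if "\<mu>0 \<in> P2 (X i)" "\<mu>1 \<in> P2 (X i)" "measure_support (X i) \<mu>0 \<subseteq> measure_support (X i) (\<nu> i)"
        "measure_support (X i) \<mu>1 \<subseteq> measure_support (X i) (\<nu> i)" for i \<mu>0 \<mu>1
      using that unfolding nonneg_N_Ricci_iff by blast
    from stable[OF DC(1) _ this] show "nonneg_N_Ricci N X' \<nu>'"
      unfolding nonneg_N_Ricci_iff by simp
  next
    fix K :: real assume "\<forall>i. inf_Ricci_ge K (X i) (\<nu> i)"
    then have "displacement_convex DC_inf (lambda_K K) (X i) (\<nu> i) \<mu>0 \<mu>1"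
      if "\<mu>0 \<in> P2 (X i)" "\<mu>1 \<in> P2 (X i)" "measure_support (X i) \<mu>0 \<subseteq> measure_support (X i) (\<nu> i)"
        "measure_support (X i) \<mu>1 \<subseteq> measure_support (X i) (\<nu> i)" for i \<mu>0 \<mu>1
      using that unfolding inf_Ricci_ge_iff by blast
    from stable[OF DC(2) lam this] show "inf_Ricci_ge K X' \<nu>'"
      unfolding inf_Ricci_ge_iff by simp
  qed
qed

end
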